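(* Let $(\Theta_\infty,\mathcal C_\infty)$ be formal data supported at infinity: an irregular class $\Theta_\infty$ at infinity together with a conjugacy class for each of its active circles. There is an open dense subset $S\subset\mathrm{SL}_2(\mathbb C)$ such that for all $A\in S$, $A\cdot\Theta_\infty$ only has a singularity at infinity (i.e. all its active circles are at infinity). Furthermore, for all $A\in S$, $$\Gamma^\infty(\Theta_\infty,\mathcal C_\infty)=\Gamma^\infty(A\cdot(\Theta_\infty,\mathcal C_\infty)),$$ as diagrams up to relabelling of the nodes.
   Context: **Circles.** For $a\in\mathbb P^1$ put $z_a=z-a$ if $a\in\mathbb C$ and $z_\infty=1/z$. An exponential factor at $a$ is a polynomial $q$ without constant term in $z_a^{-1/r}$; with $r\geq1$ minimal, $\mathrm{ram}(q)=r$, $\mathrm{Irr}(q)$ is its degree in $z_a^{-1/r}$, and $\mathrm{slope}(q)=\mathrm{Irr}(q)/\mathrm{ram}(q)$ (slope of $0$ is $0$). Its Galois conjugates are obtained by $z_a^{1/r}\mapsto\omega z_a^{1/r}$, $\omega^r=1$; the circle $\langle q\rangle_a$ is its Galois orbit. An irregular class at $\infty$ is a finitely supported function $\Theta_\infty:\langle q\rangle_\infty\mapsto n_{\langle q\rangle}\in\mathbb N$ on circles at infinity; the circles with $n_{\langle q\rangle}\ne0$ are active. Formal data at infinity consist of $\Theta_\infty$ and a conjugacy class $\mathcal C_{\langle q\rangle}\subset\mathrm{GL}_{n_{\langle q\rangle}}(\mathbb C)$ for each active circle (formal monodromy). (Modified) formal data on $\mathbb P^1$ are defined in the same way using circles at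 all points. **The diagram $\Gamma^\infty$.** Core nodes: the active circles $\langle q_1\rangle,\dots,\langle q_m\rangle$ (at infinity); with $\beta_i=\mathrm{ram}(q_i)$ and $A_{ij}=\sum\mathrm{slope}(q-q')$ (sum over all pairs of Galois conjugates $q$ of $q_i$, $q'$ of $q_j$), the edge multiplicities are $B_{ij}=A_{ij}-\beta_i\beta_j$ for $i\ne j$ and $B_{ii}=A_{ii}-\beta_i^2+1$. The full diagram $\Gamma^\infty(\Theta_\infty,\mathcal C_\infty)$ is obtained by gluing to each core node $i$ a leg, i.e. a type $A$ graph $v_1-\dots-v_k$ with simple edges, $v_1$ identified with $i$, where $k$ is the degree of the minimal polynomial of $\mathcal C_i$. **Action of $\mathrm{SL}_2(\mathbb C)$ on circles and formal data.** It is generated by elementary transformations: - Twist $T_\mu=\begin{pmatrix}1&\mu\\0&1\end{pmatrix}$: $\langle q\rangle_\infty\mapsto\langle q-\tfrac{\mu}{2}z^2\rangle_\infty$; circles at finite points are fixed. - Scaling $S_\mu=\begin{pmatrix}\mu^{-1}&0\\0&\mu\end{pmatrix}$, $\mu\ne 0$: the circle obtained from the change of variable $q(z)\mapsto q(z/\mu)$ (so a circle at $a$ goes to one at $\mu a$). - Fourier transform $F=\begin{pmatrix}0&1\\-1&0\end{pmatrix}$ (Legendre transform, with dual variable $\xi$ then renamed $z$): a circle $\langle q\rangle_\infty$ of slope $>1$, or $\langle q\rangle_a$ with $a\in\mathbb C$, $q\neq0$, goes to $\langle\tilde q\rangle_\infty$ where $\tilde q(\xi)=q(z)-\xi z$ with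 $z=z(\xi)$ determined by $dq/dz=\xi$ (keeping only positive powers of $\xi$); $\langle0\rangle_a\mapsto\langle-a\xi\rangle_\infty$; $\langle\alpha z\rangle_\infty\mapsto\langle0\rangle_\alpha$; and $\langle\alpha z+q\rangle_\infty$ with $0<\mathrm{slope}(q)<1$ goes to the circle $\langle\tilde q\rangle_\alpha$ at $\xi=\alpha$ given by the polar part of $\alpha z+q(z)-\xi z$ with $\xi=\alpha+dq/dz$. For general $A$, $A\cdot\langle q\rangle$ is obtained by factoring $A$ into elementary transformations (the result does not depend on the factorization). On formal data, multiplicities are transported along circles, and formal monodromy classes are transported up to sign and inversion (which does not affect legs): $T_\mu,S_\mu$ leave them unchanged; $F$ multiplies the class of an irregular circle by $(-1)^{\mathrm{Irr}}$ (with $\mathrm{Irr}=\mathrm{Irr}(q)$ for a circle $\langle\alpha z+q\rangle_\infty$ with $\alpha\in\mathbb C$ and $0<\mathrm{slope}(q)<1$), and transports the classes of circles $\langle0\rangle_a$, $\langle\alpha z\rangle_\infty$ via an orientation-reversing identification. *)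

theory Defs
  imports
    "HOL-Analysis.Analysis"
    "HOL-Library.Poly_Mapping"
    "HOL-Computational_Algebra.Formal_Laurent_Series"
    "Jordan_Normal_Form.Matrix"
begin

section \<open>Exponential factors\<close>

datatype P1 = Fin complex | Inf

text \<open>
  A finitely supported function \<open>q\<close> from positive rational exponents to the complex numbers
  stands for the sum of \<open>lookup q k \<cdot> z\<^sub>a\<^sup>-\<^sup>k\<close> over \<open>k\<close>, where \<open>z\<^sub>a = z - a\<close> for finite \<open>a\<close> and
  \<open>z\<^sub>\<infinity> = 1/z\<close>. So at infinity \<open>Poly_Mapping.single k c\<close> is \<open>c \<cdot> z\<^sup>k\<close>. The point \<open>a\<close> is not part of \<open>q\<close>.
\<close>

type_synonym puiseux = "rat \<Rightarrow>\<^sub>0 complex"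

definition exp_factor :: "puiseux \<Rightarrow> bool" where
  "exp_factor q \<longleftrightarrow> (\<forall>k\<in>Poly_Mapping.keys q. 0 < k)"

definition ram :: "puiseux \<Rightarrow> nat" where
  "ram q = (LEAST r. 1 \<le> r \<and> (\<forall>k\<in>Poly_Mapping.keys q. k * of_nat r \<in> \<int>))"

text \<open>\<open>expo q k\<close> is the exponent of \<open>z\<^sub>a\<^sup>-\<^sup>1\<^sup>/\<^sup>r\<close>, \<open>r = ram q\<close>, in the term of \<open>q\<close> of exponent \<open>k\<close>.\<close>

definition expo :: "puiseux \<Rightarrow> rat \<Rightarrow> nat" where
  "expo q k = nat \<lfloor>k * of_nat (ram q)\<rfloor>"

definition ramified_poly :: "puiseux \<Rightarrow> complex poly" where
  "ramified_poly q = (\<Sum>k\<in>Poly_Mapping.keys q. Polynomial.monom (Poly_Mapping.lookup q k) (expo q k))"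

definition irr :: "puiseux \<Rightarrow> nat" where
  "irr q = Polynomial.degree (ramified_poly q)"

definition slope :: "puiseux \<Rightarrow> rat" where
  "slope q = of_nat (irr q) / of_nat (ram q)"

text \<open>The substitution of \<open>\<omega> \<cdot> z\<^sub>a\<^sup>1\<^sup>/\<^sup>r\<close> for \<open>z\<^sub>a\<^sup>1\<^sup>/\<^sup>r\<close>, \<open>r = ram q\<close>, for any nonzero \<open>\<omega>\<close>.\<close>

definition subst_root :: "complex \<Rightarrow> puiseux \<Rightarrow> puiseux" where
  "subst_root \<omega> q = Poly_Mapping.mapp (\<lambda>k c. c * inverse \<omega> ^ expo q k) q"

definition galois_orbit :: "puiseux \<Rightarrow> puiseux set" where
  "galois_orbit q = {subst_root \<omega> q | \<omega>. \<omega> ^ ram q = 1}"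


section \<open>Circles and formal data\<close>

typedef circle = "{(a :: P1, galois_orbit q) | a q. exp_factor q}"
proof -
  have "exp_factor 0" by (simp add: exp_factor_def)
  then show ?thesis by blast
qed

definition circ :: "P1 \<Rightarrow> puiseux \<Rightarrow> circle" where
  "circ a q = Abs_circle (a, galois_orbit q)"

definition base_point :: "circle \<Rightarrow> P1" where
  "base_point c = fst (Rep_circle c)"

definition conjugates :: "circle \<Rightarrow> puiseux set" where
  "conjugates c = snd (Rep_circle c)"

definition circle_ram :: "circle \<Rightarrow> nat" where
  "circle_ram c = ram (SOME q. q \<in> conjugates c)"

definition is_conj_class :: "nat \<Rightarrow> complex mat set \<Rightarrow> bool" where
  "is_conj_class n C \<longleftrightarrow>
     (\<exists>M \<in> carrier_mat n n. invertible_mat M \<and> C = {N. similar_mat N M})"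

text \<open>The value of \<open>monodromy\<close> on circles that are not active is irrelevant.\<close>

record formal_data =
  multiplicity :: "circle \<Rightarrow> nat"
  monodromy :: "circle \<Rightarrow> complex mat set"

definition active :: "formal_data \<Rightarrow> circle set" where
  "active D = {c. multiplicity D c \<noteq> 0}"

definition is_formal_data :: "formal_data \<Rightarrow> bool" where
  "is_formal_data D \<longleftrightarrow> finite (active D) \<and>
     (\<forall>c\<in>active D. is_conj_class (multiplicity D c) (monodromy D c))"

definition supported_at_infinity :: "formal_data \<Rightarrow> bool" where
  "supported_at_infinity D \<longleftrightarrow> (\<forall>c\<in>active D. base_point c = Inf)"


section \<open>The diagram\<close>

definition A_num :: "circle \<Rightarrow> circle \<Rightarrow> rat" where
  "A_num c d = (\<Sum>q\<in>conjugates c. \<Sum>q'\<in>conjugates d. slope (q - q'))"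

definition B_num :: "circle \<Rightarrow> circle \<Rightarrow> rat" where
  "B_num c d =
     (if c = d then A_num c c - (of_nat (circle_ram c))\<^sup>2 + 1
      else A_num c d - of_nat (circle_ram c) * of_nat (circle_ram d))"

definition annihilates :: "complex poly \<Rightarrow> complex mat \<Rightarrow> bool" where
  "annihilates p M \<longleftrightarrow>
     (\<forall>i < dim_row M. \<forall>j < dim_row M.
        (\<Sum>k\<le>Polynomial.degree p. poly.coeff p k * (M ^\<^sub>m k) $$ (i, j)) = 0)"

definition minimal_poly :: "complex mat \<Rightarrow> complex poly" where
  "minimal_poly M =
     (ARG_MIN Polynomial.degree p. Polynomial.lead_coeff p = 1 \<and> annihilates p M)"

definition leg_length :: "complex mat set \<Rightarrow> nat" where
  "leg_length C = Polynomial.degree (minimal_poly (SOME M. M \<in> C))"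

text \<open>
  A diagram is a set of nodes with a multiplicity for each pair of nodes (the number of loops, if
  the two nodes agree). The multiplicities may be negative. The node \<open>(c, l)\<close> below is the node
  \<open>v\<^sub>l\<close> of the leg glued to \<open>c\<close>; so \<open>(c, 1)\<close> is the core node \<open>c\<close>.
\<close>

type_synonym 'v diagram = "'v set \<times> ('v \<Rightarrow> 'v \<Rightarrow> rat)"

definition full_diagram :: "formal_data \<Rightarrow> (circle \<times> nat) diagram" where
  "full_diagram D =
     ({(c, l). c \<in> active D \<and> 1 \<le> l \<and> l \<le> leg_length (monodromy D c)},
      (\<lambda>(c, l) (d, m).
         if l = 1 \<and> m = 1 then B_num c d
         else if c = d \<and> (m = l + 1 \<or> l = m + 1) then 1
         else 0))"

definition diagram_iso :: "'v diagram \<Rightarrow> 'w diagram \<Rightarrow> bool" where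
  "diagram_iso G H \<longleftrightarrow>
     (\<exists>f. bij_betw f (fst G) (fst H) \<and>
          (\<forall>x\<in>fst G. \<forall>y\<in>fst G. snd H (f x) (f y) = snd G x y))"


section \<open>Legendre transform\<close>

text \<open>
  Everything is expressed as a Laurent series in a root \<open>t\<close> of the local coordinate, \<open>z\<^sub>a = t\<^sup>r\<close>.
  \<open>coord a r\<close> is then the function \<open>z\<close> itself.
\<close>

definition coord :: "P1 \<Rightarrow> nat \<Rightarrow> complex fls" where
  "coord a r = (case a of Fin b \<Rightarrow> fls_const b + fls_X_intpow (int r)
                        | Inf \<Rightarrow> fls_X_intpow (- int r))"

definition expansion :: "puiseux \<Rightarrow> complex fls" where
  "expansion q = (\<Sum>k\<in>Poly_Mapping.keys q. fls_const (Poly_Mapping.lookup q k) * fls_X_intpow (- int (expo q k)))"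

text \<open>\<open>q\<close> is the polar part of \<open>W\<close>, a Laurent series in \<open>\<tau>\<close> where \<open>z\<^sub>b = \<tau>\<^sup>\<rho>\<close>. For \<open>b = \<infinity>\<close> these
  are the terms with a positive power of the variable.\<close>

definition is_polar_part :: "nat \<Rightarrow> complex fls \<Rightarrow> puiseux \<Rightarrow> bool" where
  "is_polar_part \<rho> W q \<longleftrightarrow> exp_factor q \<and>
     (\<forall>k>0. Poly_Mapping.lookup q k =
        (if k * of_nat \<rho> \<in> \<int> then fls_nth W (- \<lfloor>k * of_nat \<rho>\<rfloor>) else 0))"

text \<open>
  \<open>q\<close> is based at \<open>a\<close> in the variable \<open>z\<close> and \<open>q'\<close> at \<open>b\<close> in the dual variable \<open>\<xi>\<close>. The solution
  \<open>z(\<xi>)\<close> of \<open>dq/dz = \<xi>\<close> is a Puiseux series at \<open>b\<close>. It is given by a reparametrisation \<open>t = g(\<tau>)\<close>,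
  which also fixes the root of \<open>z\<^sub>a\<close> occurring in \<open>q\<close>, with \<open>\<xi>\<^sub>b = \<tau>\<^sup>\<rho>\<close>. Different choices of \<open>\<rho>\<close> and
  \<open>g\<close> give Galois conjugate results.
\<close>

definition legendre :: "P1 \<Rightarrow> puiseux \<Rightarrow> P1 \<Rightarrow> puiseux \<Rightarrow> bool" where
  "legendre a q b q' \<longleftrightarrow>
     (let Z = coord a (ram q);
          Q = expansion q;
          \<Xi> = fls_deriv Q / fls_deriv Z
      in \<exists>\<rho> g. 1 \<le> \<rho> \<and> g \<noteq> 0 \<and> fps_nth g 0 = 0 \<and>
            fls_compose_fps \<Xi> g = coord b \<rho> \<and>
            is_polar_part \<rho> (fls_compose_fps (Q - \<Xi> * Z) g) q')"


section \<open>Action of the special linear group\<close>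

datatype elementary = Twist complex | Scale complex | Fourier

fun elem_matrix :: "elementary \<Rightarrow> complex^2^2" where
  "elem_matrix (Twist \<mu>) = vector [vector [1, \<mu>], vector [0, 1]]"
| "elem_matrix (Scale \<mu>) = vector [vector [inverse \<mu>, 0], vector [0, \<mu>]]"
| "elem_matrix Fourier = vector [vector [0, 1], vector [-1, 0]]"

definition class_smult :: "complex \<Rightarrow> complex mat set \<Rightarrow> complex mat set" where
  "class_smult s C = (\<lambda>M. s \<cdot>\<^sub>m M) ` C"

definition class_inverse :: "complex mat set \<Rightarrow> complex mat set" where
  "class_inverse C = {N. \<exists>M\<in>C. inverts_mat M N \<and> inverts_mat N M}"

text \<open>
  \<open>elem_circle E c \<phi> d\<close>: the elementary transformation \<open>E\<close> maps the circle \<open>c\<close> to \<open>d\<close>, and the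
  formal monodromy class of \<open>c\<close> to its image under \<open>\<phi>\<close>. In the scaling rules \<open>\<omega>\<close> is a choice of
  \<open>ram q\<close>-th root of \<open>\<mu>\<close>, respectively \<open>1/\<mu>\<close>: substituting \<open>z/\<mu>\<close> for \<open>z\<close> turns \<open>z\<^sub>\<infinity>\<close> into \<open>\<mu> z\<^sub>\<infinity>\<close>, and
  \<open>z - a\<close> into \<open>(z - \<mu> a)/\<mu>\<close>. Reversing the orientation inverts the monodromy.
\<close>

inductive elem_circle ::
  "elementary \<Rightarrow> circle \<Rightarrow> (complex mat set \<Rightarrow> complex mat set) \<Rightarrow> circle \<Rightarrow> bool"
where
  twist_inf: "exp_factor q \<Longrightarrow>
    elem_circle (Twist \<mu>) (circ Inf q) id (circ Inf (q - Poly_Mapping.single 2 (\<mu> / 2)))"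
| twist_fin: "exp_factor q \<Longrightarrow>
    elem_circle (Twist \<mu>) (circ (Fin a) q) id (circ (Fin a) q)"
| scale_inf: "exp_factor q \<Longrightarrow> \<mu> \<noteq> 0 \<Longrightarrow> \<omega> ^ ram q = \<mu> \<Longrightarrow>
    elem_circle (Scale \<mu>) (circ Inf q) id (circ Inf (subst_root \<omega> q))"
| scale_fin: "exp_factor q \<Longrightarrow> \<mu> \<noteq> 0 \<Longrightarrow> \<omega> ^ ram q = inverse \<mu> \<Longrightarrow>
    elem_circle (Scale \<mu>) (circ (Fin a) q) id (circ (Fin (\<mu> * a)) (subst_root \<omega> q))"
| fourier_large_slope: "exp_factor q \<Longrightarrow> 1 < slope q \<Longrightarrow> legendre Inf q Inf q' \<Longrightarrow>
    elem_circle Fourier (circ Inf q) (class_smult ((-1) ^ irr q)) (circ Inf q')"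
| fourier_fin: "exp_factor q \<Longrightarrow> q \<noteq> 0 \<Longrightarrow> legendre (Fin a) q Inf q' \<Longrightarrow>
    elem_circle Fourier (circ (Fin a) q) (class_smult ((-1) ^ irr q)) (circ Inf q')"
| fourier_tame_fin:
    "elem_circle Fourier (circ (Fin a) 0) class_inverse (circ Inf (Poly_Mapping.single 1 (- a)))"
| fourier_tame_inf:
    "elem_circle Fourier (circ Inf (Poly_Mapping.single 1 \<alpha>)) class_inverse (circ (Fin \<alpha>) 0)"
| fourier_small_slope: "exp_factor q \<Longrightarrow> 0 < slope q \<Longrightarrow> slope q < 1 \<Longrightarrow>
    legendre Inf (Poly_Mapping.single 1 \<alpha> + q) (Fin \<alpha>) q' \<Longrightarrow>
    elem_circle Fourier (circ Inf (Poly_Mapping.single 1 \<alpha> + q)) (class_smult ((-1) ^ irr q))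
      (circ (Fin \<alpha>) q')"

definition elem_data :: "elementary \<Rightarrow> formal_data \<Rightarrow> formal_data \<Rightarrow> bool" where
  "elem_data E D D' \<longleftrightarrow>
     (\<forall>c \<phi> c'. elem_circle E c \<phi> c' \<longrightarrow>
        multiplicity D' c' = multiplicity D c \<and>
        (c \<in> active D \<longrightarrow> monodromy D' c' = \<phi> (monodromy D c))) \<and>
     (\<forall>c'\<in>active D'. \<exists>c\<in>active D. \<exists>\<phi>. elem_circle E c \<phi> c')"

definition SL2 :: "(complex^2^2) set" where
  "SL2 = {A. Determinants.det A = 1}"

text \<open>
  \<open>acts A D D'\<close>: \<open>D'\<close> is \<open>A \<cdot> D\<close>, computed by some factorization of \<open>A\<close> into elementary
  transformations; the rightmost factor acts first. The monodromy of \<open>D'\<close> is only determined on its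
  active circles.
\<close>

inductive acts :: "complex^2^2 \<Rightarrow> formal_data \<Rightarrow> formal_data \<Rightarrow> bool" where
  acts_one: "acts (Finite_Cartesian_Product.mat 1) D D"
| acts_step: "acts A D D' \<Longrightarrow> elem_matrix E \<in> SL2 \<Longrightarrow> elem_data E D' D'' \<Longrightarrow>
    acts (elem_matrix E ** A) D D''"

end

theory Submission
  imports Defs
begin

text \<open>
  An exponential factor \<open>q\<close> at \<open>a\<close> is encoded by the germ at infinity of the plane curve
  \<open>\<xi> = dq/dz\<close>, parametrised by Laurent series \<open>(z(t), \<xi>(t))\<close>. Twists, scalings and the Fourier
  transform act on germs by linear maps of the \<open>(z, \<xi>)\<close>-plane, namely by the matrix that is
  contragredient to the given one. Let \<open>M\<close> be the maximal pole order of \<open>z(t)\<close> and \<open>\<xi>(t)\<close>. Two germs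
  are equivalent if they agree modulo \<open>t\<^sup>M\<close> after a reparametrisation; this is a linearly invariant
  notion, and circles are the same thing as equivalence classes of the germs above. Hence the
  circle \<open>A \<cdot> c\<close> does not depend on the factorization of \<open>A\<close>, and for generic \<open>A\<close> the function \<open>z\<close>
  still has a pole after the transformation, so that \<open>A \<cdot> c\<close> is at infinity.

  For the edge multiplicities, consider two germs and the curves \<open>z(t) = z(s)\<close> and \<open>z'(t) = z'(s)\<close> in
  the \<open>(t, s)\<close>-plane, where \<open>z' = \<alpha> z + \<beta> \<xi>\<close> and \<open>\<beta> \<noteq> 0\<close>. On the first curve \<open>z'(t) - z'(s)\<close> is a
  multiple of \<open>\<xi>(t) - \<xi>(s)\<close>, whose total order is \<open>B\<^sub>i\<^sub>j\<close> up to sign and terms symmetric in the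
  ramification numbers before and after the transformation. The same holds for the second curve and
  the transformed germs, and the intersection number of the two curves is symmetric.
\<close>

text \<open>Why the precision is t^M: write z = a + t^s, with a = 0 and s = -N at infinity. The
  factor q fixes xi modulo t^(-s), with z exact. A substitution t + O(t^(1+M-s)) moves z by O(t^M)
  and xi, whose pole order is at most M, by O(t^(-s)). So the two precisions can be traded for one
  another, and the uniform one does not single out a coordinate. The trade needs s < M, which fails
  only for the tame circles at finite points; these are handled apart. The Fourier transform is a
  quarter turn of the curve because d(q - xi z) = - z dxi. The obstacle is ramification: the rules
  allow a nonminimal root of the dual coordinate, and minimality is obtained by carrying a
  hypothetical covering back to the germ of q. For loops the two curves share the diagonal t = s.
  Leaving it out costs one intersection per remaining branch, which is absorbed by the terms -beta^2
  + 1 of the loop number. Since the action is given by a relation, existence of the result,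
  uniqueness of preimages and uniqueness of the map on monodromy all have to be proved.\<close>

no_notation index_mat (infixl "$$" 100) and vec_index (infixl "$" 100) and fps_nth (infixl "$" 75)
notation fls_nth (infixl "$$" 75)

section \<open>Substitution in Laurent series and congruences modulo powers of t\<close>

abbreviation fls_comp :: "complex fls \<Rightarrow> complex fps \<Rightarrow> complex fls" (infixl "\<diamondop>" 68)
  where "F \<diamondop> G \<equiv> fls_compose_fps F G"

text \<open>Phrased by coefficients because the subdegree of 0 is 0: in this form 0 belongs to every
  t^n C[[t]], and congruences need no case distinction.\<close>

definition ordge :: "int \<Rightarrow> 'a::zero fls \<Rightarrow> bool" where
  "ordge n f \<longleftrightarrow> (\<forall>j<n. f $$ j = 0)"

lemma ordge_iff: "ordge n f \<longleftrightarrow> f = 0 \<or> n \<le> fls_subdegree f"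
  unfolding ordge_def
  by (metis fls_eq0_below_subdegree fls_subdegree_geI fls_zero_nth linorder_not_le
      nth_fls_subdegree_nonzero order_less_le_trans)

lemma ordge_0 [simp]: "ordge n 0"
  by (simp add: ordge_def)

lemma ordge_mono: "ordge n f \<Longrightarrow> m \<le> n \<Longrightarrow> ordge m f"
  by (simp add: ordge_def)

lemma ordge_add: "ordge n f \<Longrightarrow> ordge n g \<Longrightarrow> ordge n (f + g :: complex fls)"
  by (simp add: ordge_def)

lemma ordge_diff: "ordge n f \<Longrightarrow> ordge n g \<Longrightarrow> ordge n (f - g :: complex fls)"
  by (simp add: ordge_def)

lemma ordge_uminus: "ordge n f \<Longrightarrow> ordge n (- f :: complex fls)"
  by (simp add: ordge_def)

lemma ordge_minus_commute: "ordge n (f - g) \<longleftrightarrow> ordge n (g - f :: complex fls)"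
  by (auto simp: ordge_def)

lemma ordge_trans: "ordge n (f - g) \<Longrightarrow> ordge n (g - h) \<Longrightarrow> ordge n (f - h :: complex fls)"
  by (simp add: ordge_def)

lemma ordge_mult: "ordge m f \<Longrightarrow> ordge n g \<Longrightarrow> ordge (m + n) (f * g :: complex fls)"
  by (cases "f = 0"; cases "g = 0") (simp_all add: ordge_iff)

lemma ordge_sum: "(\<And>i. i \<in> I \<Longrightarrow> ordge n (f i)) \<Longrightarrow> ordge n (sum f I :: complex fls)"
  by (induction I rule: infinite_finite_induct) (auto intro: ordge_add)

lemma ordge_const_mult: "ordge n f \<Longrightarrow> ordge n (fls_const c * f :: complex fls)"
  by (simp add: ordge_def)

lemma fps_nth_0_if_subdegree: "subdegree (G :: complex fps) \<noteq> 0 \<Longrightarrow> G \<noteq> 0 \<and> fps_nth G 0 = 0"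
  by (metis nth_less_subdegree_zero subdegree_0 neq0_conv)

lemma ordge_compose:
  assumes "subdegree G = 1"
  shows "ordge n (F \<diamondop> G) \<longleftrightarrow> ordge n F"
  using fps_nth_0_if_subdegree[of G] assms
  by (simp add: ordge_iff fls_compose_fps_eq_0_iff)

lemma X_intpow_compose:
  assumes "G \<noteq> 0" "fps_nth G 0 = 0"
  shows "fls_X_intpow n \<diamondop> G = fps_to_fls G powi n"
  by (simp add: fls_compose_fps_def fls_X_intpow_base_factor_to_fps)

lemma fps_X_power_dvd_power_diff:
  fixes a b :: "complex fps"
  assumes "fps_X ^ n dvd a - b"
  shows "fps_X ^ n dvd a ^ k - b ^ k"
proof -
  have "a - b dvd a ^ k - b ^ k"
    by (metis dvd_triv_left power_diff_sumr2)
  then show ?thesis using assms dvd_trans by blast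
qed

lemma fps_X_power_dvd_iff_nth:
  "fps_X ^ n dvd (f :: complex fps) \<longleftrightarrow> (\<forall>k<n. fps_nth f k = 0)"
proof (cases "f = 0")
  case False
  have "fps_X ^ n dvd f \<longleftrightarrow> n \<le> subdegree f"
    using fps_dvd_iff[of "fps_X ^ n" f] False by simp
  also have "\<dots> \<longleftrightarrow> (\<forall>k<n. fps_nth f k = 0)"
    by (meson False nth_less_subdegree_zero nth_subdegree_nonzero order_less_le_trans subdegree_geI)
  finally show ?thesis .
qed simp

lemma fps_X_power_dvd_compose_diff:
  fixes a b c :: "complex fps"
  assumes "fps_X ^ n dvd a - b"
  shows "fps_X ^ n dvd (c oo a) - (c oo b)"
proof -
  have "fps_nth (c oo a) k = fps_nth (c oo b) k" if "k < n" for k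
  proof -
    have "fps_nth (a ^ i) k = fps_nth (b ^ i) k" for i
      using fps_X_power_dvd_power_diff[OF assms, of i] that
      by (simp add: fps_X_power_dvd_iff_nth)
    then show ?thesis by (simp add: fps_compose_nth)
  qed
  then show ?thesis by (simp add: fps_X_power_dvd_iff_nth)
qed

lemma fps_inv_subdegree:
  fixes A :: "complex fps"
  assumes "subdegree A = 1"
  shows "subdegree (fps_inv A) = 1" "fps_inv A oo A = fps_X" "A oo fps_inv A = fps_X"
proof -
  have A: "fps_nth A 0 = 0" "fps_nth A 1 \<noteq> 0"
    using assms by (metis fps_nth_0_if_subdegree one_neq_zero, metis assms nth_subdegree_zero_iff one_neq_zero subdegree_0)
  show 1: "fps_inv A oo A = fps_X" "A oo fps_inv A = fps_X"
    using fps_inv[OF A] fps_inv_right[OF A] by auto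
  have "subdegree (fps_inv A oo A) = subdegree (fps_inv A) * subdegree A"
    by (rule subdegree_fps_compose) (use A in auto)
  then show "subdegree (fps_inv A) = 1" using 1 assms by simp
qed

text \<open>A series of order 1 is a local coordinate, and composing with its inverse undoes it.
  Hence contact orders do not depend on the coordinate in which they are measured.\<close>

lemma fps_X_power_dvd_compose_diff_iff:
  fixes a b c :: "complex fps"
  assumes "subdegree c = 1" "fps_nth a 0 = 0" "fps_nth b 0 = 0"
  shows "fps_X ^ n dvd (c oo a) - (c oo b) \<longleftrightarrow> fps_X ^ n dvd a - b"
proof
  assume "fps_X ^ n dvd (c oo a) - (c oo b)"
  then have "fps_X ^ n dvd (fps_inv c oo (c oo a)) - (fps_inv c oo (c oo b))"
    by (rule fps_X_power_dvd_compose_diff)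
  moreover have "fps_inv c oo (c oo d) = d" if "fps_nth d 0 = 0" for d
    using fps_compose_assoc[OF that, of c "fps_inv c"] fps_inv_subdegree[OF assms(1)]
      fps_nth_0_if_subdegree[of c] assms(1) that by simp
  ultimately show "fps_X ^ n dvd a - b" using assms by simp
qed (rule fps_X_power_dvd_compose_diff)

lemma subdegree_eq_if_fps_X_power_dvd_iff:
  fixes a b :: "complex fps"
  assumes "\<And>n. fps_X ^ n dvd a \<longleftrightarrow> fps_X ^ n dvd b"
  shows "subdegree a = subdegree b" "a = 0 \<longleftrightarrow> b = 0"
proof -
  have 0: "f = 0 \<longleftrightarrow> (\<forall>n. fps_X ^ n dvd f)" for f :: "complex fps"
    by (auto simp: fps_X_power_dvd_iff_nth fps_eq_iff)
  show z: "a = 0 \<longleftrightarrow> b = 0" unfolding 0 using assms by simp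
  show "subdegree a = subdegree b"
  proof (cases "a = 0")
    case False
    then have "n \<le> subdegree a \<longleftrightarrow> n \<le> subdegree b" for n
      using assms[of n] z by (simp add: fps_dvd_iff)
    then show ?thesis by (meson order_antisym order_refl)
  qed (use z in auto)
qed

lemma subdegree_compose_diff:
  fixes a b c :: "complex fps"
  assumes "subdegree c = 1" "fps_nth a 0 = 0" "fps_nth b 0 = 0"
  shows "subdegree ((c oo a) - (c oo b)) = subdegree (a - b)"
  by (rule subdegree_eq_if_fps_X_power_dvd_iff) (simp add: fps_X_power_dvd_compose_diff_iff assms)

lemma ordge_fps_to_fls: "ordge (int n) (fps_to_fls f) \<longleftrightarrow> fps_X ^ n dvd (f :: complex fps)"
proof -
  have "ordge (int n) (fps_to_fls f) \<longleftrightarrow> (\<forall>k<n. fps_nth f k = 0)"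
  proof
    assume "ordge (int n) (fps_to_fls f)"
    then have "fps_to_fls f $$ int k = 0" if "k < n" for k
      unfolding ordge_def using that by (meson of_nat_less_iff)
    then show "\<forall>k<n. fps_nth f k = 0" by simp
  next
    assume *: "\<forall>k<n. fps_nth f k = 0"
    show "ordge (int n) (fps_to_fls f)" unfolding ordge_def
    proof (intro allI impI)
      fix j assume "j < int n"
      then show "fps_to_fls f $$ j = 0"
        using * by (cases "j < 0") (auto simp: zless_nat_eq_int_zless)
    qed
  qed
  then show ?thesis by (simp add: fps_X_power_dvd_iff_nth)
qed

lemma ordge_power_int_minus_one:
  fixes u :: "complex fls"
  assumes "fls_subdegree u = 0" "u \<noteq> 0" "ordge p (u - 1)"
  shows "ordge p (u powi n - 1)"
proof -
  have nat: "ordge p (v ^ k - 1)" if "ordge 0 v" "ordge p (v - 1)" for v :: "complex fls" and k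
  proof -
    have "ordge 0 (v ^ i)" for i
    proof (induction i)
      case (Suc i)
      then show ?case using ordge_mult[OF that(1)] by simp
    qed (simp add: ordge_iff)
    then have "ordge 0 (\<Sum>i<k. v ^ i)"
      by (intro ordge_sum) auto
    then have "ordge (p + 0) ((v - 1) * (\<Sum>i<k. v ^ i))"
      using that ordge_mult by blast
    then show ?thesis by (simp add: power_diff_1_eq)
  qed
  have u0: "ordge 0 u" "ordge 0 (inverse u)" using assms by (auto simp: ordge_iff)
  have "inverse u - 1 = - ((u - 1) * inverse u)" using assms by (simp add: field_simps)
  then have "ordge p (inverse u - 1)"
    using ordge_uminus[OF ordge_mult[OF assms(3) u0(2)]] by simp
  then show ?thesis using nat u0 assms(3) by (auto simp: power_int_def)
qed

text \<open>With G = u t, u = 1 + O(t^p), and f = F t^d, the change consists of the factor u^d and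
  of F o G - F, both O(t^p). So a substitution that is the identity to relative order p preserves
  every series to relative order p, whatever its pole. This is the mechanism by which precision
  moves between the two coordinates.\<close>

lemma ordge_compose_near_id:
  fixes G :: "complex fps" and f :: "complex fls"
  assumes "subdegree G = 1" "ordge (1 + int p) (fps_to_fls G - fls_X)" "ordge s f"
  shows "ordge (s + int p) (f \<diamondop> G - f)"
proof (cases "f = 0")
  case False
  define d where "d = fls_subdegree f"
  have d: "s \<le> d" using assms(3) False by (simp add: ordge_iff d_def)
  define F where "F = fls_base_factor_to_fps f"
  note G = fps_nth_0_if_subdegree[of G, unfolded assms(1), simplified]
  define u where "u = fps_to_fls G / fls_X"
  have X: "(fls_X :: complex fls) \<noteq> 0" by simp
  have Gu: "fps_to_fls G = u * fls_X"
    by (simp only: u_def times_divide_eq_left nonzero_mult_div_cancel_right[OF X])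
  have u: "u \<noteq> 0" "fls_subdegree u = 0"
    using G assms(1) by (auto simp: u_def fls_subdegree_fls_to_fps divide_inverse)
  have "u - 1 = inverse fls_X * (fps_to_fls G - fls_X)"
    by (simp only: u_def divide_inverse right_diff_distrib left_inverse[OF X]) (simp only: mult.commute)
  moreover have "ordge (- 1) (inverse fls_X :: complex fls)" by (simp add: ordge_iff)
  ultimately have "ordge (int p) (u - 1)" using ordge_mult[OF _ assms(2), of "-1"] by simp
  then have up: "ordge (int p) (u powi d - 1)" using u by (intro ordge_power_int_minus_one) auto
  have "ordge (int (Suc p)) (fps_to_fls (G - fps_X))" using assms(2) by simp
  then have "fps_X ^ Suc p dvd G - fps_X" by (simp only: ordge_fps_to_fls)
  then have "fps_X ^ Suc p dvd (F oo G) - (F oo fps_X)" by (rule fps_X_power_dvd_compose_diff)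
  then have "ordge (int (Suc p)) (fps_to_fls ((F oo G) - F))" by (simp only: ordge_fps_to_fls fps_compose_fps_X)
  then have Fp: "ordge (int p) (fps_to_fls (F oo G) - fps_to_fls F)"
    unfolding fps_to_fls_minus by (rule ordge_mono) simp
  have f: "f = fps_to_fls F * fls_X powi d"
    using fls_conv_base_factor_to_fps_shift_subdegree[of f]
    by (simp add: F_def d_def fls_X_intpow_times_conv_shift)
  have "f \<diamondop> G - f = fps_to_fls (F oo G) * fps_to_fls G powi d - fps_to_fls F * fls_X powi d"
    using f unfolding fls_compose_fps_def F_def[symmetric] d_def[symmetric] by simp
  also have "\<dots> = (fps_to_fls (F oo G) * (u powi d - 1) + (fps_to_fls (F oo G) - fps_to_fls F)) * fls_X powi d"
    by (simp add: Gu power_int_mult_distrib algebra_simps)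
  finally have eq: "f \<diamondop> G - f = \<dots>" .
  have "ordge 0 (fps_to_fls (F oo G))" by (simp add: ordge_iff fls_subdegree_fls_to_fps)
  then have "ordge (int p) (fps_to_fls (F oo G) * (u powi d - 1) + (fps_to_fls (F oo G) - fps_to_fls F))"
    using ordge_mult[OF _ up, of 0] Fp by (auto intro: ordge_add)
  moreover have "ordge d (fls_X powi d :: complex fls)" by (simp add: ordge_iff)
  ultimately have "ordge (int p + d) (f \<diamondop> G - f)" unfolding eq by (rule ordge_mult)
  then show ?thesis by (rule ordge_mono) (use d in auto)
qed auto

lemma subdegree_nonzeroD:
  assumes "subdegree (G :: complex fps) \<noteq> 0"
  shows "G \<noteq> 0" "fps_nth G 0 = 0"
  using fps_nth_0_if_subdegree[OF assms] by auto

lemma subdegree_1D: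
  assumes "subdegree (G :: complex fps) = 1"
  shows "G \<noteq> 0" "fps_nth G 0 = 0" "subdegree G \<noteq> 0"
  using subdegree_nonzeroD[of G] assms by simp_all

lemma fls_comp_assoc:
  assumes "subdegree G \<noteq> 0" "subdegree H \<noteq> 0"
  shows "F \<diamondop> G \<diamondop> H = F \<diamondop> (G oo H)"
  using subdegree_nonzeroD[OF assms(1)] subdegree_nonzeroD[OF assms(2)] by (intro fls_compose_fps_assoc) auto

lemma fls_comp_X [simp]: "F \<diamondop> fps_X = F"
proof -
  have "fls_base_factor_to_fps F oo fps_X = fls_base_factor_to_fps F" by simp
  then show ?thesis
    using fls_conv_base_factor_to_fps_shift_subdegree[of F]
    by (simp add: fls_compose_fps_def fls_X_intpow_times_conv_shift)
qed

lemma subdegree_comp: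
  fixes F G :: "complex fps"
  assumes "subdegree G \<noteq> 0"
  shows "subdegree (F oo G) = subdegree F * subdegree G"
  using subdegree_nonzeroD[OF assms] by (intro subdegree_fps_compose)

lemma fls_subdegree_comp:
  assumes "subdegree G \<noteq> 0"
  shows "fls_subdegree (F \<diamondop> G) = fls_subdegree F * int (subdegree G)"
  using subdegree_nonzeroD[OF assms] by (intro subdegree_fls_compose_fps)

lemma fls_comp_eq_0_iff: "subdegree G \<noteq> 0 \<Longrightarrow> F \<diamondop> G = 0 \<longleftrightarrow> F = 0"
  by (rule fls_compose_fps_eq_0_iff; erule subdegree_nonzeroD)

lemmas fls_comp_simps =
  fls_compose_fps_add[OF subdegree_nonzeroD] fls_compose_fps_diff[OF subdegree_nonzeroD]
  fls_compose_fps_mult[OF subdegree_nonzeroD] fls_compose_fps_powi[OF subdegree_nonzeroD]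

section \<open>Local coordinates in which a series becomes a pure power\<close>

lemma fps_nth_power_root:
  fixes u :: "complex fps"
  assumes "n > 0" "fps_nth u 0 \<noteq> 0"
  shows "\<exists>v. v ^ n = u \<and> fps_nth v 0 \<noteq> 0 \<and> (fps_nth u 0 = 1 \<longrightarrow> fps_nth v 0 = 1)"
proof -
  obtain k where k: "n = Suc k" using assms(1) gr0_implies_Suc by blast
  \<comment> \<open>The branch with constant term 1 is taken whenever it is available. Otherwise a
    series close to t^s could yield a coordinate close to a rotation of t instead of t
    itself.\<close>
  define c where "c = (if fps_nth u 0 = 1 then 1 else (SOME z. z ^ n = fps_nth u 0))"
  have c: "c ^ n = fps_nth u 0"
  proof (cases "fps_nth u 0 = 1")
    case False
    have "\<exists>z::complex. z ^ n = fps_nth u 0"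
      by (metis (mono_tags, lifting) assms card_eq_0_iff card_nth_roots ex_in_conv less_numeral_extra(3) mem_Collect_eq)
    then show ?thesis unfolding c_def using False by (auto intro: someI)
  qed (simp add: c_def)
  define v where "v = fps_radical (\<lambda>_ _. c) n u"
  have "v ^ n = u" unfolding v_def using power_radical[OF assms(2), of "\<lambda>_ _. c" k] c k by simp
  moreover have "fps_nth v 0 = c" using assms(1) by (simp add: v_def)
  moreover have "c \<noteq> 0" using c assms by (metis power_eq_0_iff)
  ultimately show ?thesis by (auto simp: c_def)
qed

text \<open>The coordinate is t v, where v is an n-th root, n = |s|, of the unit part of f, or of
  its inverse when s < 0. The last clause holds because v^n - 1 = (v - 1)(1 + ... + v^(n-1)), whose
  second factor is a unit with constant term n once v starts with 1.\<close>

lemma normal_form: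
  fixes f :: "complex fls"
  assumes "f \<noteq> 0" "fls_subdegree f \<noteq> 0"
  shows "\<exists>A. subdegree A = 1 \<and> fls_X_intpow (fls_subdegree f) \<diamondop> A = f \<and>
     (\<forall>p. 1 \<le> p \<longrightarrow> ordge (fls_subdegree f + int p) (f - fls_X_intpow (fls_subdegree f)) \<longrightarrow>
        ordge (1 + int p) (fps_to_fls A - fls_X))"
proof -
  define s where "s = fls_subdegree f"
  define n where "n = nat \<bar>s\<bar>"
  have n: "n > 0" using assms by (simp add: n_def s_def)
  define u where "u = (if s > 0 then fls_base_factor_to_fps f else inverse (fls_base_factor_to_fps f))"
  have B0: "fps_nth (fls_base_factor_to_fps f) 0 \<noteq> 0" using assms(1) by simp
  then have u0: "fps_nth u 0 \<noteq> 0" by (simp add: u_def)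
  obtain v where v: "v ^ n = u" "fps_nth v 0 \<noteq> 0" "fps_nth u 0 = 1 \<longrightarrow> fps_nth v 0 = 1"
    using fps_nth_power_root[OF n u0] by blast
  define A where "A = fps_X * v"
  have "v \<noteq> 0" using v(2) by auto
  then have A1: "subdegree A = 1" using v(2) by (simp add: A_def subdegree_eq_0_iff subdegree_mult)
  then have A0: "A \<noteq> 0" "fps_nth A 0 = 0" by (rule subdegree_1D)+
  have V: "fps_to_fls v powi s = fps_to_fls (fls_base_factor_to_fps f)"
  proof (cases "s > 0")
    case True
    then have "fps_to_fls v powi s = fps_to_fls v ^ n" by (simp add: power_int_def n_def)
    also have "\<dots> = fps_to_fls u" using v(1) by (simp flip: fps_to_fls_power)
    finally show ?thesis using True by (simp add: u_def)
  next
    case False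
    then have "fps_to_fls v powi s = inverse (fps_to_fls v ^ n)"
      by (simp add: power_int_def n_def power_inverse)
    also have "\<dots> = inverse (fps_to_fls u)" using v(1) by (simp flip: fps_to_fls_power)
    also have "\<dots> = fps_to_fls (inverse u)" using u0 by (simp add: fls_inverse_fps_to_fls subdegree_eq_0_iff)
    finally show ?thesis using False B0 by (simp add: u_def)
  qed
  have f: "f = fls_X powi s * fps_to_fls v powi s"
    unfolding V using fls_conv_base_factor_to_fps_shift_subdegree[of f]
    by (simp add: s_def fls_X_intpow_times_conv_shift)
  also have "\<dots> = fps_to_fls A powi s"
    by (simp only: A_def fls_times_fps_to_fls fps_X_to_fls power_int_mult_distrib)
  also have "\<dots> = fls_X_intpow s \<diamondop> A"
    using A0 by (rule X_intpow_compose[symmetric])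
  finally have fA: "fls_X_intpow s \<diamondop> A = f" by simp
  have "ordge (1 + int p) (fps_to_fls A - fls_X)"
    if p: "1 \<le> p" and o: "ordge (s + int p) (f - fls_X_intpow s)" for p
  proof -
    have "f - fls_X_intpow s = (fps_to_fls v powi s - 1) * fls_X powi s"
      by (subst f) (simp only: fls_X_power_int left_diff_distrib mult_1_left mult.commute[of _ "fps_to_fls v powi s"])
    then have "fps_to_fls v powi s - 1 = fls_X powi (- s) * (f - fls_X_intpow s)"
      by (simp add: power_int_minus field_simps)
    moreover have "ordge (- s) (fls_X powi (- s) :: complex fls)" by (simp add: ordge_iff)
    ultimately have vp: "ordge (int p) (fps_to_fls v powi s - 1)"
      using ordge_mult[OF _ o, of "- s"] by simp
    have "(fps_to_fls v powi s - 1) $$ 0 = 0" using vp p by (simp add: ordge_def)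
    then have "fps_nth (fls_base_factor_to_fps f) 0 = 1" by (simp add: V)
    then have "fps_nth u 0 = 1" by (simp add: u_def)
    then have v1: "fps_nth v 0 = 1" using v(3) by simp
    have w: "fls_subdegree (fps_to_fls v powi s) = 0" "fps_to_fls v powi s \<noteq> 0"
      using v(2) by (auto simp: fls_subdegree_fls_to_fps subdegree_eq_0_iff power_int_eq_0_iff)
    have "(fps_to_fls v powi s) powi (sgn s) = fps_to_fls v ^ n"
      using n by (cases "s > 0") (auto simp: n_def power_int_def power_inverse)
    then have "ordge (int p) (fps_to_fls (v ^ n - 1))"
      using ordge_power_int_minus_one[OF w vp, of "sgn s"] by (simp add: fps_to_fls_power)
    then have "fps_X ^ p dvd v ^ n - 1" by (simp only: ordge_fps_to_fls)
    moreover have "v ^ n - 1 = (v - 1) * (\<Sum>i<n. v ^ i)" by (simp add: power_diff_1_eq)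
    moreover have "is_unit (\<Sum>i<n. v ^ i)" using n v1 by (simp add: fps_sum_nth fps_nth_power_0)
    ultimately have "fps_X ^ p dvd v - 1" by (metis dvd_mult_unit_iff)
    then have "ordge (int p) (fps_to_fls v - 1)" by (simp flip: ordge_fps_to_fls)
    moreover have "ordge 1 (fls_X :: complex fls)" by (simp add: ordge_iff)
    ultimately have "ordge (1 + int p) (fls_X * (fps_to_fls v - 1))" by (intro ordge_mult)
    then show ?thesis by (simp only: A_def fls_times_fps_to_fls fps_X_to_fls right_diff_distrib mult_1_right)
  qed
  then show ?thesis using A1 fA unfolding s_def by blast
qed

lemma subdegree_inv_near_id:
  fixes A :: "complex fps"
  assumes "subdegree A = 1" "ordge (1 + int p) (fps_to_fls A - fls_X)"
  shows "ordge (1 + int p) (fps_to_fls (fps_inv A) - fls_X)"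
proof -
  have "ordge (int (Suc p)) (fps_to_fls (A - fps_X))" using assms(2) by simp
  then have "fps_X ^ Suc p dvd A - fps_X" by (simp only: ordge_fps_to_fls)
  then have "fps_X ^ Suc p dvd fps_X - A" by (metis dvd_minus_iff minus_diff_eq)
  then have "fps_X ^ Suc p dvd (A oo fps_inv A) - (A oo fps_X)"
    using fps_inv_subdegree[OF assms(1)] by simp
  then have "fps_X ^ Suc p dvd fps_inv A - fps_X"
    by (subst (asm) fps_X_power_dvd_compose_diff_iff)
      (use assms subdegree_1D[OF fps_inv_subdegree(1)[OF assms(1)]] in auto)
  then have "ordge (int (Suc p)) (fps_to_fls (fps_inv A - fps_X))" by (simp only: ordge_fps_to_fls)
  then show ?thesis by simp
qed

text \<open>Two series of the same nonzero order are both pure powers in suitable coordinates. For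
  the quantitative part f is first made equal to t^s exactly by \<open>B\<close>; then f2 becomes a
  series \<open>h\<close> close to t^s, to which the last clause of \<open>normal_form\<close>
  applies, and the estimate is carried back along \<open>B\<close>.\<close>

lemma reparam:
  fixes f f2 :: "complex fls"
  assumes "f \<noteq> 0" "f2 \<noteq> 0" "fls_subdegree f = s" "fls_subdegree f2 = s" "s \<noteq> 0"
  shows "\<exists>g. subdegree g = 1 \<and> f2 \<diamondop> g = f"
    and "1 \<le> p \<Longrightarrow> ordge (s + int p) (f2 - f) \<Longrightarrow>
      \<exists>g. subdegree g = 1 \<and> f2 \<diamondop> g = f \<and> ordge (1 + int p) (fps_to_fls g - fls_X)"
proof -
  obtain B where B: "subdegree B = 1" "fls_X_intpow s \<diamondop> B = f"
    using normal_form[of f] assms by blast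
  note iB = fps_inv_subdegree[OF B(1)]
  define h where "h = f2 \<diamondop> fps_inv B"
  have fiB: "f \<diamondop> fps_inv B = fls_X_intpow s"
    using B iB by (simp flip: B(2) add: fls_comp_assoc)
  have h: "h \<noteq> 0" "fls_subdegree h = s"
    using assms iB(1) by (auto simp: h_def fls_comp_eq_0_iff fls_subdegree_comp)
  obtain A where A: "subdegree A = 1" "fls_X_intpow s \<diamondop> A = h"
    and Ap: "\<And>p. 1 \<le> p \<Longrightarrow> ordge (s + int p) (h - fls_X_intpow s) \<Longrightarrow> ordge (1 + int p) (fps_to_fls A - fls_X)"
    using normal_form[of h] h assms(5) by blast
  note iA = fps_inv_subdegree[OF A(1)]
  define g where "g = (fps_inv B oo fps_inv A) oo B"
  have g1: "subdegree g = 1" using iA(1) iB(1) B(1) by (simp add: g_def subdegree_comp)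
  have "f2 \<diamondop> g = f2 \<diamondop> fps_inv B \<diamondop> fps_inv A \<diamondop> B"
    using iA(1) iB(1) B(1) by (simp add: g_def fls_comp_assoc subdegree_comp)
  also have "\<dots> = fls_X_intpow s \<diamondop> A \<diamondop> fps_inv A \<diamondop> B" using A(2) by (simp add: h_def)
  also have "\<dots> = fls_X_intpow s \<diamondop> B" using A(1) iA by (simp add: fls_comp_assoc)
  finally have g2: "f2 \<diamondop> g = f" using B by simp
  show "\<exists>g. subdegree g = 1 \<and> f2 \<diamondop> g = f" using g1 g2 by blast
  assume p: "1 \<le> p" and o: "ordge (s + int p) (f2 - f)"
  have "ordge (s + int p) ((f2 - f) \<diamondop> fps_inv B)" using o iB(1) by (simp add: ordge_compose)
  then have "ordge (s + int p) (h - fls_X_intpow s)"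
    using subdegree_1D[OF iB(1)] fiB by (simp add: h_def fls_comp_simps)
  then have "ordge (1 + int p) (fps_to_fls (fps_inv A) - fls_X)"
    using Ap p A(1) subdegree_inv_near_id by blast
  then have "ordge (int (Suc p)) ((fps_to_fls (fps_inv A) - fls_X) \<diamondop> B)"
    using B(1) by (simp add: ordge_compose)
  moreover have "(fps_to_fls (fps_inv A) - fls_X) \<diamondop> B = fps_to_fls ((fps_inv A oo B) - B)"
    using subdegree_1D[OF B(1)] by (simp add: fls_comp_simps)
  ultimately have "fps_X ^ Suc p dvd (fps_inv A oo B) - B" by (simp only: ordge_fps_to_fls)
  then have "fps_X ^ Suc p dvd (B oo g) - (B oo fps_X)"
  proof -
    have z: "fps_nth B 0 = 0" "fps_nth (fps_inv A) 0 = 0" "fps_nth (fps_inv A oo B) 0 = 0" "fps_nth (fps_inv B) 0 = 0"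
      using subdegree_1D[OF B(1)] subdegree_1D[OF iA(1)] subdegree_1D[OF iB(1)] by simp_all
    have "B oo g = (B oo fps_inv B) oo (fps_inv A oo B)"
      unfolding g_def using z by (simp add: fps_compose_assoc)
    also have "\<dots> = fps_inv A oo B" using iB(3) z by simp
    finally have "B oo g = fps_inv A oo B" .
    then show ?thesis using \<open>fps_X ^ Suc p dvd (fps_inv A oo B) - B\<close> by simp
  qed
  then have "fps_X ^ Suc p dvd g - fps_X"
    by (subst (asm) fps_X_power_dvd_compose_diff_iff) (use subdegree_1D[OF g1] B(1) in auto)
  then have "ordge (int (Suc p)) (fps_to_fls (g - fps_X))" by (simp only: ordge_fps_to_fls)
  then show "\<exists>g. subdegree g = 1 \<and> f2 \<diamondop> g = f \<and> ordge (1 + int p) (fps_to_fls g - fls_X)"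
    using g1 g2 by auto
qed

text \<open>This is the source of all roots of unity below: a reparametrisation that keeps z a pure
  power of the parameter can only rotate it.\<close>

lemma X_intpow_comp_eq:
  fixes w :: "complex fps"
  assumes "subdegree w \<noteq> 0" "fls_X_intpow s \<diamondop> w = fls_X_intpow t" "s \<noteq> 0"
  shows "\<exists>\<omega>. w = fps_const \<omega> * fps_X ^ subdegree w \<and> \<omega> powi s = 1 \<and> s * int (subdegree w) = t"
proof -
  define d where "d = subdegree w"
  define n where "n = nat \<bar>s\<bar>"
  have n: "n > 0" using assms(3) by (simp add: n_def)
  have w0: "w \<noteq> 0" "fps_nth w 0 = 0" using subdegree_nonzeroD assms(1) by blast+
  have sd: "s * int d = t"
    using arg_cong[OF assms(2), of fls_subdegree] assms(1) by (simp add: fls_subdegree_comp d_def)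
  have "fps_to_fls w powi s = fls_X powi t" using assms(2) w0 by (simp add: X_intpow_compose)
  then have "fps_to_fls w powi (s * sgn s) = fls_X powi (t * sgn s)" by (simp only: power_int_mult)
  moreover have "s * sgn s = int n" "t * sgn s = int (d * n)"
    using sd by (auto simp: n_def sgn_if)
  ultimately have "fps_to_fls w ^ n = fls_X ^ (d * n)" by (simp only: power_int_of_nat)
  then have "fps_to_fls (w ^ n) = fps_to_fls (fps_X ^ (d * n))"
    by (simp only: fps_to_fls_power fps_X_to_fls)
  then have wn: "w ^ n = (fps_X ^ d) ^ n" by (simp only: fps_to_fls_eq_iff power_mult)
  define v where "v = fps_shift d w"
  have wv: "w = v * fps_X ^ d" unfolding v_def d_def by (rule subdegree_decompose)
  have "v ^ n * (fps_X ^ d) ^ n = 1 * (fps_X ^ d) ^ n" using wn by (simp add: wv power_mult_distrib)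
  then have vn: "v ^ n = 1" by simp
  \<comment> \<open>Differentiating v^n = 1 forces v' = 0, so v is a constant.\<close>
  have "fps_deriv (v ^ n) = 0" using vn by simp
  then have "of_nat n * v ^ (n - 1) * fps_deriv v = 0" by (simp add: fps_deriv_power mult_ac)
  moreover have "v \<noteq> 0" using vn n by (metis power_eq_0_iff zero_neq_one)
  ultimately have "fps_deriv v = 0" using n by simp
  then have v: "v = fps_const (fps_nth v 0)" by (metis fps_deriv_eq_0_iff)
  define \<omega> where "\<omega> = fps_nth v 0"
  have "fps_const (\<omega> ^ n) = 1" using vn v by (simp add: \<omega>_def flip: fps_const_power)
  then have "\<omega> ^ n = 1" by (simp only: fps_const_eq_1_iff)
  then have "\<omega> powi s = 1"
    unfolding power_int_def n_def by (cases "s \<ge> 0") (simp_all add: power_inverse)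
  moreover have "w = fps_const \<omega> * fps_X ^ d" using wv v unfolding \<omega>_def by simp
  ultimately show ?thesis using sd unfolding d_def by blast
qed

section \<open>Exponential factors\<close>

abbreviation keys :: "puiseux \<Rightarrow> rat set" where "keys \<equiv> Poly_Mapping.keys"

abbreviation lookup :: "puiseux \<Rightarrow> rat \<Rightarrow> complex" where "lookup \<equiv> Poly_Mapping.lookup"

lemma exists_common_denominator:
  fixes K :: "rat set"
  assumes "finite K"
  shows "\<exists>r::nat. 1 \<le> r \<and> (\<forall>k\<in>K. k * of_nat r \<in> \<int>)"
  using assms
proof (induction K)
  case (insert k K)
  then obtain r :: nat where r: "1 \<le> r" "\<And>k. k \<in> K \<Longrightarrow> k * of_nat r \<in> \<int>" by auto
  obtain a b where ab: "b > 0" "k = Fract a b" by (metis Rat_cases)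
  have 1: "k * of_nat (r * nat b) \<in> \<int>"
  proof -
    have "k * of_nat (nat b) = of_int a"
      using ab by (simp add: Fract_of_int_quotient)
    then have "k * of_nat (r * nat b) = of_int (a * int r)" by simp
    then show ?thesis by (metis Ints_of_int)
  qed
  have "x * of_nat (r * nat b) \<in> \<int>" if "x \<in> K" for x
    using Ints_mult[OF r(2)[OF that], of "of_nat (nat b)"] by (simp add: mult.assoc)
  then show ?case using r(1) ab(1) 1 by (intro exI[of _ "r * nat b"]) auto
qed (auto intro: exI[of _ 1])

lemma ram_pos: "1 \<le> ram q"
  and ram_Ints: "k \<in> keys q \<Longrightarrow> k * of_nat (ram q) \<in> \<int>"
  using LeastI_ex[OF exists_common_denominator[OF finite_keys[of q]]]
  unfolding ram_def by auto

lemma ram_least: "1 \<le> r \<Longrightarrow> (\<And>k. k \<in> keys q \<Longrightarrow> k * of_nat r \<in> \<int>) \<Longrightarrow> ram q \<le> r"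
  unfolding ram_def by (rule Least_le) auto

text \<open>The integers that clear all denominators of q are closed under integral combinations. By
  Bezout the gcd of \<open>ram q\<close> and N is one of them, and minimality of
  \<open>ram q\<close> does the rest.\<close>

lemma ram_dvd:
  assumes "\<And>k. k \<in> keys q \<Longrightarrow> k * of_nat N \<in> \<int>"
  shows "ram q dvd N"
proof -
  define g where "g = gcd (ram q) N"
  obtain x y where "x * int (ram q) + y * int N = gcd (int (ram q)) (int N)"
    using bezout_int by blast
  then have xy: "int g = x * int (ram q) + y * int N" by (simp add: g_def)
  have "k * of_nat g \<in> \<int>" if "k \<in> keys q" for k
  proof -
    have "(of_nat g :: rat) = of_int x * of_nat (ram q) + of_int y * of_nat N"
      using arg_cong[OF xy, of "of_int :: int \<Rightarrow> rat"] by simp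
    then have "k * of_nat g = of_int x * (k * of_nat (ram q)) + of_int y * (k * of_nat N)"
      by (simp add: algebra_simps)
    then show ?thesis using ram_Ints[OF that] assms[OF that] by simp
  qed
  moreover have "1 \<le> g" using ram_pos[of q] by (simp add: g_def Suc_le_eq)
  ultimately have "ram q \<le> g" by (intro ram_least)
  moreover have "g \<le> ram q" using ram_pos[of q] by (simp add: g_def)
  ultimately show ?thesis by (metis g_def gcd_dvd2 order_antisym)
qed

lemma ram_cong:
  assumes "\<And>N. (\<forall>k\<in>keys p. k * of_nat N \<in> \<int>) \<longleftrightarrow> (\<forall>k\<in>keys q. k * of_nat N \<in> \<int>)"
  shows "ram p = ram q"
  unfolding ram_def using assms by simp

lemma ram_0 [simp]: "ram 0 = 1"
  unfolding ram_def by (rule Least_equality) auto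

lemma exp_factor_keys: "exp_factor q \<Longrightarrow> k \<in> keys q \<Longrightarrow> 0 < k"
  by (auto simp: exp_factor_def)

lemma exp_factor_0 [simp]: "exp_factor 0"
  by (simp add: exp_factor_def)

lemma exp_factor_add: "exp_factor p \<Longrightarrow> exp_factor q \<Longrightarrow> exp_factor (p + q)"
  using keys_add[of p q] by (auto simp: exp_factor_def)

lemma exp_factor_diff: "exp_factor p \<Longrightarrow> exp_factor q \<Longrightarrow> exp_factor (p - q)"
  using keys_diff[of p q] by (auto simp: exp_factor_def)

lemma exp_factor_single: "0 < k \<Longrightarrow> exp_factor (Poly_Mapping.single k c)"
  by (simp add: exp_factor_def)

lemma expo_eq:
  assumes "exp_factor q" "k \<in> keys q"
  shows "of_nat (expo q k) = k * of_nat (ram q)"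
proof -
  obtain m where m: "k * of_nat (ram q) = of_int m" using ram_Ints[OF assms(2)] by (auto elim: Ints_cases)
  have "0 \<le> k * of_nat (ram q)" using exp_factor_keys[OF assms] by simp
  then have "m \<ge> 0" using m by simp
  then show ?thesis using m by (simp add: expo_def)
qed

lemma expansion_nth:
  assumes "exp_factor q"
  shows "expansion q $$ j = lookup q (of_int (- j) / of_nat (ram q))"
proof -
  have r: "(of_nat (ram q) :: rat) \<noteq> 0" using ram_pos[of q] by simp
  have "expansion q $$ j = (\<Sum>k\<in>keys q. if k = of_int (- j) / of_nat (ram q) then lookup q k else 0)"
    unfolding expansion_def fls_nth_sum
  proof (rule sum.cong[OF refl])
    fix k assume k: "k \<in> keys q"
    have "j = - int (expo q k) \<longleftrightarrow> (of_int (- j) :: rat) = of_nat (expo q k)"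
      by (metis add.inverse_inverse of_int_eq_iff of_int_of_nat_eq)
    also have "\<dots> \<longleftrightarrow> k = of_int (- j) / of_nat (ram q)"
      unfolding expo_eq[OF assms k] using r by (auto simp: field_simps)
    finally have "j = - int (expo q k) \<longleftrightarrow> k = of_int (- j) / of_nat (ram q)" .
    then show "(fls_const (lookup q k) * fls_X_intpow (- int (expo q k))) $$ j =
        (if k = of_int (- j) / of_nat (ram q) then lookup q k else 0)"
      by auto
  qed
  also have "\<dots> = lookup q (of_int (- j) / of_nat (ram q))"
    by (auto simp: sum.delta' in_keys_iff)
  finally show ?thesis .
qed

lemma coeff_ramified_poly:
  assumes "exp_factor q"
  shows "Polynomial.coeff (ramified_poly q) n = lookup q (of_nat n / of_nat (ram q))"
proof -
  have r: "(of_nat (ram q) :: rat) \<noteq> 0" using ram_pos[of q] by simp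
  have "Polynomial.coeff (ramified_poly q) n = (\<Sum>k\<in>keys q. if k = of_nat n / of_nat (ram q) then lookup q k else 0)"
    unfolding ramified_poly_def Polynomial.coeff_sum
  proof (rule sum.cong[OF refl])
    fix k assume k: "k \<in> keys q"
    have "expo q k = n \<longleftrightarrow> (of_nat n :: rat) = of_nat (expo q k)" by auto
    also have "\<dots> \<longleftrightarrow> k = of_nat n / of_nat (ram q)"
      unfolding expo_eq[OF assms k] using r by (auto simp: field_simps)
    finally show "Polynomial.coeff (Polynomial.monom (lookup q k) (expo q k)) n =
        (if k = of_nat n / of_nat (ram q) then lookup q k else 0)"
      by auto
  qed
  also have "\<dots> = lookup q (of_nat n / of_nat (ram q))"
    by (auto simp: sum.delta' in_keys_iff)
  finally show ?thesis .
qed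

lemma irr_eqI:
  assumes "exp_factor q" "k \<in> keys q" "\<And>l. l \<in> keys q \<Longrightarrow> l \<le> k"
  shows "irr q = expo q k"
proof -
  have r: "(of_nat (ram q) :: rat) > 0" using ram_pos[of q] by simp
  have k: "k = of_nat (expo q k) / of_nat (ram q)" using expo_eq[OF assms(1,2)] r by simp
  show ?thesis unfolding irr_def
  proof (rule order_antisym)
    show "Polynomial.degree (ramified_poly q) \<le> expo q k"
    proof (rule Polynomial.degree_le, intro allI impI)
      fix i assume "expo q k < i"
      then have "k < of_nat i / of_nat (ram q)" by (subst k) (use r in \<open>simp add: divide_strict_right_mono\<close>)
      then have "of_nat i / of_nat (ram q) \<notin> keys q" using assms(3) by force
      then show "Polynomial.coeff (ramified_poly q) i = 0"
        by (simp add: coeff_ramified_poly assms(1) in_keys_iff)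
    qed
    show "expo q k \<le> Polynomial.degree (ramified_poly q)"
      using k assms(2) by (intro Polynomial.le_degree) (metis coeff_ramified_poly assms(1) in_keys_iff)
  qed
qed

lemma slope_eqI:
  assumes "exp_factor q" "k \<in> keys q" "\<And>l. l \<in> keys q \<Longrightarrow> l \<le> k"
  shows "slope q = k"
  using irr_eqI[OF assms] expo_eq[OF assms(1,2)] ram_pos[of q] by (simp add: slope_def)

lemma slope_0 [simp]: "slope 0 = 0"
  by (simp add: slope_def irr_def ramified_poly_def)

lemma slope_max:
  assumes "exp_factor q" "q \<noteq> 0"
  shows "slope q \<in> keys q" "l \<in> keys q \<Longrightarrow> l \<le> slope q" "0 < slope q"
proof -
  have K: "finite (keys q)" "keys q \<noteq> {}" using assms by auto
  have "slope q = Max (keys q)" using K by (intro slope_eqI assms) auto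
  then show "slope q \<in> keys q" "l \<in> keys q \<Longrightarrow> l \<le> slope q" using K by auto
  then show "0 < slope q" using exp_factor_keys assms by blast
qed

lemma irr_eq: "of_nat (irr q) = slope q * of_nat (ram q)"
  using ram_pos[of q] by (simp add: slope_def)

lemma lookup_subst_root: "lookup (subst_root \<omega> q) k = lookup q k * inverse \<omega> ^ expo q k"
  unfolding subst_root_def by (cases "k \<in> keys q") (auto simp: lookup_mapp in_keys_iff when_def)

lemma keys_subst_root: "\<omega> \<noteq> 0 \<Longrightarrow> keys (subst_root \<omega> q) = keys q"
  by (auto simp: in_keys_iff lookup_subst_root)

lemma ram_subst_root: "\<omega> \<noteq> 0 \<Longrightarrow> ram (subst_root \<omega> q) = ram q"
  by (rule ram_cong) (simp add: keys_subst_root)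

lemma expo_subst_root: "\<omega> \<noteq> 0 \<Longrightarrow> expo (subst_root \<omega> q) k = expo q k"
  by (simp add: expo_def ram_subst_root)

lemma exp_factor_subst_root: "\<omega> \<noteq> 0 \<Longrightarrow> exp_factor (subst_root \<omega> q) \<longleftrightarrow> exp_factor q"
  by (simp add: exp_factor_def keys_subst_root)

lemma subst_root_subst_root:
  "\<omega> \<noteq> 0 \<Longrightarrow> subst_root \<omega>' (subst_root \<omega> q) = subst_root (\<omega>' * \<omega>) q"
  by (intro poly_mapping_eqI) (simp add: lookup_subst_root expo_subst_root power_mult_distrib mult_ac)

lemma subst_root_1 [simp]: "subst_root 1 q = q"
  by (intro poly_mapping_eqI) (simp add: lookup_subst_root)

lemma root_nonzero: "(\<omega>::complex) ^ ram q = 1 \<Longrightarrow> \<omega> \<noteq> 0"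
  using ram_pos[of q] by (auto simp: power_0_left)

lemma galois_orbit_refl: "q \<in> galois_orbit q"
  unfolding galois_orbit_def using subst_root_1[of q] by (metis (mono_tags, lifting) mem_Collect_eq power_one)

lemma galois_orbit_eq:
  assumes "p \<in> galois_orbit q"
  shows "galois_orbit p = galois_orbit q"
proof -
  obtain \<omega> where w: "p = subst_root \<omega> q" "\<omega> ^ ram q = 1" using assms by (auto simp: galois_orbit_def)
  have nz: "\<omega> \<noteq> 0" using root_nonzero[OF w(2)] .
  have r: "ram p = ram q" using w nz by (simp add: ram_subst_root)
  show ?thesis
  proof (intro equalityI subsetI)
    fix x assume "x \<in> galois_orbit p"
    then obtain \<eta> where "x = subst_root \<eta> p" "\<eta> ^ ram q = 1" by (auto simp: galois_orbit_def r)
    then have "x = subst_root (\<eta> * \<omega>) q" "(\<eta> * \<omega>) ^ ram q = 1"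
      using w nz by (auto simp: subst_root_subst_root power_mult_distrib)
    then show "x \<in> galois_orbit q" by (auto simp: galois_orbit_def)
  next
    fix x assume "x \<in> galois_orbit q"
    then obtain \<eta> where e: "x = subst_root \<eta> q" "\<eta> ^ ram q = 1" by (auto simp: galois_orbit_def)
    have "subst_root (\<eta> * inverse \<omega>) p = subst_root \<eta> q"
      by (simp only: w(1) subst_root_subst_root[OF nz] mult.assoc left_inverse[OF nz] mult_1_right)
    moreover have "(\<eta> * inverse \<omega>) ^ ram p = 1" using e w r by (simp add: power_mult_distrib power_inverse)
    ultimately show "x \<in> galois_orbit p"
      unfolding galois_orbit_def using e by (metis (mono_tags, lifting) mem_Collect_eq)
  qed
qed

section \<open>Germs of plane curves at infinity\<close>

text \<open>The signed exponent s in z = \<open>coord_base a\<close> + t^s. It lets finite points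
  and infinity be treated by the same formulas.\<close>

definition coord_exp :: "P1 \<Rightarrow> nat \<Rightarrow> int" where
  "coord_exp a N = (case a of Fin _ \<Rightarrow> int N | Inf \<Rightarrow> - int N)"

definition coord_base :: "P1 \<Rightarrow> complex" where
  "coord_base a = (case a of Fin b \<Rightarrow> b | Inf \<Rightarrow> 0)"

lemma coord_exp_simps [simp]: "coord_exp (Fin b) N = int N" "coord_exp Inf N = - int N"
  and coord_base_simps [simp]: "coord_base (Fin b) = b" "coord_base Inf = 0"
  by (simp_all add: coord_exp_def coord_base_def)

lemma coord_exp_eq_0 [simp]: "coord_exp a N = 0 \<longleftrightarrow> N = 0"
  by (cases a) auto

lemma coord_exp_mult: "coord_exp a (e * N) = int e * coord_exp a N"
  by (cases a) auto

lemma coord_eq: "coord a N = fls_const (coord_base a) + fls_X_intpow (coord_exp a N)"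
  by (cases a) (simp_all add: coord_def)

text \<open>\<open>y\<close>, a series in \<open>t\<close> where \<open>z\<^sub>a = t\<^sup>N\<close>, agrees with \<open>dq/dz\<close> up to the terms which would
  contribute logarithms or nonpolar terms to the primitive.\<close>

definition polar :: "P1 \<Rightarrow> nat \<Rightarrow> puiseux \<Rightarrow> complex fls \<Rightarrow> bool" where
  "polar a N q y \<longleftrightarrow> (\<forall>j < - coord_exp a N.
     of_int (coord_exp a N) * y $$ j = of_int (j + coord_exp a N) * lookup q (of_int (- (j + coord_exp a N)) / of_nat N))"

definition Dexp :: "P1 \<Rightarrow> puiseux \<Rightarrow> complex fls" where
  "Dexp a q = fls_deriv (expansion q) / fls_deriv (coord a (ram q))"

text \<open>Compare coefficients of t^(j+s-1) in dz/dt * dq/dz = dq/dt, where dz/dt = s t^(s-1). The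
  result is the equation defining \<open>polar\<close>, here for every j.\<close>

lemma Dexp_nth:
  assumes "exp_factor q"
  shows "of_int (coord_exp a (ram q)) * Dexp a q $$ j =
    of_int (j + coord_exp a (ram q)) * lookup q (of_int (- (j + coord_exp a (ram q))) / of_nat (ram q))"
proof -
  define s where "s = coord_exp a (ram q)"
  have s: "s \<noteq> 0" using ram_pos[of q] by (simp add: s_def)
  have D: "fls_deriv (coord a (ram q)) = fls_const (of_int s) * fls_X_intpow (s - 1)"
    unfolding coord_eq s_def[symmetric] fls_deriv_add fls_deriv_const
    by (intro fls_eqI) (auto simp: fls_deriv_X_intpow)
  have "fls_deriv (coord a (ram q)) \<noteq> 0" using s by (simp add: D fls_shift_eq0_iff fls_X_intpow_times_conv_shift)
  then have "fls_const (of_int s) * fls_X_intpow (s - 1) * Dexp a q = fls_deriv (expansion q)"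
    by (simp add: Dexp_def D)
  then have "(fls_const (of_int s) * (fls_X_intpow (s - 1) * Dexp a q)) $$ (j + s - 1) = fls_deriv (expansion q) $$ (j + s - 1)"
    by (simp add: mult.assoc)
  then show ?thesis
    by (simp add: fls_shifted_times_simps expansion_nth[OF assms] flip: s_def)
qed

lemma polar_Dexp: "exp_factor q \<Longrightarrow> polar a (ram q) q (Dexp a q)"
  unfolding polar_def by (auto simp only: Dexp_nth)

lemma Dexp_subdegree:
  assumes "exp_factor q" "q \<noteq> 0"
  shows "Dexp a q \<noteq> 0" "fls_subdegree (Dexp a q) = - coord_exp a (ram q) - int (irr q)"
proof -
  define s where "s = coord_exp a (ram q)"
  have s: "s \<noteq> 0" using ram_pos[of q] by (simp add: s_def)
  have r: "(of_nat (ram q) :: rat) > 0" using ram_pos[of q] by simp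
  have ip: "irr q > 0" using slope_max(3)[OF assms] irr_eq[of q] r by (metis mult_pos_pos of_nat_0_less_iff)
  have sl: "slope q = of_nat (irr q) / of_nat (ram q)" by (simp add: slope_def)
  have "of_int s * Dexp a q $$ (- s - int (irr q)) = - of_nat (irr q) * lookup q (slope q)"
    using Dexp_nth[OF assms(1), of a "- s - int (irr q)"] by (simp add: s_def sl)
  also have "\<dots> \<noteq> 0" using slope_max(1)[OF assms] ip by (simp add: in_keys_iff)
  finally have 1: "Dexp a q $$ (- s - int (irr q)) \<noteq> 0" by auto
  then show "Dexp a q \<noteq> 0" by auto
  have "Dexp a q $$ j = 0" if j: "j < - s - int (irr q)" for j
  proof -
    have "int (irr q) < - (j + s)" using j by simp
    then have "(of_nat (irr q) :: rat) < of_int (- (j + s))"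
      by (metis of_int_less_iff of_int_of_nat_eq)
    then have "slope q < of_int (- (j + s)) / of_nat (ram q)"
      unfolding sl using r by (rule divide_strict_right_mono)
    then have "of_int (- (j + s)) / of_nat (ram q) \<notin> keys q" using slope_max(2)[OF assms] by force
    then have "lookup q (of_int (- (j + s)) / of_nat (ram q)) = 0" by (simp add: in_keys_iff)
    then show ?thesis using Dexp_nth[OF assms(1), of a j] s by (simp add: s_def)
  qed
  then show "fls_subdegree (Dexp a q) = - coord_exp a (ram q) - int (irr q)"
    using 1 by (intro fls_subdegree_eqI) (auto simp: s_def)
qed

lemma Dexp_0 [simp]: "Dexp a 0 = 0"
  by (simp add: Dexp_def expansion_def)

type_synonym germ = "complex fls \<times> complex fls"

text \<open>For the tame circle at a finite point \<open>a\<close>, where \<open>\<xi> = 0\<close> would have no pole, the germ of the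
  vertical line \<open>z = a\<close> is used, up to equivalence.\<close>

definition germ :: "P1 \<Rightarrow> puiseux \<Rightarrow> germ" where
  "germ a q = (coord a (ram q), if q = 0 \<and> a \<noteq> Inf then fls_X_intpow (- 1) else Dexp a q)"

definition gcomp :: "germ \<Rightarrow> complex fps \<Rightarrow> germ" where
  "gcomp \<gamma> g = (fst \<gamma> \<diamondop> g, snd \<gamma> \<diamondop> g)"

definition near :: "int \<Rightarrow> germ \<Rightarrow> germ \<Rightarrow> bool" where
  "near n \<gamma> \<delta> \<longleftrightarrow> ordge n (fst \<gamma> - fst \<delta>) \<and> ordge n (snd \<gamma> - snd \<delta>)"

text \<open>A zero coordinate enters with subdegree 0, which does not influence the maximum as soon
  as this is at least 1. Hence the recurring condition that the pole order be positive.\<close>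

definition pole :: "germ \<Rightarrow> int" where
  "pole \<gamma> = max (- fls_subdegree (fst \<gamma>)) (- fls_subdegree (snd \<gamma>))"

text \<open>The precision is read off from the first germ only. Congruence modulo a positive power
  of t sees all polar terms, so the second germ has the same pole order and the relation is
  symmetric after all.\<close>

definition germ_equiv :: "germ \<Rightarrow> germ \<Rightarrow> bool" where
  "germ_equiv \<gamma> \<delta> \<longleftrightarrow> 1 \<le> pole \<gamma> \<and> (\<exists>g. subdegree g = 1 \<and> near (pole \<gamma>) (gcomp \<delta> g) \<gamma>)"

text \<open>The inverse transpose of \<open>A\<close> (for \<open>A\<close> of determinant 1) applied to \<open>(z, \<xi>)\<close>.\<close>

definition act :: "complex^2^2 \<Rightarrow> germ \<Rightarrow> germ" where
  "act A \<gamma> = (fls_const (A$2$2) * fst \<gamma> - fls_const (A$2$1) * snd \<gamma>,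
              fls_const (A$1$1) * snd \<gamma> - fls_const (A$1$2) * fst \<gamma>)"

section \<open>Equivalence of germs and its linear invariance\<close>

lemma near_refl [simp]: "near n \<gamma> \<gamma>"
  by (simp add: near_def)

lemma near_sym: "near n \<gamma> \<delta> \<Longrightarrow> near n \<delta> \<gamma>"
  by (simp add: near_def ordge_minus_commute)

lemma near_trans: "near n \<gamma> \<delta> \<Longrightarrow> near n \<delta> \<epsilon> \<Longrightarrow> near n \<gamma> \<epsilon>"
  unfolding near_def using ordge_trans by blast

lemma near_gcomp:
  assumes "subdegree g = 1" "near n \<gamma> \<delta>"
  shows "near n (gcomp \<gamma> g) (gcomp \<delta> g)"
  using assms subdegree_1D[OF assms(1)]
  by (simp add: near_def gcomp_def ordge_compose flip: fls_compose_fps_diff)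

lemma gcomp_gcomp:
  "subdegree g \<noteq> 0 \<Longrightarrow> subdegree h \<noteq> 0 \<Longrightarrow> gcomp (gcomp \<gamma> g) h = gcomp \<gamma> (g oo h)"
  by (simp add: gcomp_def fls_comp_assoc)

lemma gcomp_X [simp]: "gcomp \<gamma> fps_X = \<gamma>"
  by (simp add: gcomp_def)

lemma pole_gcomp: "subdegree g \<noteq> 0 \<Longrightarrow> pole (gcomp \<gamma> g) = pole \<gamma> * int (subdegree g)"
  by (simp add: pole_def gcomp_def fls_subdegree_comp max_mult_distrib_right)

lemma pole_le_iff: "0 \<le> M \<Longrightarrow> pole \<gamma> \<le> M \<longleftrightarrow> ordge (- M) (fst \<gamma>) \<and> ordge (- M) (snd \<gamma>)"
  by (auto simp: pole_def ordge_iff)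

lemma pole_near:
  assumes "near n \<gamma> \<delta>" "0 \<le> n" "1 \<le> pole \<gamma>"
  shows "pole \<delta> = pole \<gamma>"
proof -
  have "pole \<gamma> \<le> M \<longleftrightarrow> pole \<delta> \<le> M" if "0 \<le> M" for M
  proof -
    have "fst \<gamma> $$ j = fst \<delta> $$ j \<and> snd \<gamma> $$ j = snd \<delta> $$ j" if "j < - M" for j
    proof -
      have "j < n" using that \<open>0 \<le> M\<close> assms(2) by linarith
      then show ?thesis using assms(1) by (simp add: near_def ordge_def)
    qed
    then show ?thesis unfolding pole_le_iff[OF that] ordge_def by simp
  qed
  from this[of "pole \<gamma>"] this[of "pole \<delta>"] this[of 0] assms(3) show ?thesis by linarith
qed

lemma mat2_eqI:
  fixes A B :: "complex^2^2"
  assumes "A$1$1 = B$1$1" "A$1$2 = B$1$2" "A$2$1 = B$2$1" "A$2$2 = B$2$2"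
  shows "A = B"
  using assms by (simp add: Finite_Cartesian_Product.vec_eq_iff forall_2)

lemma mat2_mult_nth: "((A :: complex^2^2) ** B) $ i $ j = A $ i $ 1 * B $ 1 $ j + A $ i $ 2 * B $ 2 $ j"
  by (simp add: matrix_matrix_mult_def sum_2)

lemma mat2_one_nth: "(Finite_Cartesian_Product.mat 1 :: complex^2^2) $ i $ j = (if i = j then 1 else 0)"
  by (simp add: Finite_Cartesian_Product.mat_def)

lemma act_act: "act B (act A \<gamma>) = act (B ** A) \<gamma>"
  by (simp add: act_def matrix_matrix_mult_def sum_2 algebra_simps flip: fls_const_mult_const fls_plus_const)

lemma act_one [simp]: "act (Finite_Cartesian_Product.mat 1) \<gamma> = \<gamma>"
  by (simp add: act_def Finite_Cartesian_Product.mat_def)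

lemma SL2_iff: "A \<in> SL2 \<longleftrightarrow> A$1$1 * A$2$2 - A$1$2 * A$2$1 = 1"
  by (simp add: SL2_def det_2)

lemma SL2_inverse:
  assumes "A \<in> SL2"
  shows "\<exists>B\<in>SL2. B ** A = Finite_Cartesian_Product.mat 1 \<and> A ** B = Finite_Cartesian_Product.mat 1"
proof -
  define B :: "complex^2^2" where "B = vector [vector [A$2$2, - A$1$2], vector [- A$2$1, A$1$1]]"
  have B: "B $ 1 $ 1 = A$2$2" "B $ 1 $ 2 = - A$1$2" "B $ 2 $ 1 = - A$2$1" "B $ 2 $ 2 = A$1$1"
    by (simp_all add: B_def vector_2)
  have "B ** A = Finite_Cartesian_Product.mat 1" "A ** B = Finite_Cartesian_Product.mat 1"
    using assms by (auto intro!: mat2_eqI simp: mat2_mult_nth mat2_one_nth B SL2_iff algebra_simps)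
  moreover have "B \<in> SL2" using assms by (simp add: SL2_iff B algebra_simps)
  ultimately show ?thesis by blast
qed

lemma SL2_mult: "A \<in> SL2 \<Longrightarrow> B \<in> SL2 \<Longrightarrow> A ** B \<in> SL2"
  by (simp add: SL2_def det_mul)

lemma near_act: "near n \<gamma> \<delta> \<Longrightarrow> near n (act A \<gamma>) (act A \<delta>)"
  by (auto simp: near_def act_def ordge_def algebra_simps)

lemma gcomp_act: "subdegree g \<noteq> 0 \<Longrightarrow> gcomp (act A \<gamma>) g = act A (gcomp \<gamma> g)"
  by (simp add: gcomp_def act_def fls_comp_simps)

text \<open>A linear map with constant coefficients cannot increase the pole order; applying this to
  the inverse matrix as well gives equality.\<close>

lemma pole_act:
  assumes "A \<in> SL2" "1 \<le> pole \<gamma>"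
  shows "pole (act A \<gamma>) = pole \<gamma>"
proof -
  have le: "pole (act C \<delta>) \<le> M" if "0 \<le> M" "pole \<delta> \<le> M" for C \<delta> M
    using that(2) unfolding pole_le_iff[OF that(1)] act_def fst_conv snd_conv
    by (intro conjI ordge_diff ordge_const_mult) blast+
  obtain B where "B ** A = Finite_Cartesian_Product.mat 1" using SL2_inverse assms(1) by blast
  then have "act B (act A \<gamma>) = \<gamma>" by (simp add: act_act)
  then have "pole \<gamma> \<le> M" if "0 \<le> M" "pole (act A \<gamma>) \<le> M" for M using le that by metis
  from this[of 0] this[of "pole (act A \<gamma>)"] le[of "pole \<gamma>" \<gamma> A] assms(2) show ?thesis by linarith
qed

lemma germ_equiv_pole: "germ_equiv \<gamma> \<delta> \<Longrightarrow> pole \<delta> = pole \<gamma> \<and> 1 \<le> pole \<gamma>"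
proof -
  assume "germ_equiv \<gamma> \<delta>"
  then obtain g where g: "1 \<le> pole \<gamma>" "subdegree g = 1" "near (pole \<gamma>) (gcomp \<delta> g) \<gamma>"
    by (auto simp: germ_equiv_def)
  then have "pole (gcomp \<delta> g) = pole \<gamma>" by (intro pole_near[OF near_sym]) auto
  then show ?thesis using g by (simp add: pole_gcomp)
qed

lemma germ_equiv_refl: "1 \<le> pole \<gamma> \<Longrightarrow> germ_equiv \<gamma> \<gamma>"
  unfolding germ_equiv_def by (intro conjI exI[of _ fps_X]) auto

lemma germ_equiv_gcomp: "subdegree g = 1 \<Longrightarrow> 1 \<le> pole \<gamma> \<Longrightarrow> germ_equiv (gcomp \<gamma> g) \<gamma>"
  unfolding germ_equiv_def by (intro conjI exI[of _ g]) (auto simp: pole_gcomp)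

lemma germ_equiv_sym: "germ_equiv \<gamma> \<delta> \<Longrightarrow> germ_equiv \<delta> \<gamma>"
proof -
  assume e: "germ_equiv \<gamma> \<delta>"
  then obtain g where g: "1 \<le> pole \<gamma>" "subdegree g = 1" "near (pole \<gamma>) (gcomp \<delta> g) \<gamma>"
    by (auto simp: germ_equiv_def)
  note i = fps_inv_subdegree[OF g(2)]
  have "near (pole \<gamma>) (gcomp (gcomp \<delta> g) (fps_inv g)) (gcomp \<gamma> (fps_inv g))"
    using g i by (intro near_gcomp) auto
  then have "near (pole \<gamma>) \<delta> (gcomp \<gamma> (fps_inv g))" using g i by (simp add: gcomp_gcomp)
  then show ?thesis using i germ_equiv_pole[OF e] near_sym unfolding germ_equiv_def by metis
qed

lemma germ_equiv_trans: "germ_equiv \<gamma> \<delta> \<Longrightarrow> germ_equiv \<delta> \<epsilon> \<Longrightarrow> germ_equiv \<gamma> \<epsilon>"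
proof -
  assume e: "germ_equiv \<gamma> \<delta>" "germ_equiv \<delta> \<epsilon>"
  then obtain g h where g: "1 \<le> pole \<gamma>" "subdegree g = 1" "near (pole \<gamma>) (gcomp \<delta> g) \<gamma>"
    and h: "subdegree h = 1" "near (pole \<delta>) (gcomp \<epsilon> h) \<delta>"
    by (auto simp: germ_equiv_def)
  have "near (pole \<gamma>) (gcomp (gcomp \<epsilon> h) g) (gcomp \<delta> g)"
    using h g germ_equiv_pole[OF e(1)] by (intro near_gcomp) auto
  then have "near (pole \<gamma>) (gcomp \<epsilon> (h oo g)) \<gamma>" using g h near_trans by (auto simp: gcomp_gcomp)
  moreover have "subdegree (h oo g) = 1" using g h by (simp add: subdegree_comp)
  ultimately show ?thesis using g(1) unfolding germ_equiv_def by blast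
qed

lemma germ_equiv_act: "A \<in> SL2 \<Longrightarrow> germ_equiv \<gamma> \<delta> \<Longrightarrow> germ_equiv (act A \<gamma>) (act A \<delta>)"
proof -
  assume A: "A \<in> SL2" and e: "germ_equiv \<gamma> \<delta>"
  then obtain g where g: "1 \<le> pole \<gamma>" "subdegree g = 1" "near (pole \<gamma>) (gcomp \<delta> g) \<gamma>"
    by (auto simp: germ_equiv_def)
  have "near (pole \<gamma>) (gcomp (act A \<delta>) g) (act A \<gamma>)"
    using near_act[OF g(3), of A] g(2) by (simp add: gcomp_act)
  then show ?thesis using g A unfolding germ_equiv_def by (auto simp: pole_act)
qed

section \<open>Recovering the exponential factor from its germ\<close>

lemma polar_cong:
  assumes "polar a N q y" "ordge (- coord_exp a N) (y2 - y)"
  shows "polar a N q y2"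
  using assms by (auto simp: polar_def ordge_def)

lemma polar_unique:
  assumes "polar a N q y" "polar a N q y2" "1 \<le> N"
  shows "ordge (- coord_exp a N) (y2 - y)"
  unfolding ordge_def
proof (intro allI impI)
  fix j assume "j < - coord_exp a N"
  then have "of_int (coord_exp a N) * y2 $$ j = of_int (coord_exp a N) * y $$ j"
    using assms(1,2) by (simp add: polar_def)
  then show "(y2 - y) $$ j = 0" using assms(3) by simp
qed

lemma fls_comp_X_power_nth:
  assumes "e \<ge> 1"
  shows "(F \<diamondop> (fps_X ^ e)) $$ n = (if int e dvd n then F $$ (n div int e) else 0)"
proof -
  define s where "s = fls_subdegree F"
  define B where "B = fls_base_factor_to_fps F"
  have "fps_to_fls (fps_X ^ e) powi s = (fls_X powi (int e * s) :: complex fls)"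
    by (simp only: fps_to_fls_power fps_X_to_fls power_int_mult power_int_of_nat)
  then have "F \<diamondop> (fps_X ^ e) = fls_shift (- (int e * s)) (fps_to_fls (B oo fps_X ^ e))"
    by (simp add: fls_compose_fps_def B_def s_def fls_X_intpow_times_conv_shift)
  then have 1: "(F \<diamondop> (fps_X ^ e)) $$ n = fps_to_fls (B oo fps_X ^ e) $$ (n - int e * s)" by simp
  have B: "fps_nth B m = F $$ (int m + s)" for m
    unfolding B_def s_def by (simp add: fls_base_factor_to_fps_nth)
  show ?thesis
  proof (cases "n < int e * s")
    case True
    have "F $$ (n div int e) = 0" if "int e dvd n"
    proof -
      have "n div int e < s" using True assms that by (auto simp: dvd_def)
      then show ?thesis by (simp add: s_def)
    qed
    then show ?thesis using 1 True by simp
  next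
    case False
    define m where "m = nat (n - int e * s)"
    have m: "n = int m + int e * s" using False by (simp add: m_def)
    have d: "int e dvd n \<longleftrightarrow> e dvd m" unfolding m by (simp add: dvd_add_left_iff)
    have "n div int e = int (m div e) + s" using assms by (simp add: m div_mult_self1 zdiv_int)
    then show ?thesis using 1 d by (simp add: m fps_nth_compose_X_power B)
  qed
qed

text \<open>Replaces t by t^e. It is needed to put two circles of different ramification over a
  common root of z, and to handle a dual parametrisation before its ramification is known to be
  minimal. Exponents not divisible by e carry no coefficient of q, since N already clears the
  denominators.\<close>

lemma polar_comp_X_power:
  assumes "polar a N q y" "1 \<le> e" "1 \<le> N" "\<And>k. k \<in> keys q \<Longrightarrow> k * of_nat N \<in> \<int>"
  shows "polar a (e * N) q (y \<diamondop> (fps_X ^ e))"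
  unfolding polar_def
proof (intro allI impI)
  fix j assume j: "j < - coord_exp a (e * N)"
  define s where "s = coord_exp a N"
  have s: "coord_exp a (e * N) = int e * s" by (simp add: s_def coord_exp_mult)
  show "of_int (coord_exp a (e * N)) * (y \<diamondop> (fps_X ^ e)) $$ j =
    of_int (j + coord_exp a (e * N)) * lookup q (of_int (- (j + coord_exp a (e * N))) / of_nat (e * N))"
  proof (cases "int e dvd j")
    case True
    then obtain i where i: "j = int e * i" by (auto simp: dvd_def)
    have "int e * (i + s) < 0" using j unfolding i s by (simp add: algebra_simps)
    then have "i < - s" using assms(2) by (simp add: mult_less_0_iff)
    define K where "K = (of_int (- (i + s)) / of_nat N :: rat)"
    have y: "of_int s * y $$ i = of_int (i + s) * lookup q K"
      using assms(1) \<open>i < - s\<close> by (auto simp only: polar_def s_def K_def)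
    have "of_int (- (int e * i + int e * s)) = (of_nat e * of_int (- (i + s)) :: rat)"
      by (simp add: algebra_simps)
    then have K: "of_int (- (int e * i + int e * s)) / of_nat (e * N) = K"
      using assms(2) by (simp add: K_def)
    have "of_int (int e * s) * (y \<diamondop> (fps_X ^ e)) $$ (int e * i) = of_nat e * (of_int s * y $$ i)"
      using assms(2) by (simp add: fls_comp_X_power_nth)
    also have "\<dots> = of_int (int e * i + int e * s) * lookup q K"
      unfolding y by (simp add: algebra_simps)
    finally show ?thesis unfolding s i K .
  next
    case False
    have "of_int (- (j + int e * s)) / of_nat (e * N) \<notin> keys q"
    proof
      assume "of_int (- (j + int e * s)) / of_nat (e * N) \<in> keys q"
      then have "of_int (- (j + int e * s)) / of_nat (e * N) * of_nat N \<in> (\<int> :: rat set)"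
        by (rule assms(4))
      then obtain m where "of_int (- (j + int e * s)) / of_nat (e * N) * of_nat N = (of_int m :: rat)"
        by (auto elim: Ints_cases)
      moreover have "of_int (- (j + int e * s)) / of_nat (e * N) * of_nat N = (of_int (- (j + int e * s)) / of_nat e :: rat)"
        using assms(3) by simp
      ultimately have "of_int (- (j + int e * s)) = (of_int (m * int e) :: rat)"
        using assms(2) by (simp add: divide_eq_eq)
      then have "- (j + int e * s) = m * int e" by (simp only: of_int_eq_iff)
      then have "j = int e * (- m - s)" by (simp add: algebra_simps)
      then show False using False by simp
    qed
    then have "lookup q (of_int (- (j + int e * s)) / of_nat (e * N)) = 0" by (simp add: in_keys_iff)
    then show ?thesis using False assms(2) unfolding s by (simp add: fls_comp_X_power_nth)
  qed
qed

text \<open>A term of q of exponent k > 0 sits in xi at j = -kN - s, which is below -s, so the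
  congruence determines it. Rotation by \<omega> multiplies it by \<omega>^j, and this equals
  \<omega>^(-kN) because \<omega>^s = 1: precisely the Galois action.\<close>

lemma polar_twist:
  assumes "exp_factor q" "exp_factor q2" "ram q = N" "ram q2 = N" "polar a N q y" "polar a N q2 y2"
    and w: "\<omega> ^ N = 1" and o: "ordge (- coord_exp a N) (y2 \<diamondop> (fps_const \<omega> * fps_X) - y)"
  shows "q = subst_root \<omega> q2"
proof (rule poly_mapping_eqI)
  fix k
  have N: "N \<ge> 1" using assms ram_pos by metis
  then have wn: "\<omega> \<noteq> 0" using w by (auto simp: power_0_left)
  show "lookup q k = lookup (subst_root \<omega> q2) k"
  proof (cases "k \<in> keys q \<or> k \<in> keys q2")
    case True
    then have k: "0 < k" "k * of_nat N \<in> \<int>"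
      using exp_factor_keys[OF assms(1), of k] exp_factor_keys[OF assms(2), of k]
        ram_Ints[of k q] ram_Ints[of k q2] assms(3,4) by auto
    then obtain m where m: "k * of_nat N = of_int m" by (auto elim: Ints_cases)
    have "0 < k * of_nat N" using k(1) N by simp
    then have m0: "m > 0" using m by simp
    have km: "of_int m / of_nat N = k" using m N by (simp add: field_simps)
    define s where "s = coord_exp a N"
    define j where "j = - m - s"
    have js: "j + s = - m" "j < - s" using m0 by (auto simp: j_def)
    have s0: "s \<noteq> 0" using N by (simp add: s_def)
    have ws: "\<omega> powi s = 1" unfolding s_def using w by (cases a) (auto simp: power_int_def power_inverse)
    have "\<omega> powi j = \<omega> powi (- m) / \<omega> powi s"
      unfolding j_def using wn by (intro power_int_diff) simp
    also have "\<dots> = \<omega> powi (- m)" by (simp add: ws)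
    also have "\<dots> = inverse \<omega> ^ nat m" using m0 by (simp add: power_int_def power_inverse)
    finally have wj: "\<omega> powi j = inverse \<omega> ^ nat m" .
    have 1: "of_int s * y $$ j = of_int (- m) * lookup q k"
      using assms(5)[unfolded polar_def s_def[symmetric], rule_format, OF js(2)]
      unfolding js(1) by (simp add: km)
    have 2: "of_int s * y2 $$ j = of_int (- m) * lookup q2 k"
      using assms(6)[unfolded polar_def s_def[symmetric], rule_format, OF js(2)]
      unfolding js(1) by (simp add: km)
    have "y2 $$ j * \<omega> powi j = y $$ j"
      using o js wn by (simp add: ordge_def fls_nth_fls_compose_fps_linear flip: s_def)
    then have "of_int (- m) * lookup q k = (of_int s * y2 $$ j) * \<omega> powi j"
      using 1 by (simp add: mult.assoc)
    then have "lookup q k = lookup q2 k * inverse \<omega> ^ nat m" unfolding 2 using m0 wj by simp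
    moreover have "expo q2 k = nat m" unfolding expo_def using m assms by simp
    ultimately show ?thesis by (simp add: lookup_subst_root)
  qed (auto simp: in_keys_iff lookup_subst_root)
qed

lemma polar_snd_germ: "exp_factor q \<Longrightarrow> polar a (ram q) q (snd (germ a q))"
  using polar_Dexp[of q a] by (cases a) (auto simp: germ_def polar_def)

lemma fst_germ: "fst (germ a q) = coord a (ram q)"
  by (simp add: germ_def)

lemma fls_subdegree_coord_Inf: "fls_subdegree (coord Inf N) = - int N"
  by (simp add: coord_eq)

lemma fls_subdegree_coord_Fin: "0 \<le> fls_subdegree (coord (Fin b) N)"
  by (rule fls_subdegree_ge0I) (simp add: coord_eq)

lemma pole_coord_Inf: "int N \<le> pole (coord Inf N, y)"
  by (simp add: pole_def fls_subdegree_coord_Inf)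

lemma pole_germ_Inf: "int (ram q) \<le> pole (germ Inf q)"
  by (simp add: germ_def pole_coord_Inf)

lemma pole_germ_Fin: "exp_factor q \<Longrightarrow> pole (germ (Fin b) q) = int (ram q) + int (irr q)"
proof -
  assume q: "exp_factor q"
  have "fls_subdegree (snd (germ (Fin b) q)) = - (int (ram q) + int (irr q))"
  proof (cases "q = 0")
    case True
    have "irr q = 0" using True by (simp add: irr_def ramified_poly_def)
    then show ?thesis using True by (simp add: germ_def)
  qed (use Dexp_subdegree[OF q] in \<open>simp add: germ_def\<close>)
  moreover have "0 \<le> fls_subdegree (fst (germ (Fin b) q))"
    by (simp add: fst_germ fls_subdegree_coord_Fin)
  ultimately show ?thesis by (simp add: pole_def)
qed

lemma irr_pos: "exp_factor q \<Longrightarrow> q \<noteq> 0 \<Longrightarrow> 0 < irr q"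
proof -
  assume "exp_factor q" "q \<noteq> 0"
  then have "0 < slope q * of_nat (ram q)" using slope_max(3)[of q] ram_pos[of q] by simp
  then show ?thesis by (simp flip: irr_eq)
qed

lemma irr_0 [simp]: "irr 0 = 0"
  by (simp add: irr_def ramified_poly_def)

lemma pole_germ_ge_1: "exp_factor q \<Longrightarrow> 1 \<le> pole (germ a q)"
  using pole_germ_Inf[of q] pole_germ_Fin[of q] ram_pos[of q] by (cases a) force+

lemma pole_germ_gt_coord_exp:
  assumes "exp_factor q" "q \<noteq> 0 \<or> a = Inf"
  shows "coord_exp a (ram q) < pole (germ a q)"
  using assms pole_germ_Inf[of q] pole_germ_Fin[of q] ram_pos[of q] irr_pos[of q] by (cases a) auto

text \<open>Terms of \<open>\<xi>\<close> which are not determined by \<open>q\<close> do not matter.\<close>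

lemma drop_tail:
  assumes "1 \<le> N" "ordge (- coord_exp a N) (y2 - y)" "coord_exp a N < pole (coord a N, y)"
  shows "germ_equiv (coord a N, y) (coord a N, y2)"
proof -
  define s where "s = coord_exp a N"
  define M where "M = pole (coord a N, y)"
  note M = M_def[unfolded pole_def fst_conv snd_conv]
  have sM: "s < M" "s \<noteq> 0" "1 \<le> M"
    using assms pole_coord_Inf[of N y] by (cases a; simp add: s_def M_def)+
  show ?thesis
  proof (cases "M = - s")
    case True
    then have "near M (gcomp (coord a N, y2) fps_X) (coord a N, y)"
      using assms(2) by (simp add: near_def s_def)
    then show ?thesis using sM unfolding germ_equiv_def M_def by (metis subdegree_fps_X)
  next
    case False
    have y: "fls_subdegree y = - M" "- s > - M"
    proof -
      show "- s > - M"
        using sM False pole_coord_Inf[of N y] by (cases a) (auto simp: s_def M_def)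
      then show "fls_subdegree y = - M"
      proof -
        have "- fls_subdegree (coord a N) \<noteq> M"
        proof (cases a)
          case (Fin b)
          then show ?thesis using fls_subdegree_coord_Fin[of b N] sM by simp
        next
          case Inf
          then show ?thesis using fls_subdegree_coord_Inf[of N] False by (simp add: s_def)
        qed
        then show ?thesis using M by (simp add: max_def split: if_splits)
      qed
    qed
    then have y0: "y \<noteq> 0" using sM by auto
    have eq: "y2 $$ j = y $$ j" if "j < - s" for j using assms(2) that by (simp add: ordge_def s_def)
    have "y $$ (- M) \<noteq> 0" using y y0 by (metis nth_fls_subdegree_nonzero)
    then have y2: "y2 \<noteq> 0" "fls_subdegree y2 = - M"
      using eq y by (auto intro!: fls_subdegree_eqI)
    \<comment> \<open>Here xi has the dominant pole M. The relative precision p = M - s is the one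
      at which an error t^(-s) in xi, of order -M, becomes an error t^M in z - a, of order s: xi is
      matched exactly and z absorbs the difference.\<close>
    define p where "p = nat (M - s)"
    have p: "1 \<le> p" "- M + int p = - s" using sM by (auto simp: p_def)
    then have pM: "s + int p = M" by linarith
    obtain g where g: "subdegree g = 1" "y2 \<diamondop> g = y" "ordge (1 + int p) (fps_to_fls g - fls_X)"
      using reparam(2)[OF y0 y2(1) y(1) y2(2) _ p(1)] assms(2) sM p(2) by (auto simp: s_def)
    have "ordge (s + int p) (fls_X_intpow s \<diamondop> g - fls_X_intpow s)"
      by (rule ordge_compose_near_id[OF g(1,3)]) (simp add: ordge_iff)
    then have "ordge M (coord a N \<diamondop> g - coord a N)"
      unfolding pM using subdegree_1D[OF g(1)] by (simp add: coord_eq fls_comp_simps flip: s_def)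
    then have "near M (gcomp (coord a N, y2) g) (coord a N, y)"
      using g(2) by (simp add: near_def gcomp_def)
    then show ?thesis using sM g(1) unfolding germ_equiv_def M_def by blast
  qed
qed

lemma normalize_first_coordinate:
  assumes "1 \<le> N" "coord_exp a N < pole (coord a N, y)" "subdegree h = e" "1 \<le> e"
    and near: "near (pole (coord a N, y)) (gcomp \<delta> h) (coord a N, y)"
  shows "\<exists>h'. subdegree h' = e \<and> fst \<delta> \<diamondop> h' = coord a N \<and> ordge (- coord_exp a N) (snd \<delta> \<diamondop> h' - y)"
proof -
  define s where "s = coord_exp a N"
  define M where "M = pole (coord a N, y)"
  have sM: "s < M" "s \<noteq> 0" "1 \<le> M" "- s \<le> M"
    using assms pole_coord_Inf[of N y] by (cases a; simp add: s_def M_def)+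
  have h: "subdegree h \<noteq> 0" using assms by simp
  define f2 where "f2 = fst \<delta> \<diamondop> h - fls_const (coord_base a)"
  define p where "p = nat (M - s)"
  have p: "1 \<le> p" "s + int p = M" using sM by (auto simp: p_def)
  have o: "ordge M (f2 - fls_X_intpow s)"
    using near by (simp add: near_def gcomp_def f2_def coord_eq M_def s_def algebra_simps)
  then have eq: "f2 $$ j = fls_X_intpow s $$ j" if "j < M" for j using that by (auto simp: ordge_def)
  have "f2 $$ s \<noteq> 0" using eq[of s] sM by simp
  moreover have "f2 $$ j = 0" if "j < s" for j using eq[of j] that sM by simp
  ultimately have f2: "f2 \<noteq> 0" "fls_subdegree f2 = s" by (auto intro!: fls_subdegree_eqI)
  obtain g where g: "subdegree g = 1" "f2 \<diamondop> g = fls_X_intpow s" "ordge (1 + int p) (fps_to_fls g - fls_X)"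
    using reparam(2)[of "fls_X_intpow s" f2 s p] f2 sM p o by auto
  define h' where "h' = h oo g"
  have h': "subdegree h' = e" using assms g by (simp add: h'_def subdegree_comp)
  have c: "F \<diamondop> h' = F \<diamondop> h \<diamondop> g" for F using h g by (simp add: h'_def fls_comp_assoc)
  have "fst \<delta> \<diamondop> h' = (f2 + fls_const (coord_base a)) \<diamondop> g" unfolding c by (simp add: f2_def)
  also have "\<dots> = coord a N" using g subdegree_1D[OF g(1)] by (simp add: fls_comp_simps coord_eq s_def)
  finally have 1: "fst \<delta> \<diamondop> h' = coord a N" .
  have "ordge M (snd \<delta> \<diamondop> h - y)" using near by (simp add: near_def gcomp_def M_def)
  then have "ordge M ((snd \<delta> \<diamondop> h - y) \<diamondop> g)" using g by (simp add: ordge_compose)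
  then have "ordge (- s) ((snd \<delta> \<diamondop> h - y) \<diamondop> g)" using sM ordge_mono by blast
  then have 2: "ordge (- s) (snd \<delta> \<diamondop> h' - y \<diamondop> g)"
    unfolding c using subdegree_1D[OF g(1)] by (simp add: fls_comp_simps)
  have "ordge (- M) y" using pole_le_iff[of M "(coord a N, y)"] sM by (simp add: M_def)
  then have "ordge (- M + int p) (y \<diamondop> g - y)" by (rule ordge_compose_near_id[OF g(1,3)])
  moreover have "- M + int p = - s" using p by linarith
  ultimately have "ordge (- s) (y \<diamondop> g - y)" by simp
  then have "ordge (- s) (snd \<delta> \<diamondop> h' - y)" using 2 ordge_trans by blast
  then show ?thesis using h' 1 by (auto simp: s_def)
qed

lemma Dexp_subst_root:
  assumes "exp_factor p" "\<omega> \<noteq> 0"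
  shows "Dexp a (subst_root \<omega> p) \<diamondop> (fps_const (inverse \<omega>) * fps_X) =
    fls_const (\<omega> powi coord_exp a (ram p)) * Dexp a p"
proof (rule fls_eqI)
  fix j
  define s where "s = coord_exp a (ram p)"
  have s: "s \<noteq> 0" using ram_pos[of p] by (simp add: s_def)
  define k where "k = (of_int (- (j + s)) / of_nat (ram p) :: rat)"
  have e: "exp_factor (subst_root \<omega> p)" using assms by (simp add: exp_factor_subst_root)
  have 1: "of_int s * Dexp a (subst_root \<omega> p) $$ j = of_int (j + s) * (lookup p k * inverse \<omega> ^ expo p k)"
    using Dexp_nth[OF e, of a j]
    unfolding ram_subst_root[OF assms(2)] s_def[symmetric] k_def[symmetric] lookup_subst_root .
  have 2: "of_int s * Dexp a p $$ j = of_int (j + s) * lookup p k"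
    using Dexp_nth[OF assms(1), of a j] by (simp add: s_def k_def)
  have 3: "lookup p k * inverse \<omega> ^ expo p k = lookup p k * \<omega> powi (j + s)"
  proof (cases "k \<in> keys p")
    case True
    have "k * of_nat (ram p) = of_int (- (j + s))" using ram_pos[of p] by (simp add: k_def)
    then have "of_nat (expo p k) = (of_int (- (j + s)) :: rat)" using expo_eq[OF assms(1) True] by simp
    then have "int (expo p k) = - (j + s)" by (metis of_int_eq_iff of_int_of_nat_eq)
    then have "j + s = - int (expo p k)" by simp
    then show ?thesis by (simp add: power_int_minus power_inverse)
  qed (simp add: in_keys_iff)
  have "of_int s * (Dexp a (subst_root \<omega> p) $$ j * inverse \<omega> powi j) =
      of_int (j + s) * lookup p k * (\<omega> powi (j + s) * inverse \<omega> powi j)"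
    using 1 3 by (simp add: mult_ac)
  also have "\<omega> powi (j + s) * inverse \<omega> powi j = \<omega> powi s"
    using assms(2) by (simp add: power_int_add power_int_inverse)
  finally have "of_int s * (Dexp a (subst_root \<omega> p) $$ j * inverse \<omega> powi j) = of_int s * (\<omega> powi s * Dexp a p $$ j)"
    using 2 by (simp add: mult_ac)
  then show "(Dexp a (subst_root \<omega> p) \<diamondop> (fps_const (inverse \<omega>) * fps_X)) $$ j =
      (fls_const (\<omega> powi coord_exp a (ram p)) * Dexp a p) $$ j"
    using s assms by (simp add: fls_nth_fls_compose_fps_linear flip: s_def)
qed

lemma subdegree_linear: "\<omega> \<noteq> 0 \<Longrightarrow> subdegree (fps_const (\<omega>::complex) * fps_X) = 1"
  by (rule subdegreeI) auto

lemma X_intpow_linear: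
  "\<omega> \<noteq> 0 \<Longrightarrow> fls_X_intpow n \<diamondop> (fps_const \<omega> * fps_X) = fls_const (\<omega> powi n) * fls_X_intpow n"
  by (rule fls_eqI) (simp add: fls_nth_fls_compose_fps_linear)

lemma coord_linear:
  "\<omega> \<noteq> 0 \<Longrightarrow> coord a N \<diamondop> (fps_const \<omega> * fps_X) = fls_const (coord_base a) + fls_const (\<omega> powi coord_exp a N) * fls_X_intpow (coord_exp a N)"
proof -
  assume w: "\<omega> \<noteq> 0"
  then have l: "subdegree (fps_const \<omega> * fps_X) \<noteq> 0" using subdegree_linear[of \<omega>] by simp
  show ?thesis
    by (simp only: coord_eq fls_comp_simps[OF l l] X_intpow_linear[OF w] fls_compose_fps_const)
qed

lemma subst_root_0 [simp]: "subst_root \<omega> 0 = 0"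
  by (intro poly_mapping_eqI) (simp add: lookup_subst_root)

lemma subst_root_eq_0: "\<omega> \<noteq> 0 \<Longrightarrow> subst_root \<omega> q = 0 \<longleftrightarrow> q = 0"
  using keys_subst_root[of \<omega> q] by (metis keys_eq_empty)

text \<open>The substitution \<open>z \<mapsto> z/\<mu>\<close> in terms of germs; for \<open>\<mu> = 1\<close> this is Galois conjugation.\<close>

lemma germ_equiv_subst_root:
  fixes a :: P1
  assumes "exp_factor p" "\<omega> \<noteq> 0"
  defines "\<mu> \<equiv> inverse \<omega> powi coord_exp a (ram p)"
  defines "b \<equiv> (case a of Inf \<Rightarrow> Inf | Fin c \<Rightarrow> Fin (\<mu> * c))"
  shows "germ_equiv (fls_const \<mu> * fst (germ a p), fls_const (inverse \<mu>) * snd (germ a p))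
    (germ b (subst_root \<omega> p))"
proof -
  define g where "g = fps_const (inverse \<omega>) * fps_X"
  have g: "subdegree g = 1" using assms(2) by (simp add: g_def subdegree_linear)
  have coord_exp: "coord_exp b N = coord_exp a N" for N by (cases a) (simp_all add: b_def)
  have coord_base: "coord_base b = \<mu> * coord_base a" by (cases a) (simp_all add: b_def)
  have D: "Dexp b q = Dexp a q" for q
    by (cases a) (simp_all add: b_def Dexp_def coord_eq)
  have im: "inverse \<mu> = \<omega> powi coord_exp a (ram p)"
    by (simp add: \<mu>_def power_int_inverse)
  have "gcomp (germ b (subst_root \<omega> p)) g = (fls_const \<mu> * fst (germ a p), fls_const (inverse \<mu>) * snd (germ a p))"
  proof (rule prod_eqI)
    have "fst (gcomp (germ b (subst_root \<omega> p)) g) = coord b (ram p) \<diamondop> g"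
      using assms by (simp add: gcomp_def fst_germ ram_subst_root)
    also have "\<dots> = fls_const \<mu> * coord a (ram p)"
    proof -
      have iw: "inverse \<omega> \<noteq> 0" using assms(2) by simp
      show ?thesis
        unfolding g_def coord_linear[OF iw] unfolding coord_exp coord_base coord_eq \<mu>_def[symmetric]
        by (simp add: distrib_left flip: fls_const_mult_const)
    qed
    finally show "fst (gcomp (germ b (subst_root \<omega> p)) g) = fst (fls_const \<mu> * fst (germ a p), fls_const (inverse \<mu>) * snd (germ a p))"
      by (simp add: fst_germ)
  next
    have "snd (germ b (subst_root \<omega> p)) \<diamondop> g = fls_const (inverse \<mu>) * snd (germ a p)"
    proof (cases "p = 0 \<and> a \<noteq> Inf")
      case True
      then have "b \<noteq> Inf" "inverse \<mu> = \<omega>" by (cases a; simp add: b_def im)+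
      then show ?thesis
        using True assms(2) X_intpow_linear[of "inverse \<omega>" "- 1"]
        by (simp add: germ_def g_def power_int_minus)
    next
      case False
      then have "\<not> (subst_root \<omega> p = 0 \<and> b \<noteq> Inf)"
        using assms(2) by (cases a) (auto simp: b_def subst_root_eq_0)
      then show ?thesis using False Dexp_subst_root[OF assms(1,2), of a]
        by (auto simp: germ_def D g_def im)
    qed
    then show "snd (gcomp (germ b (subst_root \<omega> p)) g) = snd (fls_const \<mu> * fst (germ a p), fls_const (inverse \<mu>) * snd (germ a p))"
      by (simp add: gcomp_def)
  qed
  then show ?thesis
    using germ_equiv_gcomp[OF g pole_germ_ge_1, of "subst_root \<omega> p" b] assms
    by (simp add: exp_factor_subst_root)
qed

lemma germ_equiv_galois:
  assumes "exp_factor p" "q \<in> galois_orbit p"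
  shows "germ_equiv (germ a p) (germ a q)"
proof -
  obtain \<omega> where w: "q = subst_root \<omega> p" "\<omega> ^ ram p = 1" using assms by (auto simp: galois_orbit_def)
  have nz: "\<omega> \<noteq> 0" using root_nonzero[OF w(2)] .
  have 1: "inverse \<omega> powi coord_exp a (ram p) = 1"
    using w(2) by (cases a) (auto simp: power_int_def power_inverse)
  show ?thesis using germ_equiv_subst_root[OF assms(1) nz, of a] unfolding 1 w(1)
    by (cases a) simp_all
qed

text \<open>A germ defined by a primitive exponential factor does not factor through a ramified covering.\<close>

lemma germ_primitive:
  assumes "exp_factor q" "1 \<le> e" "subdegree h = e" "near (pole (germ a q)) (gcomp \<delta> h) (germ a q)"
  shows "e = 1"
proof (cases "q = 0 \<and> a \<noteq> Inf")
  case True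
  then have "pole (germ a q) = 1" using pole_germ_Fin[OF assms(1)] by (cases a) simp_all
  moreover have "pole (gcomp \<delta> h) = pole (germ a q)"
    using assms(4) calculation by (intro pole_near[OF near_sym]) auto
  \<comment> \<open>A covering of degree e multiplies the pole order by e, and here the pole order
    is 1.\<close>
  ultimately have "pole \<delta> * int e = 1" using assms by (simp add: pole_gcomp)
  then show ?thesis by (auto simp: zmult_eq_1_iff)
next
  case False
  define r where "r = ram q"
  define s where "s = coord_exp a r"
  have r: "r \<ge> 1" using ram_pos by (simp add: r_def)
  have s: "s \<noteq> 0" using r by (simp add: s_def)
  have ge: "germ a q = (coord a r, Dexp a q)" using False by (auto simp: germ_def r_def)
  have "coord_exp a r < pole (coord a r, Dexp a q)"
    using pole_germ_gt_coord_exp[OF assms(1), of a] False by (simp add: ge r_def)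
  from normalize_first_coordinate[OF r this assms(3,2)] assms(4)
  obtain h' where h': "subdegree h' = e" "fst \<delta> \<diamondop> h' = coord a r" "ordge (- s) (snd \<delta> \<diamondop> h' - Dexp a q)"
    unfolding ge s_def by blast
  have h0: "subdegree h' \<noteq> 0" using h'(1) assms by simp
  define f where "f = fst \<delta> - fls_const (coord_base a)"
  have fh: "f \<diamondop> h' = fls_X_intpow s"
    using h'(2) h0 by (simp add: f_def fls_comp_simps coord_eq s_def)
  have fs: "fls_subdegree f * int e = s" using arg_cong[OF fh, of fls_subdegree] h0 h'(1)
    by (simp add: fls_subdegree_comp)
  then have f0: "f \<noteq> 0" "fls_subdegree f \<noteq> 0" using s by auto
  obtain k where k: "subdegree k = 1" "fls_X_intpow (fls_subdegree f) \<diamondop> k = f"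
    using normal_form[OF f0] by blast
  note ik = fps_inv_subdegree[OF k(1)]
  define w where "w = k oo h'"
  have w: "subdegree w = e" using k h0 h'(1) by (simp add: w_def subdegree_comp)
  have "fls_X_intpow (fls_subdegree f) \<diamondop> w = fls_X_intpow s"
    using k h0 fh by (simp add: w_def flip: fls_comp_assoc)
  then obtain \<omega> where om: "w = fps_const \<omega> * fps_X ^ e"
    using X_intpow_comp_eq[of w "fls_subdegree f" s] f0(2) w assms(2) by auto
  then have om0: "\<omega> \<noteq> 0" using w assms(2) by auto
  have "h' = fps_inv k oo w"
    unfolding w_def using ik h0 subdegree_1D[OF k(1)] subdegree_nonzeroD[OF h0]
    by (simp add: fps_compose_assoc)
  then have "snd \<delta> \<diamondop> h' = snd \<delta> \<diamondop> fps_inv k \<diamondop> w" using ik w assms by (simp add: fls_comp_assoc)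
  also have "w = (fps_const \<omega> * fps_X) oo (fps_X ^ e)"
    using assms(2) by (simp add: om fps_compose_mult_distrib)
  also have "snd \<delta> \<diamondop> fps_inv k \<diamondop> ((fps_const \<omega> * fps_X) oo (fps_X ^ e)) =
      (snd \<delta> \<diamondop> fps_inv k \<diamondop> (fps_const \<omega> * fps_X)) \<diamondop> (fps_X ^ e)"
    using assms(2) om0 subdegree_linear[of \<omega>] by (simp add: fls_comp_assoc)
  \<comment> \<open>In the coordinate \<open>k\<close> the covering is a monomial in t^e, so xi is a
    series in t^e. Together with e dividing r this means that r/e already clears the denominators of
    q, contradicting the minimality of \<open>ram q\<close> unless e = 1.\<close>
  finally have dv: "(snd \<delta> \<diamondop> h') $$ j = 0" if "\<not> int e dvd j" for j
    using that assms(2) by (simp add: fls_comp_X_power_nth)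
  have es: "int e dvd s" using fs by (metis dvd_triv_right)
  then have "e dvd r" unfolding s_def by (cases a) auto
  then obtain r' where r': "r = e * r'" by (auto simp: dvd_def)
  have "k * of_nat r' \<in> \<int>" if kq: "k \<in> keys q" for k
  proof -
    obtain m where m: "k * of_nat r = of_int m" using ram_Ints[OF kq] by (auto simp: r_def elim: Ints_cases)
    have "0 < k * of_nat r" using exp_factor_keys[OF assms(1) kq] r by simp
    then have m0: "m > 0" using m by simp
    define j where "j = - m - s"
    have j: "j < - s" "- (j + s) = m" using m0 by (auto simp: j_def)
    have "of_int (- (j + s)) / of_nat r = k" unfolding j(2) using m r by (simp flip: m)
    then have "of_int s * Dexp a q $$ j = of_int (j + s) * lookup q k"
      using Dexp_nth[OF assms(1), of a j] by (simp add: r_def s_def)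
    also have "j + s = - m" using j(2) by linarith
    also have "of_int (- m) * lookup q k \<noteq> 0" using m0 kq by (simp add: in_keys_iff)
    finally have "Dexp a q $$ j \<noteq> 0" by auto
    then have "(snd \<delta> \<diamondop> h') $$ j \<noteq> 0" using h'(3) j(1) by (auto simp: ordge_def)
    then have "int e dvd j" using dv by blast
    then have "int e dvd m" using es j(2) by (metis dvd_add dvd_minus_iff)
    then obtain n where "m = int e * n" by (auto simp: dvd_def)
    then have "k * of_nat r' = of_int n"
      using m assms(2) by (simp add: r' mult_ac)
    then show ?thesis by simp
  qed
  moreover have "1 \<le> r'" using r' r by (cases r') auto
  ultimately have "r \<le> r'" unfolding r_def by (intro ram_least)
  then show ?thesis using r' r assms(2) by auto
qed

text \<open>Once z is exact on both sides, the reparametrisation preserves a pure power of t, so it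
  is a rotation by an r-th root of unity and \<open>polar_twist\<close> identifies the factors up to
  conjugation. The tame circle at a finite point lies outside the range of this argument; it is
  recognised by its pole order 1 and by the constant term of z.\<close>

lemma germ_equiv_imp_conjugate:
  assumes "exp_factor q" "exp_factor q2" "germ_equiv (germ a q) (germ b q2)"
  shows "a = b \<and> q \<in> galois_orbit q2"
proof -
  define r where "r = ram q"
  define r2 where "r2 = ram q2"
  have r: "r \<ge> 1" "r2 \<ge> 1" using ram_pos by (simp_all add: r_def r2_def)
  obtain h where h: "subdegree h = 1" "near (pole (germ a q)) (gcomp (germ b q2) h) (germ a q)"
    using assms(3) by (auto simp: germ_equiv_def)
  have pe: "pole (germ b q2) = pole (germ a q)" using germ_equiv_pole[OF assms(3)] by simp
  have b_Fin: "\<exists>c. b = Fin c" if "ordge 1 (fst (germ b q2) \<diamondop> h - coord (Fin c) N)" "N \<ge> 1" for c N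
  proof (cases b)
    case Inf
    have "fls_subdegree (fst (germ b q2) \<diamondop> h) = - int r2"
      using h(1) by (simp add: fls_subdegree_comp fst_germ Inf fls_subdegree_coord_Inf r2_def)
    then have "(fst (germ b q2) \<diamondop> h) $$ (- int r2) \<noteq> 0"
      using r by (metis neg_equal_0_iff_equal nth_fls_subdegree_zero_iff of_nat_eq_0_iff fls_zero_subdegree not_one_le_zero)
    moreover have "coord (Fin c) N $$ (- int r2) = 0"
      using fls_subdegree_coord_Fin[of c N] r by (intro fls_eq0_below_subdegree) simp
    ultimately have False using that r by (auto simp: ordge_def)
    then show ?thesis ..
  qed auto
  show ?thesis
  proof (cases "q = 0 \<and> a \<noteq> Inf")
    case True
    then obtain c where a: "a = Fin c" by (cases a) auto
    have p1: "pole (germ a q) = 1" using pole_germ_Fin[OF assms(1), of c] True a by simp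
    have n: "ordge 1 (fst (germ b q2) \<diamondop> h - coord (Fin c) 1)"
      using h(2) True a p1 by (simp add: near_def gcomp_def fst_germ)
    then obtain d where b: "b = Fin d" using b_Fin by blast
    \<comment> \<open>At a finite point the pole order is \<open>ram + irr\<close>, so pole order 1
      leaves only the tame circle.\<close>
    have "irr q2 = 0" "r2 = 1" using pole_germ_Fin[OF assms(2), of d] p1 pe b r by (auto simp: r2_def)
    then have q2: "q2 = 0" using irr_pos[OF assms(2)] by auto
    have "(fst (germ b q2) \<diamondop> h - coord (Fin c) 1) $$ 0 = 0" using n by (simp add: ordge_def)
    moreover have "fst (germ b q2) \<diamondop> h = fls_const d + fps_to_fls h"
    proof -
      have "fst (germ b q2) = fls_const d + fls_X" by (simp add: fst_germ b q2 coord_eq fls_X_conv_shift_1)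
      then show ?thesis using subdegree_1D[OF h(1)] by (simp add: fls_comp_simps)
    qed
    ultimately have "c = d" using subdegree_1D[OF h(1)] by (simp add: coord_eq)
    then show ?thesis using True a b q2 galois_orbit_refl by simp
  next
    case False
    have ge: "germ a q = (coord a r, Dexp a q)" using False by (auto simp: germ_def r_def)
    have M: "coord_exp a r < pole (coord a r, Dexp a q)"
      using pole_germ_gt_coord_exp[OF assms(1), of a] False by (simp add: ge r_def)
    have "\<exists>h'. subdegree h' = 1 \<and> coord b r2 \<diamondop> h' = coord a r \<and>
        ordge (- coord_exp a r) (snd (germ b q2) \<diamondop> h' - Dexp a q)"
      using normalize_first_coordinate[OF r(1) M h(1) le_refl, of "germ b q2"] h(2)
      unfolding ge fst_germ r2_def by blast
    then obtain h' where h': "subdegree h' = 1" "coord b r2 \<diamondop> h' = coord a r"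
      "ordge (- coord_exp a r) (snd (germ b q2) \<diamondop> h' - Dexp a q)" by blast
    note h1 = subdegree_1D[OF h'(1)]
    have eq: "fls_const (coord_base b) + fls_X_intpow (coord_exp b r2) \<diamondop> h' = fls_const (coord_base a) + fls_X_intpow (coord_exp a r)"
      using h'(2) h1 by (simp add: coord_eq fls_comp_simps)
    have sub: "fls_subdegree (fls_X_intpow (coord_exp b r2) \<diamondop> h') = coord_exp b r2"
      using h1 h'(1) by (simp add: fls_subdegree_comp)
    have sc: "fls_subdegree (coord b r2) = fls_subdegree (coord a r)"
      using arg_cong[OF h'(2), of fls_subdegree] h1 h'(1) by (simp add: fls_subdegree_comp)
    have ab: "a = b"
    proof (cases a)
      case Inf
      show ?thesis
      proof (cases b)
        case (Fin d)
        then show ?thesis using sc fls_subdegree_coord_Fin[of d r2] r Inf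
          by (simp add: fls_subdegree_coord_Inf)
      qed (simp add: Inf)
    next
      case (Fin c)
      then obtain d where b: "b = Fin d"
        using sc fls_subdegree_coord_Fin[of c r] r by (cases b) (auto simp: fls_subdegree_coord_Inf)
      have "(fls_X_intpow (coord_exp b r2) \<diamondop> h') $$ 0 = 0"
        by (rule fls_eq0_below_subdegree, unfold sub) (use r b in simp)
      then have "d = c" using arg_cong[OF eq, of "\<lambda>f. f $$ 0"] Fin b r by simp
      then show ?thesis using Fin b by simp
    qed
    then have X: "fls_X_intpow (coord_exp a r2) \<diamondop> h' = fls_X_intpow (coord_exp a r)" using eq by simp
    then obtain \<omega> where w: "h' = fps_const \<omega> * fps_X" "\<omega> powi (coord_exp a r2) = 1" "coord_exp a r2 = coord_exp a r"
      using X_intpow_comp_eq[of h' "coord_exp a r2" "coord_exp a r"] h1 h'(1) r by auto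
    have rr: "r2 = r" using w(3) by (cases a) auto
    have w1: "\<omega> ^ r = 1" using w(2) rr by (cases a) (auto simp: power_int_minus)
    have rq: "ram q2 = ram q" using rr by (simp add: r_def r2_def)
    have "q = subst_root \<omega> q2"
    proof (rule polar_twist[OF assms(1,2) refl rq polar_Dexp[OF assms(1)] _ w1[unfolded r_def]])
      show "polar a (ram q) q2 (snd (germ a q2))"
        using polar_snd_germ[OF assms(2), of a] rq by simp
      show "ordge (- coord_exp a (ram q)) (snd (germ a q2) \<diamondop> (fps_const \<omega> * fps_X) - Dexp a q)"
        using h'(3) w(1) ab by (simp add: r_def)
    qed
    then show ?thesis using ab w1 rr by (auto simp: galois_orbit_def r_def r2_def)
  qed
qed

section \<open>The Legendre transform on germs\<close>

text \<open>Multiplication by t^m removes the pole of F and reduces the claim to the chain rule for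
  power series; the product rule then strips the factor off again.\<close>

lemma fls_deriv_comp:
  assumes "subdegree g \<noteq> 0"
  shows "fls_deriv (F \<diamondop> g) = (fls_deriv F \<diamondop> g) * fps_to_fls (fps_deriv g)"
proof -
  note g = subdegree_nonzeroD[OF assms]
  obtain m :: nat where "- int m \<le> fls_subdegree F" by (metis add.inverse_inverse neg_le_iff_le nat_le_iff order_refl zle_int)
  then have "0 \<le> fls_subdegree (fls_shift (- int m) F)" by (cases "F = 0") (auto)
  then obtain A where A: "fls_shift (- int m) F = fps_to_fls A"
    by (metis fls_regpart_to_fls_trivial)
  have AF: "fps_to_fls A = fls_X ^ m * F"
    using A by (simp add: fls_X_power_times_conv_shift)
  define G where "G = fps_to_fls g"
  define G' where "G' = fps_to_fls (fps_deriv g)"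
  have dG: "fls_deriv G = G'" by (simp add: G_def G'_def fls_deriv_fps_to_fls)
  have 1: "fps_to_fls (A oo g) = G ^ m * (F \<diamondop> g)"
    using arg_cong[OF AF, of "\<lambda>f. f \<diamondop> g"] g by (simp add: fls_compose_fps_mult fls_compose_fps_power G_def)
  have 2: "fps_to_fls (fps_deriv A) = of_nat m * fls_X ^ (m - 1) * F + fls_X ^ m * fls_deriv F"
    using arg_cong[OF AF, of fls_deriv] by (simp add: fls_deriv_fps_to_fls fls_deriv_power mult_ac add_ac)
  have 3: "fps_to_fls (fps_deriv A oo g) = of_nat m * G ^ (m - 1) * (F \<diamondop> g) + G ^ m * (fls_deriv F \<diamondop> g)"
    using arg_cong[OF 2, of "\<lambda>f. f \<diamondop> g"] g
    by (simp add: fls_compose_fps_mult fls_compose_fps_power fls_compose_fps_add G_def)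
  have "fls_deriv (fps_to_fls (A oo g)) = fps_to_fls (fps_deriv A oo g) * G'"
    using g by (simp add: fls_deriv_fps_to_fls fps_compose_deriv G'_def fls_times_fps_to_fls)
  then have "of_nat m * G ^ (m - 1) * G' * (F \<diamondop> g) + G ^ m * fls_deriv (F \<diamondop> g) =
     (of_nat m * G ^ (m - 1) * (F \<diamondop> g) + G ^ m * (fls_deriv F \<diamondop> g)) * G'"
    unfolding 1 3 by (simp add: fls_deriv_power dG mult_ac add_ac)
  then have "G ^ m * fls_deriv (F \<diamondop> g) = G ^ m * ((fls_deriv F \<diamondop> g) * G')"
    by (simp add: algebra_simps)
  moreover have "G \<noteq> 0" using g by (simp add: G_def)
  ultimately show ?thesis by (simp add: G'_def)
qed

lemma legendre_iff:
  "legendre a q b q' \<longleftrightarrow> (\<exists>\<rho> g. 1 \<le> \<rho> \<and> g \<noteq> 0 \<and> fps_nth g 0 = 0 \<and> Dexp a q \<diamondop> g = coord b \<rho> \<and>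
      is_polar_part \<rho> ((expansion q - Dexp a q * coord a (ram q)) \<diamondop> g) q')"
  by (simp add: legendre_def Dexp_def Let_def)

text \<open>A reparametrisation of higher order factors through one of order one.\<close>

lemma legendre_unramified:
  assumes "legendre a q b q'"
  shows "\<exists>\<rho> g. 1 \<le> \<rho> \<and> subdegree g = 1 \<and> Dexp a q \<diamondop> g = coord b \<rho> \<and>
      is_polar_part \<rho> ((expansion q - Dexp a q * coord a (ram q)) \<diamondop> g) q'"
proof -
  define W where "W = expansion q - Dexp a q * coord a (ram q)"
  obtain \<rho> g where g: "1 \<le> \<rho>" "g \<noteq> 0" "fps_nth g 0 = 0" "Dexp a q \<diamondop> g = coord b \<rho>"
    and P: "is_polar_part \<rho> (W \<diamondop> g) q'"
    using assms by (auto simp: legendre_iff W_def)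
  define d where "d = subdegree g"
  have d: "d \<ge> 1" using g(2,3) by (metis One_nat_def Suc_leI d_def neq0_conv nth_subdegree_nonzero)
  define f where "f = Dexp a q - fls_const (coord_base b)"
  have fg: "f \<diamondop> g = fls_X_intpow (coord_exp b \<rho>)"
    using g by (simp add: f_def fls_compose_fps_diff coord_eq)
  have fs: "fls_subdegree f * int d = coord_exp b \<rho>"
    using arg_cong[OF fg, of fls_subdegree] d by (simp add: fls_subdegree_comp d_def)
  then have f0: "f \<noteq> 0" "fls_subdegree f \<noteq> 0" using g(1) by auto
  obtain k where k: "subdegree k = 1" "fls_X_intpow (fls_subdegree f) \<diamondop> k = f"
    using normal_form[OF f0] by blast
  note ik = fps_inv_subdegree[OF k(1)]
  define w where "w = k oo g"
  have w: "subdegree w = d" using k d by (simp add: w_def d_def subdegree_comp)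
  have "fls_X_intpow (fls_subdegree f) \<diamondop> w = fls_X_intpow (coord_exp b \<rho>)"
    using k d fg by (simp add: w_def d_def flip: fls_comp_assoc)
  then obtain \<omega> where om: "w = fps_const \<omega> * fps_X ^ d" "\<omega> powi fls_subdegree f = 1"
    using X_intpow_comp_eq[of w "fls_subdegree f" "coord_exp b \<rho>"] f0(2) w d by auto
  then have om0: "\<omega> \<noteq> 0" using w d by auto
  have l: "subdegree (fps_const \<omega> * fps_X) = 1" using subdegree_linear[OF om0] .
  define g1 where "g1 = fps_inv k oo (fps_const \<omega> * fps_X)"
  have g1: "subdegree g1 = 1" using ik l by (simp add: g1_def subdegree_comp)
  have z: "fps_nth k 0 = 0" "fps_nth (fps_const \<omega> * fps_X) 0 = 0" "fps_nth (fps_X ^ d) 0 = (0::complex)"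
    using subdegree_1D[OF k(1)] d by (auto simp: power_0_left)
  have "g = fps_inv k oo w"
    unfolding w_def using ik z g(3) by (simp add: fps_compose_assoc)
  also have "w = (fps_const \<omega> * fps_X) oo (fps_X ^ d)"
    using z by (simp add: om fps_compose_mult_distrib)
  finally have gg1: "g = g1 oo (fps_X ^ d)"
    unfolding g1_def using z by (simp add: fps_compose_assoc)
  have "int d dvd coord_exp b \<rho>" using fs by (metis dvd_triv_right)
  then have "d dvd \<rho>" by (cases b) auto
  then obtain \<rho>0 where r0: "\<rho> = d * \<rho>0" by (auto simp: dvd_def)
  have s0: "fls_subdegree f = coord_exp b \<rho>0" using fs d unfolding r0 by (simp add: coord_exp_mult)
  have "f \<diamondop> fps_inv k = fls_X_intpow (fls_subdegree f) \<diamondop> k \<diamondop> fps_inv k" by (simp only: k(2))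
  also have "\<dots> = fls_X_intpow (coord_exp b \<rho>0)" using k(1) ik by (simp add: fls_comp_assoc s0)
  finally have fk: "f \<diamondop> fps_inv k = fls_X_intpow (coord_exp b \<rho>0)" .
  have "f \<diamondop> g1 = f \<diamondop> fps_inv k \<diamondop> (fps_const \<omega> * fps_X)"
    using ik l by (simp add: g1_def fls_comp_assoc)
  also note fk
  also have "fls_X_intpow (coord_exp b \<rho>0) \<diamondop> (fps_const \<omega> * fps_X) = fls_X_intpow (coord_exp b \<rho>0)"
    using X_intpow_linear[OF om0] om(2) by (simp add: s0)
  finally have "Dexp a q \<diamondop> g1 = coord b \<rho>0"
    using subdegree_1D[OF g1] by (simp add: f_def fls_comp_simps coord_eq algebra_simps)
  moreover have "is_polar_part \<rho>0 (W \<diamondop> g1) q'"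
    unfolding is_polar_part_def
  proof (intro conjI allI impI)
    show "exp_factor q'" using P by (simp add: is_polar_part_def)
    fix k :: rat assume "0 < k"
    then have L: "lookup q' k = (if k * of_nat \<rho> \<in> \<int> then (W \<diamondop> g) $$ (- \<lfloor>k * of_nat \<rho>\<rfloor>) else 0)"
      using P by (simp add: is_polar_part_def)
    have Wg: "W \<diamondop> g = (W \<diamondop> g1) \<diamondop> (fps_X ^ d)" using g1 d by (simp add: gg1 fls_comp_assoc)
    have kr: "k * of_nat \<rho> = of_nat d * (k * of_nat \<rho>0)" by (simp add: r0)
    show "lookup q' k = (if k * of_nat \<rho>0 \<in> \<int> then (W \<diamondop> g1) $$ (- \<lfloor>k * of_nat \<rho>0\<rfloor>) else 0)"
    proof (cases "k * of_nat \<rho>0 \<in> \<int>")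
      case True
      then obtain m where m: "k * of_nat \<rho>0 = of_int m" by (auto elim: Ints_cases)
      then have "k * of_nat \<rho> = of_int (int d * m)" by (simp add: kr)
      then have "lookup q' k = (W \<diamondop> g) $$ (- (int d * m))" unfolding L by (simp only: Ints_of_int floor_of_int if_True)
      also have "\<dots> = (W \<diamondop> g1) $$ (- m)" using d by (simp add: Wg fls_comp_X_power_nth flip: mult_minus_right)
      finally show ?thesis using m by simp
    next
      case False
      \<comment> \<open>Exponents visible for \<rho> but not for the smaller \<open>\<rho>0\<close>
        would need a power of t not divisible by d, whereas the series pulled back along g only
        contains powers of t^d.\<close>
      have "lookup q' k = 0"
      proof (cases "k * of_nat \<rho> \<in> \<int>")
        case True
        then obtain n where n: "k * of_nat \<rho> = of_int n" by (auto elim: Ints_cases)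
        have "\<not> int d dvd n"
        proof
          assume "int d dvd n"
          then obtain i where "n = int d * i" by (auto simp: dvd_def)
          then have "k * of_nat \<rho>0 = of_int i" using n d by (simp add: kr)
          then show False using False by simp
        qed
        then show ?thesis unfolding L using n d by (simp add: Wg fls_comp_X_power_nth)
      qed (simp add: L)
      then show ?thesis using False by simp
    qed
  qed
  moreover have "1 \<le> \<rho>0" using g(1) r0 by (cases \<rho>0) auto
  ultimately show ?thesis using g1 unfolding W_def by blast
qed

text \<open>From dq = xi dz one gets d(q - xi z) = - z dxi, so -z is the derivative of the transform
  with respect to xi. Comparing coefficients with dxi/dt = s t^(s-1) gives the claim.\<close>

lemma polar_legendre:
  assumes "1 \<le> \<rho>" "subdegree g = 1" "Dexp a q \<diamondop> g = coord b \<rho>"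
    "is_polar_part \<rho> ((expansion q - Dexp a q * coord a (ram q)) \<diamondop> g) q'"
  shows "polar b \<rho> q' (- (coord a (ram q) \<diamondop> g))"
proof -
  define Z where "Z = coord a (ram q)"
  define V where "V = (expansion q - Dexp a q * Z) \<diamondop> g"
  define Y where "Y = - (Z \<diamondop> g)"
  define s where "s = coord_exp b \<rho>"
  have g: "subdegree g \<noteq> 0" using assms by simp
  have "fls_deriv Z \<noteq> 0"
  proof
    assume "fls_deriv Z = 0"
    then have "fls_deriv Z $$ (coord_exp a (ram q) - 1) = 0" by simp
    then show False using ram_pos[of q] by (simp add: Z_def coord_eq)
  qed
  then have "Dexp a q * fls_deriv Z = fls_deriv (expansion q)" by (simp add: Dexp_def Z_def)
  then have dW: "fls_deriv (expansion q - Dexp a q * Z) = - (fls_deriv (Dexp a q) * Z)" by simp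
  have "fls_deriv V = fls_deriv (Dexp a q \<diamondop> g) * Y"
    unfolding V_def fls_deriv_comp[OF g] dW Y_def using g by (simp add: fls_comp_simps)
  also have "fls_deriv (Dexp a q \<diamondop> g) = fls_const (of_int s) * fls_X_intpow (s - 1)"
    unfolding assms(3) coord_eq s_def[symmetric] fls_deriv_add fls_deriv_const
  proof (rule fls_eqI)
    fix n
    show "(0 + fls_deriv (fls_X_intpow s)) $$ n = (fls_const (of_int s) * fls_X_intpow (s - 1) :: complex fls) $$ n"
      by (cases "n = s - 1") auto
  qed
  finally have "fls_deriv V = fls_const (of_int s) * (fls_X_intpow (s - 1) * Y)" by (simp only: mult.assoc)
  then have dV: "fls_deriv V = fls_const (of_int s) * fls_shift (- (s - 1)) Y"
    by (simp only: fls_X_intpow_times_conv_shift(1))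
  have "of_int s * Y $$ j = of_int (j + s) * V $$ (j + s)" for j
    using arg_cong[OF dV, of "\<lambda>f. f $$ (j + s - 1)"] by simp
  moreover have "lookup q' (of_int (- (j + s)) / of_nat \<rho>) = V $$ (j + s)" if "j < - s" for j
  proof -
    have k: "0 < of_int (- (j + s)) / (of_nat \<rho> :: rat)" using that assms(1) by simp
    have kr: "of_int (- (j + s)) / (of_nat \<rho> :: rat) * of_nat \<rho> = of_int (- (j + s))" using assms(1) by simp
    show ?thesis using assms(4)[unfolded is_polar_part_def, THEN conjunct2, rule_format, OF k]
      unfolding kr V_def[unfolded Z_def, symmetric] by (simp only: Ints_of_int floor_of_int if_True minus_minus)
  qed
  ultimately show ?thesis unfolding polar_def s_def[symmetric] Y_def[symmetric] Z_def[symmetric] by simp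
qed

lemma act_Fourier: "act (elem_matrix Fourier) \<gamma> = (snd \<gamma>, - fst \<gamma>)"
  by (simp add: act_def vector_2)

lemma Fourier_SL2: "elem_matrix Fourier \<in> SL2"
  by (simp add: SL2_iff vector_2)

text \<open>In the dual parameter the rotated germ (xi, -z) has first coordinate
  \<open>coord b \<rho>\<close> and polar part q'. This only shows that it is close to the germ of
  q' pulled back along t^e, where \<rho> = e * \<open>ram q'\<close>; excluding e > 1 is the real
  content. The last hypothesis is the condition s < M for the dual point.\<close>

lemma legendre_germ_equiv:
  assumes q: "exp_factor q" "q \<noteq> 0 \<or> a = Inf" and L: "legendre a q b q'"
    and b: "\<And>\<rho> g. 1 \<le> \<rho> \<Longrightarrow> subdegree g = 1 \<Longrightarrow> Dexp a q \<diamondop> g = coord b \<rho> \<Longrightarrow> coord_exp b \<rho> < pole (germ a q)"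
  shows "germ_equiv (act (elem_matrix Fourier) (germ a q)) (germ b q')"
proof -
  let ?F = "elem_matrix Fourier"
  obtain \<rho> g where g: "1 \<le> \<rho>" "subdegree g = 1" "Dexp a q \<diamondop> g = coord b \<rho>"
    and P: "is_polar_part \<rho> ((expansion q - Dexp a q * coord a (ram q)) \<diamondop> g) q'"
    using legendre_unramified[OF L] by blast
  have g0: "subdegree g \<noteq> 0" using g by simp
  define Y where "Y = - (coord a (ram q) \<diamondop> g)"
  have pY: "polar b \<rho> q' Y" unfolding Y_def using polar_legendre[OF g P] .
  have q': "exp_factor q'" using P by (simp add: is_polar_part_def)
  define M where "M = pole (germ a q)"
  have M1: "1 \<le> M" unfolding M_def by (rule pole_germ_ge_1[OF q(1)])
  have ge: "germ a q = (coord a (ram q), Dexp a q)" using q(2) by (auto simp: germ_def)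
  have c: "gcomp (act ?F (germ a q)) g = (coord b \<rho>, Y)"
    by (simp only: act_Fourier ge gcomp_def g(3) fst_conv snd_conv Y_def fls_compose_fps_uminus)
  have pF: "pole (act ?F (germ a q)) = M" using pole_act[OF Fourier_SL2] M1 by (simp add: M_def)
  have "pole (gcomp (act ?F (germ a q)) g) = M" using pF g by (simp add: pole_gcomp)
  then have pM: "pole (coord b \<rho>, Y) = M" by (simp only: c)
  have sM: "coord_exp b \<rho> < M" unfolding M_def using b[OF g] .
  have kr: "k * of_nat \<rho> \<in> \<int>" if "k \<in> keys q'" for k
  proof (rule ccontr)
    assume "k * of_nat \<rho> \<notin> \<int>"
    then have "lookup q' k = 0" using P exp_factor_keys[OF q' that] by (simp add: is_polar_part_def)
    then show False using that by (simp add: in_keys_iff)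
  qed
  then obtain e where e: "\<rho> = e * ram q'" using ram_dvd[of q' \<rho>] by (auto simp: dvd_def mult.commute)
  have e1: "1 \<le> e" using e g(1) by (cases e) auto
  define h where "h = (fps_X ^ e :: complex fps)"
  have h: "subdegree h = e" "subdegree h \<noteq> 0" using e1 by (simp_all add: h_def)
  have ch: "coord b (ram q') \<diamondop> h = coord b \<rho>"
  proof -
    have "fls_X_intpow n \<diamondop> h = fls_X_intpow (int e * n)" for n
      using e1 by (intro fls_eqI) (auto simp: h_def fls_comp_X_power_nth dvd_def)
    then show ?thesis using h by (simp add: coord_eq fls_comp_simps e coord_exp_mult)
  qed
  have "polar b (e * ram q') q' (Dexp b q' \<diamondop> h)" unfolding h_def
    using e1 ram_pos q' ram_Ints by (intro polar_comp_X_power polar_Dexp) auto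
  then have o: "ordge (- coord_exp b \<rho>) (Dexp b q' \<diamondop> h - Y)"
    using polar_unique[OF pY _ g(1)] e by simp
  \<comment> \<open>The exceptional clause of \<open>germ\<close> does not apply: at a finite point
    a vanishing derivative would bound the pole order by \<rho>, which is smaller than M.\<close>
  have ge': "germ b q' = (coord b (ram q'), Dexp b q')"
  proof (cases b)
    case (Fin c)
    have "Dexp b q' \<noteq> 0"
    proof
      assume "Dexp b q' = 0"
      then have "ordge (- coord_exp b \<rho>) Y" using o by (simp add: ordge_def)
      moreover have "ordge (- coord_exp b \<rho>) (coord b \<rho>)"
        using Fin by (auto simp: ordge_iff intro: order_trans[OF _ fls_subdegree_coord_Fin])
      ultimately have "pole (coord b \<rho>, Y) \<le> coord_exp b \<rho>" by (subst pole_le_iff) (auto simp: Fin)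
      then show False using pM sM by simp
    qed
    then show ?thesis by (auto simp: germ_def)
  qed (auto simp: germ_def)
  have "germ_equiv (coord b \<rho>, Y) (coord b \<rho>, Dexp b q' \<diamondop> h)"
    using drop_tail[OF g(1) o] sM pM by simp
  then obtain k where k: "subdegree k = 1" "near M (gcomp (coord b \<rho>, Dexp b q' \<diamondop> h) k) (coord b \<rho>, Y)"
    by (auto simp: germ_equiv_def pM)
  have "(coord b \<rho>, Dexp b q' \<diamondop> h) = gcomp (germ b q') h" by (simp add: ge' gcomp_def ch)
  then have n1: "near M (gcomp (gcomp (germ b q') h) k) (gcomp (act ?F (germ a q)) g)" using k(2) c by simp
  note ig = fps_inv_subdegree[OF g(2)]
  define l where "l = (h oo k) oo fps_inv g"
  have l: "subdegree l = e" using h k ig by (simp add: l_def subdegree_comp)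
  have hk: "subdegree (h oo k) \<noteq> 0" using h k by (simp add: subdegree_comp)
  have "near M (gcomp (gcomp (gcomp (germ b q') h) k) (fps_inv g)) (gcomp (gcomp (act ?F (germ a q)) g) (fps_inv g))"
    using n1 ig(1) by (intro near_gcomp)
  then have n2: "near M (gcomp (germ b q') l) (act ?F (germ a q))"
    using h k g ig hk by (simp add: gcomp_gcomp l_def)
  \<comment> \<open>Undoing the quarter turn presents the germ of q itself as a pullback of degree
    e, and that germ is primitive.\<close>
  obtain B where B: "B ** ?F = Finite_Cartesian_Product.mat 1" using SL2_inverse[OF Fourier_SL2] by blast
  have "near M (act B (gcomp (germ b q') l)) (act B (act ?F (germ a q)))" using near_act[OF n2] .
  then have "near M (gcomp (act B (germ b q')) l) (germ a q)"
    using l e1 B by (simp add: gcomp_act act_act)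
  then have "e = 1" using germ_primitive[OF q(1) e1 l] by (simp add: M_def)
  then show ?thesis using n2 l pF M1 unfolding germ_equiv_def by auto
qed

text \<open>Since xi - b (or xi, at infinity) has a nonzero order, it is a pure power in a suitable
  parameter. The polar part then has finite support because a Laurent series has a pole of finite
  order.\<close>

lemma legendre_exists:
  assumes "1 \<le> \<rho>" "Dexp a q - fls_const (coord_base b) \<noteq> 0" "fls_subdegree (Dexp a q - fls_const (coord_base b)) = coord_exp b \<rho>"
  shows "\<exists>q'. legendre a q b q'"
proof -
  obtain g where g: "subdegree g = 1" "(Dexp a q - fls_const (coord_base b)) \<diamondop> g = fls_X_intpow (coord_exp b \<rho>)"
    using reparam(1)[of "fls_X_intpow (coord_exp b \<rho>)" "Dexp a q - fls_const (coord_base b)" "coord_exp b \<rho>"] assms by auto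
  have D: "Dexp a q \<diamondop> g = coord b \<rho>"
    using g subdegree_1D[OF g(1)] by (simp add: fls_comp_simps coord_eq algebra_simps)
  define W where "W = (expansion q - Dexp a q * coord a (ram q)) \<diamondop> g"
  define f where "f = (\<lambda>k::rat. if 0 < k \<and> k * of_nat \<rho> \<in> \<int> then W $$ (- \<lfloor>k * of_nat \<rho>\<rfloor>) else 0)"
  have "{k. f k \<noteq> 0} \<subseteq> (\<lambda>n. of_int n / of_nat \<rho>) ` {0..- fls_subdegree W}"
  proof
    fix k assume "k \<in> {k. f k \<noteq> 0}"
    then have k: "0 < k" "k * of_nat \<rho> \<in> \<int>" "W $$ (- \<lfloor>k * of_nat \<rho>\<rfloor>) \<noteq> 0"
      by (auto simp: f_def split: if_splits)
    then obtain n where n: "k * of_nat \<rho> = of_int n" by (auto elim: Ints_cases)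
    have "0 < k * of_nat \<rho>" using k(1) assms(1) by simp
    then have "0 < n" using n by simp
    moreover have "fls_subdegree W \<le> - n" using k(3) n by (simp add: fls_subdegree_leI)
    ultimately have "n \<in> {0..- fls_subdegree W}" by simp
    moreover have "k = of_int n / of_nat \<rho>" using n assms(1) by (simp add: field_simps)
    ultimately show "k \<in> (\<lambda>n. of_int n / of_nat \<rho>) ` {0..- fls_subdegree W}" by blast
  qed
  then have fin: "finite {k. f k \<noteq> 0}" by (rule finite_subset) simp
  define q' where "q' = Abs_poly_mapping f"
  have lq: "lookup q' = f" unfolding q'_def using fin by (rule lookup_Abs_poly_mapping)
  have "is_polar_part \<rho> W q'"
    by (auto simp: is_polar_part_def exp_factor_def in_keys_iff lq f_def split: if_splits)
  then show ?thesis unfolding legendre_iff using D assms(1) subdegree_1D[OF g(1)] W_def by blast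
qed

section \<open>The action on circles\<close>

lemma Rep_circ: "exp_factor q \<Longrightarrow> Rep_circle (circ a q) = (a, galois_orbit q)"
  unfolding circ_def by (rule Abs_circle_inverse) auto

lemma base_point_circ [simp]: "exp_factor q \<Longrightarrow> base_point (circ a q) = a"
  by (simp add: base_point_def Rep_circ)

lemma conjugates_circ [simp]: "exp_factor q \<Longrightarrow> conjugates (circ a q) = galois_orbit q"
  by (simp add: conjugates_def Rep_circ)

lemma circ_eq_iff:
  assumes "exp_factor p" "exp_factor q"
  shows "circ a p = circ b q \<longleftrightarrow> a = b \<and> p \<in> galois_orbit q"
proof -
  have "circ a p = circ b q \<longleftrightarrow> a = b \<and> galois_orbit p = galois_orbit q"
    using Rep_circle_inject[of "circ a p" "circ b q"] by (simp add: Rep_circ assms)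
  then show ?thesis using galois_orbit_eq galois_orbit_refl by blast
qed

lemma circle_cases:
  obtains a q where "c = circ a q" "exp_factor q"
proof -
  obtain a q where "Rep_circle c = (a, galois_orbit q)" "exp_factor q" using Rep_circle[of c] by auto
  then have "c = circ a q" unfolding circ_def by (metis Rep_circle_inverse)
  then show ?thesis using \<open>exp_factor q\<close> that by blast
qed

lemma ram_conjugate: "p \<in> galois_orbit q \<Longrightarrow> ram p = ram q"
  using root_nonzero ram_subst_root by (auto simp: galois_orbit_def)

lemma irr_conjugate:
  assumes "exp_factor q" "p \<in> galois_orbit q"
  shows "irr p = irr q"
proof -
  obtain \<omega> where w: "p = subst_root \<omega> q" "\<omega> ^ ram q = 1" using assms by (auto simp: galois_orbit_def)
  have nz: "\<omega> \<noteq> 0" using root_nonzero[OF w(2)] .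
  have p: "exp_factor p" using assms nz by (simp add: w exp_factor_subst_root)
  show ?thesis
  proof (cases "q = 0")
    case False
    have k: "keys p = keys q" using nz by (simp add: w keys_subst_root)
    have "irr p = expo p (slope q)" using slope_max[OF assms(1) False] k p by (intro irr_eqI) auto
    moreover have "irr q = expo q (slope q)" using slope_max[OF assms(1) False] assms by (intro irr_eqI) auto
    ultimately show ?thesis using nz by (simp add: w expo_subst_root)
  qed (simp add: w)
qed

lemma circle_ram_circ [simp]: "exp_factor q \<Longrightarrow> circle_ram (circ a q) = ram q"
  unfolding circle_ram_def
  by (metis (mono_tags, lifting) conjugates_circ galois_orbit_refl ram_conjugate someI)

text \<open>The action by a matrix without any factorization. For A in SL2 the choice of
  representatives is immaterial, since conjugate factors have equivalent germs.\<close>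

definition circle_rel :: "complex^2^2 \<Rightarrow> circle \<Rightarrow> circle \<Rightarrow> bool" where
  "circle_rel A c d \<longleftrightarrow> (\<exists>a q b p. exp_factor q \<and> exp_factor p \<and> c = circ a q \<and> d = circ b p \<and>
     germ_equiv (act A (germ a q)) (germ b p))"

lemma circle_rel_circ:
  assumes "A \<in> SL2" "exp_factor q" "exp_factor p"
  shows "circle_rel A (circ a q) (circ b p) \<longleftrightarrow> germ_equiv (act A (germ a q)) (germ b p)"
proof
  assume "circle_rel A (circ a q) (circ b p)"
  then obtain a' q' b' p' where *: "exp_factor q'" "exp_factor p'" "circ a q = circ a' q'" "circ b p = circ b' p'"
     "germ_equiv (act A (germ a' q')) (germ b' p')" unfolding circle_rel_def by blast
  then have "a = a'" "q \<in> galois_orbit q'" "b = b'" "p \<in> galois_orbit p'" using circ_eq_iff assms by blast+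
  then have "germ_equiv (germ a' q') (germ a q)" "germ_equiv (germ b' p') (germ b p)"
    using germ_equiv_galois * by blast+
  then show "germ_equiv (act A (germ a q)) (germ b p)"
    using germ_equiv_act[OF assms(1)] germ_equiv_sym germ_equiv_trans *(5) by meson
qed (use assms circle_rel_def in blast)

lemma circle_rel_one: "circle_rel (Finite_Cartesian_Product.mat 1) c c"
proof -
  obtain a q where "c = circ a q" "exp_factor q" by (rule circle_cases)
  then show ?thesis unfolding circle_rel_def using germ_equiv_refl pole_germ_ge_1 act_one by metis
qed

lemma circle_rel_mult:
  assumes "A \<in> SL2" "B \<in> SL2" "circle_rel A c d" "circle_rel B d e"
  shows "circle_rel (B ** A) c e"
proof -
  obtain a q where c: "c = circ a q" "exp_factor q" by (rule circle_cases)
  obtain b p where d: "d = circ b p" "exp_factor p" by (rule circle_cases)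
  obtain b' p' where e: "e = circ b' p'" "exp_factor p'" by (rule circle_cases)
  have "germ_equiv (act A (germ a q)) (germ b p)" "germ_equiv (act B (germ b p)) (germ b' p')"
    using assms c d e circle_rel_circ by auto
  then have "germ_equiv (act (B ** A) (germ a q)) (germ b' p')"
    using germ_equiv_act[OF assms(2)] germ_equiv_trans by (metis act_act)
  then show ?thesis using c e circle_rel_def by blast
qed

lemma circle_rel_one_eq:
  assumes "circle_rel (Finite_Cartesian_Product.mat 1) c d"
  shows "c = d"
proof -
  obtain a q b p where *: "exp_factor q" "exp_factor p" "c = circ a q" "d = circ b p"
     "germ_equiv (germ a q) (germ b p)" using assms unfolding circle_rel_def by auto
  then show ?thesis using germ_equiv_imp_conjugate[OF *(1,2,5)] circ_eq_iff by blast
qed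

lemma circle_rel_inverse:
  assumes "A \<in> SL2" "B ** A = Finite_Cartesian_Product.mat 1" "B \<in> SL2" "circle_rel A c d"
  shows "circle_rel B d c"
proof -
  obtain a q where c: "c = circ a q" "exp_factor q" by (rule circle_cases)
  obtain b p where d: "d = circ b p" "exp_factor p" by (rule circle_cases)
  have "germ_equiv (act A (germ a q)) (germ b p)"
    using assms c d circle_rel_circ by auto
  then have "germ_equiv (act B (act A (germ a q))) (act B (germ b p))"
    using germ_equiv_act assms by blast
  then have "germ_equiv (act B (germ b p)) (germ a q)"
    using assms germ_equiv_sym by (simp add: act_act)
  then show ?thesis using c d circle_rel_def by blast
qed

lemma circle_rel_right_unique:
  assumes "A \<in> SL2" "circle_rel A c d" "circle_rel A c e"
  shows "d = e"
proof -
  obtain B where B: "B \<in> SL2" "B ** A = Finite_Cartesian_Product.mat 1" "A ** B = Finite_Cartesian_Product.mat 1"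
    using SL2_inverse assms(1) by blast
  have "circle_rel (A ** B) d e"
    using circle_rel_mult[OF B(1) assms(1) circle_rel_inverse[OF assms(1) B(2,1) assms(2)] assms(3)] .
  then show ?thesis using B circle_rel_one_eq by simp
qed

lemma circle_rel_left_unique:
  assumes "A \<in> SL2" "circle_rel A c e" "circle_rel A d e"
  shows "c = d"
proof -
  obtain B where B: "B \<in> SL2" "B ** A = Finite_Cartesian_Product.mat 1" "A ** B = Finite_Cartesian_Product.mat 1"
    using SL2_inverse assms(1) by blast
  then show ?thesis
    using circle_rel_right_unique[OF B(1)] circle_rel_inverse[OF assms(1) B(2,1)] assms by blast
qed

section \<open>Elementary transformations as linear maps of germs\<close>

lemma ram_add_integral:
  assumes "k \<in> \<int>"
  shows "ram (Poly_Mapping.single k c + q) = ram q"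
proof (rule ram_cong)
  fix N :: nat
  have k: "k * of_nat N \<in> \<int>" using assms by simp
  have "l \<noteq> k \<Longrightarrow> l \<in> keys (Poly_Mapping.single k c + q) \<longleftrightarrow> l \<in> keys q" for l
    by (simp add: in_keys_iff lookup_add lookup_single_not_eq)
  then show "(\<forall>l\<in>keys (Poly_Mapping.single k c + q). l * of_nat N \<in> \<int>) \<longleftrightarrow> (\<forall>l\<in>keys q. l * of_nat N \<in> \<int>)"
    using k by metis
qed

lemma Dexp_add_single:
  assumes "exp_factor q" "1 \<le> n"
  shows "Dexp Inf (Poly_Mapping.single (of_nat n) c + q) =
    fls_const (of_nat n * c) * fls_X_intpow (- (int n - 1) * int (ram q)) + Dexp Inf q"
proof (rule fls_eqI)
  fix j
  define p where "p = Poly_Mapping.single (of_nat n) c + q"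
  define r where "r = ram q"
  have r: "r \<ge> 1" using ram_pos[of q] by (simp add: r_def)
  have p: "exp_factor p" unfolding p_def using assms by (intro exp_factor_add exp_factor_single) auto
  have rp: "ram p = r" unfolding p_def r_def by (rule ram_add_integral) simp
  define k where "k = (of_int (- (j - int r)) / of_nat r :: rat)"
  have kn: "k = of_nat n \<longleftrightarrow> j = - (int n - 1) * int r"
  proof -
    have "k = of_nat n \<longleftrightarrow> (of_int (- (j - int r)) :: rat) = of_int (int n * int r)"
      using r by (simp add: k_def field_simps)
    also have "\<dots> \<longleftrightarrow> - (j - int r) = int n * int r" by (simp only: of_int_eq_iff)
    finally show ?thesis by (auto simp: algebra_simps)
  qed
  have 1: "of_int (- int r) * Dexp Inf p $$ j = of_int (j - int r) * lookup p k"
    using Dexp_nth[OF p, of Inf j] unfolding rp coord_exp_simps k_def by simp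
  have 2: "of_int (- int r) * Dexp Inf q $$ j = of_int (j - int r) * lookup q k"
    using Dexp_nth[OF assms(1), of Inf j] unfolding r_def[symmetric] coord_exp_simps k_def by simp
  have "lookup (Poly_Mapping.single (of_nat n) c) k = (if k = of_nat n then c else 0)"
    by (simp add: lookup_single when_def eq_commute)
  then have 3: "lookup p k = (if j = - (int n - 1) * int r then c else 0) + lookup q k"
    by (simp only: p_def lookup_add kn)
  have "of_int (- int r) * (Dexp Inf p $$ j - Dexp Inf q $$ j) =
     of_int (j - int r) * (if j = - (int n - 1) * int r then c else 0)"
    unfolding right_diff_distrib 1 2 3 by (simp only: distrib_left add_diff_cancel_right')
  also have "\<dots> = of_int (- int r) * (if j = - (int n - 1) * int r then of_nat n * c else 0)"
  proof (cases "j = - (int n - 1) * int r")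
    case True
    have e: "(of_int (j - int r) :: complex) = of_int (- int r) * of_nat n"
      unfolding True by (simp add: algebra_simps)
    show ?thesis unfolding e if_P[OF True] by (simp only: mult.assoc)
  qed simp
  finally have "of_int (- int r) * (Dexp Inf p $$ j - Dexp Inf q $$ j) =
     of_int (- int r) * (if j = - (int n - 1) * int r then of_nat n * c else 0)" .
  then have "Dexp Inf p $$ j - Dexp Inf q $$ j = (if j = - (int n - 1) * int r then of_nat n * c else 0)"
    using r by (simp only: mult_cancel_left) auto
  then show "Dexp Inf (Poly_Mapping.single (of_nat n) c + q) $$ j =
    (fls_const (of_nat n * c) * fls_X_intpow (- (int n - 1) * int (ram q)) + Dexp Inf q) $$ j"
    unfolding p_def[symmetric] r_def[symmetric] by (auto simp: algebra_simps)
qed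

text \<open>Near a finite point z is holomorphic, so the twist alters xi by a power series only,
  which is not visible in the polar part.\<close>

lemma elem_circle_twist_fin:
  assumes "exp_factor q"
  shows "germ_equiv (act (elem_matrix (Twist \<mu>)) (germ (Fin a) q)) (germ (Fin a) q)"
proof -
  define y where "y = snd (germ (Fin a) q)"
  define y2 where "y2 = y - fls_const \<mu> * coord (Fin a) (ram q)"
  have g: "germ (Fin a) q = (coord (Fin a) (ram q), y)" by (simp add: y_def germ_def)
  have g2: "act (elem_matrix (Twist \<mu>)) (germ (Fin a) q) = (coord (Fin a) (ram q), y2)"
    by (simp add: g act_def vector_2 y2_def)
  have "ordge 0 (coord (Fin a) (ram q))" using fls_subdegree_coord_Fin by (auto simp: ordge_iff)
  then have c: "ordge 0 (y2 - y)" unfolding y2_def by (simp add: ordge_uminus ordge_const_mult)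
  show ?thesis
  proof (cases "q = 0")
    case False
    have "ordge (- coord_exp (Fin a) (ram q)) (y2 - y)" using c by (rule ordge_mono) simp
    then have "germ_equiv (coord (Fin a) (ram q), y) (coord (Fin a) (ram q), y2)"
      using drop_tail[OF ram_pos, of "Fin a" q y2 y] pole_germ_gt_coord_exp[OF assms, of "Fin a"] False by (simp add: g)
    from germ_equiv_sym[OF this] show ?thesis by (subst g2, subst g)
  next
    case True
    have y: "y = fls_X_intpow (- 1)" using True by (simp add: y_def germ_def)
    have eq: "y2 $$ j = y $$ j" if "j < 0" for j using c that by (auto simp: ordge_def)
    have y0: "y \<noteq> 0" "fls_subdegree y = - 1" by (simp_all add: y fls_shift_eq0_iff)
    have nth: "y2 $$ (- 1) = 1" "\<And>j. j < - 1 \<Longrightarrow> y2 $$ j = 0" using eq by (simp_all add: y)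
    then have y2: "y2 \<noteq> 0" "fls_subdegree y2 = - 1"
      by (force, intro fls_subdegree_eqI) (simp_all add: nth)
    \<comment> \<open>In the tame case M = 1 and a constant added to xi = 1/t is visible, but 1/t +
      O(1) is 1/t in another parameter. The change of parameter moves z by O(t), which is below the
      precision.\<close>
    obtain h where h: "subdegree h = 1" "y \<diamondop> h = y2"
      using reparam(1)[OF y2(1) y0(1) y2(2) y0(2)] by auto
    have p: "pole (coord (Fin a) 1, y2) = 1"
      using fls_subdegree_coord_Fin[of a 1] y2 by (simp add: pole_def)
    have "coord (Fin a) 1 = fls_const a + fls_X" by (simp add: coord_eq fls_X_conv_shift_1)
    then have "coord (Fin a) 1 \<diamondop> h - coord (Fin a) 1 = fps_to_fls h - fls_X"
      using subdegree_1D[OF h(1)] by (simp add: fls_comp_simps)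
    moreover have "ordge 1 (fps_to_fls h - fls_X)"
      using h(1) by (intro ordge_diff) (auto simp: ordge_iff fls_subdegree_fls_to_fps)
    ultimately have "near 1 (gcomp (coord (Fin a) 1, y) h) (coord (Fin a) 1, y2)"
      using h by (simp add: near_def gcomp_def)
    then have e: "germ_equiv (coord (Fin a) 1, y2) (coord (Fin a) 1, y)"
      unfolding germ_equiv_def p using h(1) by auto
    have r1: "ram q = 1" using True by simp
    show ?thesis by (subst g2, subst g, unfold r1, rule e)
  qed
qed

lemma Twist_SL2: "elem_matrix (Twist \<mu>) \<in> SL2"
  by (simp add: SL2_iff vector_2)

lemma Scale_SL2_iff: "elem_matrix (Scale \<mu>) \<in> SL2 \<longleftrightarrow> \<mu> \<noteq> 0"
  by (cases "\<mu> = 0") (simp_all add: SL2_iff vector_2)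

lemma Dexp_large_slope:
  assumes "exp_factor q" "1 < slope q"
  shows "Dexp Inf q \<noteq> 0" "fls_subdegree (Dexp Inf q) = - int (irr q - ram q)" "ram q < irr q"
proof -
  have q: "q \<noteq> 0" using assms by auto
  have "(of_nat (ram q) :: rat) < of_nat (irr q)"
    using assms(2) ram_pos[of q] by (simp add: slope_def)
  then show "ram q < irr q" by simp
  then show "Dexp Inf q \<noteq> 0" "fls_subdegree (Dexp Inf q) = - int (irr q - ram q)"
    using Dexp_subdegree[OF assms(1) q, of Inf] by auto
qed

lemma Dexp_small_slope:
  fixes \<alpha> :: complex
  assumes "exp_factor q" "0 < slope q" "slope q < 1"
  defines "p \<equiv> Poly_Mapping.single 1 \<alpha> + q"
  shows "exp_factor p" "ram p = ram q" "Dexp Inf p = fls_const \<alpha> + Dexp Inf q"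
    "Dexp Inf q \<noteq> 0" "fls_subdegree (Dexp Inf q) = int (ram q - irr q)" "irr q < ram q"
proof -
  have q: "q \<noteq> 0" using assms by auto
  show "exp_factor p" unfolding p_def using assms by (intro exp_factor_add exp_factor_single) auto
  show "ram p = ram q" unfolding p_def by (rule ram_add_integral) simp
  show "Dexp Inf p = fls_const \<alpha> + Dexp Inf q"
    using Dexp_add_single[OF assms(1), of 1 \<alpha>] by (simp add: p_def)
  have "(of_nat (irr q) :: rat) < of_nat (ram q)"
    using assms(3) ram_pos[of q] by (simp add: slope_def)
  then show "irr q < ram q" by simp
  then show "Dexp Inf q \<noteq> 0" "fls_subdegree (Dexp Inf q) = int (ram q - irr q)"
    using Dexp_subdegree[OF assms(1) q, of Inf] by auto
qed

lemma germ_single_1: "germ Inf (Poly_Mapping.single 1 c) = (fls_X_intpow (- 1), fls_const c)"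
  using Dexp_add_single[of 0 1 c] ram_add_integral[of 1 c 0] by (simp add: germ_def coord_eq)

lemma germ_tame: "germ (Fin a) 0 = (fls_const a + fls_X, fls_X_intpow (- 1))"
  by (simp add: germ_def coord_eq fls_X_conv_shift_1)

lemma legendre_exp_factor: "legendre a q b p \<Longrightarrow> exp_factor p"
  by (auto simp: legendre_iff is_polar_part_def)

lemma elem_circle_rel:
  assumes "elem_circle E c \<phi> d"
  shows "circle_rel (elem_matrix E) c d"
  using assms
proof cases
  case (twist_inf q \<mu>)
  define p where "p = q - Poly_Mapping.single 2 (\<mu> / 2)"
  have p: "p = Poly_Mapping.single (of_nat 2) (- \<mu> / 2) + q"
    by (simp add: p_def single_uminus)
  have ep: "exp_factor p" unfolding p using twist_inf by (intro exp_factor_add exp_factor_single) auto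
  have "ram p = ram q" unfolding p by (rule ram_add_integral) simp
  moreover have "Dexp Inf p = fls_const (- \<mu>) * fls_X_intpow (- int (ram q)) + Dexp Inf q"
    using Dexp_add_single[OF \<open>exp_factor q\<close>, of 2 "- \<mu> / 2"] unfolding p by simp
  ultimately have "act (elem_matrix E) (germ Inf q) = germ Inf p"
    unfolding twist_inf by (simp add: act_def germ_def vector_2 coord_eq)
  then have "germ_equiv (act (elem_matrix E) (germ Inf q)) (germ Inf p)"
    using germ_equiv_refl[OF pole_germ_ge_1[OF ep]] by simp
  then show ?thesis unfolding circle_rel_def using twist_inf ep unfolding p_def by blast
next
  case (twist_fin q \<mu> a)
  then show ?thesis using elem_circle_twist_fin circle_rel_def by blast
next
  case (scale_inf q \<mu> \<omega>)
  then have w: "\<omega> \<noteq> 0" using ram_pos[of q] by (auto simp: power_0_left)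
  have "inverse \<omega> powi coord_exp Inf (ram q) = \<mu>" using scale_inf by (simp add: power_int_minus power_inverse)
  then have "germ_equiv (act (elem_matrix E) (germ Inf q)) (germ Inf (subst_root \<omega> q))"
    using germ_equiv_subst_root[OF \<open>exp_factor q\<close> w, of Inf] scale_inf by (simp add: act_def vector_2)
  then show ?thesis unfolding circle_rel_def using scale_inf w exp_factor_subst_root by blast
next
  case (scale_fin q \<mu> \<omega> a)
  then have w: "\<omega> \<noteq> 0" using ram_pos[of q] by (auto simp: power_0_left)
  have "inverse \<omega> powi coord_exp (Fin a) (ram q) = \<mu>" using scale_fin by (simp add: power_inverse)
  then have "germ_equiv (act (elem_matrix E) (germ (Fin a) q)) (germ (Fin (\<mu> * a)) (subst_root \<omega> q))"
    using germ_equiv_subst_root[OF \<open>exp_factor q\<close> w, of "Fin a"] scale_fin by (simp add: act_def vector_2)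
  then show ?thesis unfolding circle_rel_def using scale_fin w exp_factor_subst_root by blast
next
  case (fourier_large_slope q q')
  then have "germ_equiv (act (elem_matrix Fourier) (germ Inf q)) (germ Inf q')"
    using pole_germ_ge_1[of q Inf] by (intro legendre_germ_equiv) auto
  then show ?thesis unfolding circle_rel_def using fourier_large_slope legendre_exp_factor by blast
next
  case (fourier_fin q a q')
  then have "germ_equiv (act (elem_matrix Fourier) (germ (Fin a) q)) (germ Inf q')"
    using pole_germ_ge_1[of q "Fin a"] by (intro legendre_germ_equiv) auto
  then show ?thesis unfolding circle_rel_def using fourier_fin legendre_exp_factor by blast
next
  case (fourier_tame_fin a)
  have e: "exp_factor (Poly_Mapping.single 1 (- a))" by (simp add: exp_factor_single)
  \<comment> \<open>Fourier turns (a + t, 1/t) into (1/t, -a - t), which agrees with (1/t, -a)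
    modulo t.\<close>
  have "near 1 (gcomp (germ Inf (Poly_Mapping.single 1 (- a))) fps_X) (act (elem_matrix Fourier) (germ (Fin a) 0))"
    unfolding act_Fourier gcomp_X germ_single_1 germ_tame by (auto simp: near_def ordge_def)
  moreover have "pole (act (elem_matrix Fourier) (germ (Fin a) 0)) = 1"
    using pole_act[OF Fourier_SL2 pole_germ_ge_1[OF exp_factor_0]] pole_germ_Fin[OF exp_factor_0] by simp
  ultimately have "germ_equiv (act (elem_matrix Fourier) (germ (Fin a) 0)) (germ Inf (Poly_Mapping.single 1 (- a)))"
    unfolding germ_equiv_def by (metis order_refl subdegree_fps_X)
  then show ?thesis unfolding circle_rel_def using fourier_tame_fin e exp_factor_0 by blast
next
  case (fourier_tame_inf \<alpha>)
  have e: "exp_factor (Poly_Mapping.single 1 \<alpha>)" by (simp add: exp_factor_single)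
  \<comment> \<open>Fourier turns (1/t, \<alpha>) into (\<alpha>, -1/t); the substitution of -t
    accounts for the sign and introduces an error of order t in z.\<close>
  define h where "h = (fps_const (- 1) * fps_X :: complex fps)"
  have h: "subdegree h = 1" unfolding h_def by (rule subdegree_linear) simp
  have "fst (gcomp (germ (Fin \<alpha>) 0) h) - fst (act (elem_matrix Fourier) (germ Inf (Poly_Mapping.single 1 \<alpha>))) = fps_to_fls h"
    unfolding act_Fourier germ_single_1 germ_tame using subdegree_1D[OF h] by (simp add: gcomp_def fls_comp_simps)
  moreover have "snd (gcomp (germ (Fin \<alpha>) 0) h) = snd (act (elem_matrix Fourier) (germ Inf (Poly_Mapping.single 1 \<alpha>)))"
    unfolding act_Fourier germ_single_1 germ_tame h_def gcomp_def using X_intpow_linear[of "- 1" "- 1"] by simp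
  ultimately have "near 1 (gcomp (germ (Fin \<alpha>) 0) h) (act (elem_matrix Fourier) (germ Inf (Poly_Mapping.single 1 \<alpha>)))"
    using h by (simp add: near_def ordge_iff fls_subdegree_fls_to_fps)
  moreover have "pole (germ Inf (Poly_Mapping.single 1 \<alpha>)) = 1" by (simp add: germ_single_1 pole_def)
  then have "pole (act (elem_matrix Fourier) (germ Inf (Poly_Mapping.single 1 \<alpha>))) = 1"
    using pole_act[OF Fourier_SL2 pole_germ_ge_1[OF e, of Inf]] by (simp only:)
  ultimately have "germ_equiv (act (elem_matrix Fourier) (germ Inf (Poly_Mapping.single 1 \<alpha>))) (germ (Fin \<alpha>) 0)"
    unfolding germ_equiv_def using h by (metis order_refl)
  then show ?thesis unfolding circle_rel_def using fourier_tame_inf e exp_factor_0 by blast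
next
  case (fourier_small_slope q \<alpha> q')
  define p where "p = Poly_Mapping.single 1 \<alpha> + q"
  have D: "exp_factor p" "ram p = ram q" "Dexp Inf p = fls_const \<alpha> + Dexp Inf q" "irr q < ram q"
    unfolding p_def by (rule Dexp_small_slope[OF \<open>exp_factor q\<close> \<open>0 < slope q\<close> \<open>slope q < 1\<close>])+
  have Dq: "fls_subdegree (Dexp Inf q) = int (ram q - irr q)"
    using \<open>exp_factor q\<close> \<open>0 < slope q\<close> \<open>slope q < 1\<close> by (intro Dexp_small_slope)
  have q0: "q \<noteq> 0" using \<open>0 < slope q\<close> by auto
  have "germ_equiv (act (elem_matrix Fourier) (germ Inf p)) (germ (Fin \<alpha>) q')"
  proof (rule legendre_germ_equiv)
    show "legendre Inf p (Fin \<alpha>) q'" using fourier_small_slope by (simp add: p_def)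
    fix \<rho> :: nat and g assume "1 \<le> \<rho>" and g: "subdegree g = 1" "Dexp Inf p \<diamondop> g = coord (Fin \<alpha>) \<rho>"
    then have "Dexp Inf q \<diamondop> g = fls_X_intpow (int \<rho>)"
      using subdegree_1D[OF g(1)] by (simp add: D fls_comp_simps coord_eq)
    then have "fls_subdegree (Dexp Inf q) = int \<rho>"
      using g by (metis fls_subdegree_comp fls_subdegree_fls_X_intpow mult.right_neutral of_nat_1 subdegree_1D(3))
    then show "coord_exp (Fin \<alpha>) \<rho> < pole (germ Inf p)"
      using pole_germ_Inf[of p] D Dq irr_pos[OF \<open>exp_factor q\<close> q0] by auto
  qed (auto simp: D)
  then show ?thesis unfolding circle_rel_def p_def[symmetric] using fourier_small_slope D legendre_exp_factor p_def by metis
qed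

lemma exists_complex_root:
  assumes "n \<ge> 1"
  shows "\<exists>\<omega>::complex. \<omega> ^ n = z"
proof (cases "z = 0")
  case False
  then have "card {\<omega>. \<omega> ^ n = z} = n" using card_nth_roots[of z n] assms by simp
  then have "{\<omega>. \<omega> ^ n = z} \<noteq> {}" using assms by (metis card.empty not_one_le_zero)
  then show ?thesis by blast
qed (use assms in \<open>auto intro!: exI[of _ 0] simp: power_0_left\<close>)

text \<open>The Fourier rules cover all cases: finite points with q zero or not, and at infinity
  slope above 1 or a linear term plus a remainder that is zero or of slope below 1.\<close>

lemma elem_circle_total:
  assumes "elem_matrix E \<in> SL2"
  shows "\<exists>\<phi> d. elem_circle E c \<phi> d"
proof -
  obtain a q where c: "c = circ a q" and q: "exp_factor q" by (rule circle_cases)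
  show ?thesis
  proof (cases E)
    case (Twist \<mu>)
    then show ?thesis unfolding c using q twist_inf twist_fin by (cases a) blast+
  next
    case (Scale \<mu>)
    then have m: "\<mu> \<noteq> 0" using assms unfolding Scale Scale_SL2_iff by simp
    obtain \<omega> \<omega>' :: complex where "\<omega> ^ ram q = \<mu>" "\<omega>' ^ ram q = inverse \<mu>"
      using exists_complex_root ram_pos by metis
    then show ?thesis unfolding c Scale using q m scale_inf scale_fin by (cases a) blast+
  next
    case Fourier
    show ?thesis
    proof (cases a)
      case (Fin x)
      show ?thesis
      proof (cases "q = 0")
        case True
        then show ?thesis unfolding c Fourier Fin using fourier_tame_fin by blast
      next
        case False
        have "fls_subdegree (Dexp (Fin x) q - fls_const (coord_base Inf)) = coord_exp Inf (ram q + irr q)"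
          using Dexp_subdegree[OF q False, of "Fin x"] by simp
        then obtain q' where "legendre (Fin x) q Inf q'"
          using legendre_exists[of "ram q + irr q" "Fin x" q Inf] ram_pos[of q] Dexp_subdegree(1)[OF q False] by auto
        then show ?thesis unfolding c Fourier Fin using fourier_fin q False by blast
      qed
    next
      case Inf
      show ?thesis
      proof (cases "1 < slope q")
        case True
        note D = Dexp_large_slope[OF q True]
        have 1: "1 \<le> irr q - ram q" "Dexp Inf q - fls_const (coord_base Inf) \<noteq> 0"
          "fls_subdegree (Dexp Inf q - fls_const (coord_base Inf)) = coord_exp Inf (irr q - ram q)"
          using D by simp_all
        obtain q' where "legendre Inf q Inf q'"
          using legendre_exists[OF 1] by blast
        then show ?thesis unfolding c Fourier Inf using fourier_large_slope q True by blast
      next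
        case False
        \<comment> \<open>Removing the coefficient of z leaves a remainder whose slope is at most
          that of q, hence at most 1, and not equal to 1.\<close>
        define \<alpha> where "\<alpha> = lookup q 1"
        define p where "p = q - Poly_Mapping.single 1 \<alpha>"
        have qp: "q = Poly_Mapping.single 1 \<alpha> + p" by (simp add: p_def)
        have p: "exp_factor p" unfolding p_def using q by (intro exp_factor_diff exp_factor_single) auto
        show ?thesis
        proof (cases "p = 0")
          case True
          then show ?thesis unfolding c Fourier Inf qp using fourier_tame_inf[of \<alpha>] by auto
        next
          case pn: False
          have "lookup p 1 = 0" by (simp add: p_def \<alpha>_def lookup_minus)
          then have s1: "slope p \<noteq> 1" using slope_max(1)[OF p pn] by (auto simp: in_keys_iff)
          have "lookup p (slope p) \<noteq> 0" using slope_max(1)[OF p pn] by (simp add: in_keys_iff)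
          then have "lookup q (slope p) \<noteq> 0" using s1 unfolding p_def by (simp add: lookup_minus lookup_single_not_eq)
          then have "slope p \<in> keys q" by (simp add: in_keys_iff)
          then have "slope p \<le> slope q" using slope_max(2)[OF q] by (cases "q = 0") auto
          then have s: "0 < slope p" "slope p < 1" using s1 False slope_max(3)[OF p pn] by auto
          note D = Dexp_small_slope[OF p s]
          have 0: "Dexp Inf (Poly_Mapping.single 1 \<alpha> + p) - fls_const (coord_base (Fin \<alpha>)) = Dexp Inf p"
            by (simp add: D)
          have 1: "1 \<le> ram p - irr p" "Dexp Inf (Poly_Mapping.single 1 \<alpha> + p) - fls_const (coord_base (Fin \<alpha>)) \<noteq> 0"
            "fls_subdegree (Dexp Inf (Poly_Mapping.single 1 \<alpha> + p) - fls_const (coord_base (Fin \<alpha>))) = coord_exp (Fin \<alpha>) (ram p - irr p)"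
            unfolding 0 using D by simp_all
          obtain q' where "legendre Inf (Poly_Mapping.single 1 \<alpha> + p) (Fin \<alpha>) q'"
            using legendre_exists[OF 1] by blast
          then show ?thesis unfolding c Fourier Inf qp using fourier_small_slope p s by blast
        qed
      qed
    qed
  qed
qed

section \<open>Invariance of the edge multiplicities\<close>

abbreviation roots_of_unity :: "nat \<Rightarrow> complex set" where
  "roots_of_unity n \<equiv> {\<omega>. \<omega> ^ n = 1}"

text \<open>Two monic polynomials of degree n with n common roots: their difference has degree below
  n and vanishes on Z. A general field is allowed because x will be a Laurent series.\<close>

lemma prod_diff_roots:
  fixes Z :: "'a::field set"
  assumes "card Z = n" "n \<ge> 1" "\<And>z. z \<in> Z \<Longrightarrow> z ^ n = 1"
  shows "(\<Prod>z\<in>Z. x - z) = x ^ n - 1"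
proof -
  have fin: "finite Z" using assms by (metis card.infinite not_one_le_zero)
  define p where "p = (\<Prod>z\<in>Z. [:- z, 1:])"
  define q where "q = Polynomial.monom (1::'a) n - 1"
  have dp: "Polynomial.degree p = n"
    unfolding p_def using fin assms(1) by (subst Polynomial.degree_prod_eq_sum_degree) auto
  have lp: "Polynomial.coeff p n = 1"
    using Polynomial.lead_coeff_prod[of "\<lambda>z. [:- z, 1:]" Z] dp by (simp add: p_def)
  have dq: "Polynomial.degree q \<le> n"
    unfolding q_def by (intro Polynomial.degree_diff_le) (auto simp: Polynomial.degree_monom_le)
  have lq: "Polynomial.coeff q n = 1" using assms(2) by (simp add: q_def)
  have "p - q = 0"
  proof (rule ccontr)
    assume nz: "p - q \<noteq> 0"
    have "Polynomial.degree (p - q) < n"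
    proof (rule ccontr)
      assume "\<not> Polynomial.degree (p - q) < n"
      moreover have "Polynomial.degree (p - q) \<le> n" using dp dq by (intro Polynomial.degree_diff_le) auto
      ultimately have "Polynomial.degree (p - q) = n" by simp
      moreover have "Polynomial.coeff (p - q) n = 0" using lp lq by simp
      ultimately have "Polynomial.lead_coeff (p - q) = 0" by (simp only:)
      then show False using nz by (simp only: Polynomial.leading_coeff_0_iff)
    qed
    moreover have "Z \<subseteq> {x. poly (p - q) x = 0}"
    proof
      fix z assume z: "z \<in> Z"
      then have "poly p z = 0" using fin by (auto simp: p_def poly_prod prod_zero_iff)
      moreover have "poly q z = 0" using assms(3)[OF z] by (simp add: q_def poly_monom)
      ultimately show "z \<in> {x. poly (p - q) x = 0}" by simp
    qed
    then have "card Z \<le> card {x. poly (p - q) x = 0}" using poly_roots_finite[OF nz] by (intro card_mono)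
    ultimately show False using card_poly_roots_bound[OF nz] assms(1) by simp
  qed
  then have "poly p x = poly q x" by simp
  then show ?thesis by (simp add: p_def q_def poly_prod poly_monom)
qed

lemma finite_roots_of_unity [simp]: "n \<ge> 1 \<Longrightarrow> finite (roots_of_unity n)"
  using finite_nth_roots[of n 1] by simp

lemma card_roots_of_unity: "n \<ge> 1 \<Longrightarrow> card (roots_of_unity n) = n"
  using card_nth_roots[of 1 n] by simp

lemma prod_roots_of_unity:
  fixes a b :: "complex fls"
  assumes "n \<ge> 1"
  shows "(\<Prod>\<omega>\<in>roots_of_unity n. a - fls_const \<omega> * b) = a ^ n - b ^ n"
proof (cases "b = 0")
  case False
  have inj: "inj_on fls_const (roots_of_unity n)"
    by (rule inj_onI) (metis fls_const_nth)
  have "(\<Prod>z\<in>fls_const ` roots_of_unity n. a / b - z) = (a / b) ^ n - 1"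
    using assms inj by (intro prod_diff_roots) (auto simp: card_image card_roots_of_unity simp flip: fls_const_power)
  then have "(\<Prod>\<omega>\<in>roots_of_unity n. a / b - fls_const \<omega>) = (a / b) ^ n - 1"
    using inj by (simp add: prod.reindex)
  then have "(\<Prod>\<omega>\<in>roots_of_unity n. b) * (\<Prod>\<omega>\<in>roots_of_unity n. a / b - fls_const \<omega>) = b ^ n * ((a / b) ^ n - 1)"
    using assms by (simp add: card_roots_of_unity)
  then have "(\<Prod>\<omega>\<in>roots_of_unity n. b * (a / b - fls_const \<omega>)) = b ^ n * ((a / b) ^ n - 1)"
    by (simp only: prod.distrib)
  moreover have "b * (a / b - fls_const \<omega>) = a - fls_const \<omega> * b" for \<omega>
    using False by (simp add: field_simps)
  moreover have "b ^ n * ((a / b) ^ n - 1) = a ^ n - b ^ n"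
    using False by (simp add: field_simps power_divide)
  ultimately show ?thesis by simp
qed (use assms in \<open>simp add: card_roots_of_unity\<close>)

lemma subdegree_prod_roots_of_unity:
  fixes a b :: "complex fps"
  assumes "n \<ge> 1" "a ^ n \<noteq> b ^ n"
  shows "subdegree (a ^ n - b ^ n) = (\<Sum>\<omega>\<in>roots_of_unity n. subdegree (a - fps_const \<omega> * b))"
    and "\<omega> \<in> roots_of_unity n \<Longrightarrow> a \<noteq> fps_const \<omega> * b"
proof -
  have P: "(\<Prod>\<omega>\<in>roots_of_unity n. fps_to_fls (a - fps_const \<omega> * b)) = fps_to_fls (a ^ n - b ^ n)"
    using prod_roots_of_unity[OF assms(1), of "fps_to_fls a" "fps_to_fls b"]
    by (simp add: fps_to_fls_power fls_times_fps_to_fls)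
  have nz: "fps_to_fls (a ^ n - b ^ n) \<noteq> 0" using assms(2) by simp
  show ne: "a \<noteq> fps_const \<omega> * b" if "\<omega> \<in> roots_of_unity n" for \<omega>
  proof
    assume "a = fps_const \<omega> * b"
    then have "fps_to_fls (a - fps_const \<omega> * b) = 0" by simp
    then have "(\<Prod>\<omega>\<in>roots_of_unity n. fps_to_fls (a - fps_const \<omega> * b)) = 0"
      using that assms(1) by (intro prod_zero) auto
    then show False using P nz by simp
  qed
  have "fls_subdegree (\<Prod>\<omega>\<in>roots_of_unity n. fps_to_fls (a - fps_const \<omega> * b)) =
      (\<Sum>\<omega>\<in>roots_of_unity n. fls_subdegree (fps_to_fls (a - fps_const \<omega> * b)))"
    using ne by (intro fls_subdegree_prod) auto
  then have "int (subdegree (a ^ n - b ^ n)) = (\<Sum>\<omega>\<in>roots_of_unity n. int (subdegree (a - fps_const \<omega> * b)))"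
    unfolding P by (simp only: fls_subdegree_fls_to_fps)
  then show "subdegree (a ^ n - b ^ n) = (\<Sum>\<omega>\<in>roots_of_unity n. subdegree (a - fps_const \<omega> * b))"
    by (simp only: of_nat_eq_iff flip: of_nat_sum)
qed

text \<open>On the curve \<open>x\<^sub>1 = x\<^sub>2\<close> the difference of the other coordinates is, up to a constant factor,
  the difference of any transversal coordinate \<open>\<alpha> x + \<beta> y\<close>.\<close>

lemma fls_subdegree_diff_on_fibre:
  fixes y1 y2 :: "complex fls" and H1 H2 t s :: "complex fps"
  assumes "\<beta> \<noteq> 0" "subdegree H1 = 1" "subdegree H2 = 1" "subdegree t \<noteq> 0" "subdegree s \<noteq> 0"
    and E1: "fls_const \<alpha> * fls_X_intpow (- int r1) + fls_const \<beta> * y1 = fls_X_intpow (- int m1) \<diamondop> H1"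
    and E2: "fls_const \<alpha> * fls_X_intpow (- int r2) + fls_const \<beta> * y2 = fls_X_intpow (- int m2) \<diamondop> H2"
    and ts: "t ^ r1 = s ^ r2" and ne: "y1 \<diamondop> t \<noteq> y2 \<diamondop> s"
  shows "(H2 oo s) ^ m2 \<noteq> (H1 oo t) ^ m1"
    and "fls_subdegree (y1 \<diamondop> t - y2 \<diamondop> s) =
      int (subdegree ((H2 oo s) ^ m2 - (H1 oo t) ^ m1)) - int m1 * int (subdegree t) - int m2 * int (subdegree s)"
proof -
  have X: "fls_X_intpow (- int n) \<diamondop> H = inverse (fps_to_fls (H ^ n))" if "subdegree H \<noteq> 0" for H n
    by (simp only: X_intpow_compose[OF subdegree_nonzeroD[OF that]] power_int_minus power_int_of_nat fps_to_fls_power)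
  define a where "a = H1 oo t"
  define b where "b = H2 oo s"
  have ab: "subdegree a = subdegree t" "subdegree b = subdegree s"
    using assms by (simp_all add: a_def b_def subdegree_comp)
  have "fls_X_intpow (- int m1) \<diamondop> H1 \<diamondop> t = fls_X_intpow (- int m1) \<diamondop> a"
    unfolding a_def by (rule fls_comp_assoc) (use assms in auto)
  also have "\<dots> = inverse (fps_to_fls (a ^ m1))" by (rule X) (use ab assms in auto)
  finally have Xa: "fls_X_intpow (- int m1) \<diamondop> H1 \<diamondop> t = inverse (fps_to_fls (a ^ m1))" .
  have "fls_X_intpow (- int m2) \<diamondop> H2 \<diamondop> s = fls_X_intpow (- int m2) \<diamondop> b"
    unfolding b_def by (rule fls_comp_assoc) (use assms in auto)
  also have "\<dots> = inverse (fps_to_fls (b ^ m2))" by (rule X) (use ab assms in auto)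
  finally have Xb: "fls_X_intpow (- int m2) \<diamondop> H2 \<diamondop> s = inverse (fps_to_fls (b ^ m2))" .
  have e1: "fls_const \<alpha> * inverse (fps_to_fls (t ^ r1)) + fls_const \<beta> * (y1 \<diamondop> t) = inverse (fps_to_fls (a ^ m1))"
    using arg_cong[OF E1, of "\<lambda>f. f \<diamondop> t"]
    by (simp only: fls_comp_simps[OF assms(4) assms(4)] fls_compose_fps_const X[OF assms(4)] Xa)
  have e2: "fls_const \<alpha> * inverse (fps_to_fls (s ^ r2)) + fls_const \<beta> * (y2 \<diamondop> s) = inverse (fps_to_fls (b ^ m2))"
    using arg_cong[OF E2, of "\<lambda>f. f \<diamondop> s"]
    by (simp only: fls_comp_simps[OF assms(5) assms(5)] fls_compose_fps_const X[OF assms(5)] Xb)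
  \<comment> \<open>The \<alpha> terms cancel because t^r1 = s^r2. What remains is 1/P - 1/Q = (Q -
    P)/(PQ), where P and Q have orders m1 ord(t) and m2 ord(s): the two correction terms.\<close>
  have d: "fls_const \<beta> * (y1 \<diamondop> t - y2 \<diamondop> s) = inverse (fps_to_fls (a ^ m1)) - inverse (fps_to_fls (b ^ m2))"
    unfolding e1[symmetric] e2[symmetric] ts by (simp add: right_diff_distrib)
  have nz: "fps_to_fls (a ^ m1) \<noteq> 0" "fps_to_fls (b ^ m2) \<noteq> 0"
    using ab assms(4,5) by auto
  have "P * Q * (inverse P - inverse Q) = Q - P" if "P \<noteq> 0" "Q \<noteq> 0" for P Q :: "complex fls"
    using that by (simp add: field_simps)
  from this[OF nz]
  have "fps_to_fls (a ^ m1) * fps_to_fls (b ^ m2) * (fls_const \<beta> * (y1 \<diamondop> t - y2 \<diamondop> s)) = fps_to_fls (b ^ m2 - a ^ m1)"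
    unfolding d fps_to_fls_minus .
  then have e: "fls_const \<beta> * (fps_to_fls (a ^ m1) * fps_to_fls (b ^ m2) * (y1 \<diamondop> t - y2 \<diamondop> s)) = fps_to_fls (b ^ m2 - a ^ m1)"
    by (simp only: mult_ac)
  have "fls_const \<beta> * (fps_to_fls (a ^ m1) * fps_to_fls (b ^ m2) * (y1 \<diamondop> t - y2 \<diamondop> s)) \<noteq> 0"
    using assms(1) nz ne by simp
  then show n: "(H2 oo s) ^ m2 \<noteq> (H1 oo t) ^ m1" unfolding e by (auto simp: a_def b_def)
  have "fls_subdegree (fls_const \<beta> * (fps_to_fls (a ^ m1) * fps_to_fls (b ^ m2) * (y1 \<diamondop> t - y2 \<diamondop> s))) =
    int m1 * int (subdegree t) + int m2 * int (subdegree s) + fls_subdegree (y1 \<diamondop> t - y2 \<diamondop> s)"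
    using assms(1) nz ne by (simp add: fls_subdegree_fls_to_fps subdegree_power ab)
  from this[unfolded e fls_subdegree_fls_to_fps]
  show "fls_subdegree (y1 \<diamondop> t - y2 \<diamondop> s) =
      int (subdegree ((H2 oo s) ^ m2 - (H1 oo t) ^ m1)) - int m1 * int (subdegree t) - int m2 * int (subdegree s)"
    unfolding a_def b_def by linarith
qed

section \<open>Intersection numbers counted along branches\<close>

lemma fps_linear_comp: "(fps_const \<omega> * a) oo b = fps_const \<omega> * (a oo b)" if "fps_nth b 0 = (0::complex)"
  using that by (simp add: fps_compose_mult_distrib)

lemma fps_X_power_comp: "(fps_X ^ n) oo b = b ^ n" if "fps_nth b 0 = (0::complex)"
  using that fps_compose_power[OF that, of fps_X n] by simp

lemma subdegree_monomial: "\<omega> \<noteq> 0 \<Longrightarrow> subdegree (fps_const (\<omega>::complex) * fps_X ^ n) = n"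
  by (simp add: subdegree_mult)

text \<open>Both sides count the intersections of the curves \<open>x\<^sub>1 = x\<^sub>2\<close> and \<open>x'\<^sub>1 = x'\<^sub>2\<close>.\<close>

lemma intersection_symmetric:
  fixes y1 y2 Y1 Y2 :: "complex fls" and H1 H2 :: "complex fps"
  assumes "\<beta> \<noteq> 0" "subdegree H1 = 1" "subdegree H2 = 1" "r1 \<ge> 1" "r2 \<ge> 1" "m1 \<ge> 1" "m2 \<ge> 1"
    and E1: "fls_const \<alpha> * fls_X_intpow (- int r1) + fls_const \<beta> * y1 = fls_X_intpow (- int m1) \<diamondop> H1"
    and E2: "fls_const \<alpha> * fls_X_intpow (- int r2) + fls_const \<beta> * y2 = fls_X_intpow (- int m2) \<diamondop> H2"
    and E1': "fls_const \<delta> * fls_X_intpow (- int m1) - fls_const \<beta> * Y1 = fls_X_intpow (- int r1) \<diamondop> fps_inv H1"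
    and E2': "fls_const \<delta> * fls_X_intpow (- int m2) - fls_const \<beta> * Y2 = fls_X_intpow (- int r2) \<diamondop> fps_inv H2"
    and ne: "\<And>\<zeta>. \<zeta> \<in> roots_of_unity r2 \<Longrightarrow> y1 \<diamondop> (fps_X ^ r2) \<noteq> y2 \<diamondop> (fps_const \<zeta> * fps_X ^ r1)"
    and ne': "\<And>\<zeta>. \<zeta> \<in> roots_of_unity m2 \<Longrightarrow> Y1 \<diamondop> (fps_X ^ m2) \<noteq> Y2 \<diamondop> (fps_const \<zeta> * fps_X ^ m1)"
  shows "int m2 * (\<Sum>\<zeta>\<in>roots_of_unity r2. fls_subdegree (y1 \<diamondop> (fps_X ^ r2) - y2 \<diamondop> (fps_const \<zeta> * fps_X ^ r1))) =
    int r2 * (\<Sum>\<zeta>\<in>roots_of_unity m2. fls_subdegree (Y1 \<diamondop> (fps_X ^ m2) - Y2 \<diamondop> (fps_const \<zeta> * fps_X ^ m1)))"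
proof -
  \<comment> \<open>One auxiliary variable X uniformises both curves: the factor r2 makes t^(r1/r2)
    a power series in X, and the factor m2 does the same for the m2-th root of H1(t).\<close>
  define t :: "complex fps" where "t = fps_X ^ (r2 * m2)"
  define f where "f = (\<lambda>\<zeta>. fps_const \<zeta> * fps_X ^ (r1 * m2) :: complex fps)"
  note i1 = fps_inv_subdegree[OF assms(2)] and i2 = fps_inv_subdegree[OF assms(3)]
  have st: "subdegree t = r2 * m2" "subdegree t \<noteq> 0" using assms by (simp_all add: t_def)
  have Ht: "subdegree (H1 oo t) = r2 * m2" using assms st by (simp add: subdegree_comp)
  define v where "v = fps_shift (r2 * m2) (H1 oo t)"
  have Hv: "H1 oo t = v * fps_X ^ (r2 * m2)" unfolding v_def by (metis Ht subdegree_decompose)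
  have "fps_nth v 0 \<noteq> 0"
    unfolding v_def using Ht st by (metis add_0 fps_shift_nth nth_subdegree_zero_iff subdegree_0)
  then obtain w where w: "w ^ m2 = v" "fps_nth w 0 \<noteq> 0" using fps_nth_power_root[of m2 v] assms by auto
  define h where "h = w * fps_X ^ r2"
  have hm: "h ^ m2 = H1 oo t" by (simp add: h_def power_mult_distrib w Hv power_mult)
  have sh: "subdegree h = r2" "subdegree h \<noteq> 0"
  proof -
    have "w \<noteq> 0" using w by auto
    then show "subdegree h = r2" using w by (simp add: h_def subdegree_mult subdegree_eq_0_iff)
    then show "subdegree h \<noteq> 0" using assms by simp
  qed
  \<comment> \<open>Over t the values of s on the curve t^r1 = s^r2 are \<open>f \<zeta>\<close>,
    and those on the curve H1(t)^m1 = H2(s)^m2 are \<open>g \<xi>\<close>, where h^m2 = H1(t). Both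
    sides of the claim are evaluated through the double sum of the orders of
    \<open>f \<zeta> - g \<xi>\<close>.\<close>
  define g where "g = (\<lambda>\<zeta>. fps_inv H2 oo (fps_const \<zeta> * h ^ m1))"
  have nz: "\<zeta> \<noteq> 0" if "\<zeta> \<in> roots_of_unity n" "n \<ge> 1" for \<zeta> n using that by (auto simp: power_0_left)
  have sf: "subdegree (f \<zeta>) = r1 * m2" if "\<zeta> \<in> roots_of_unity r2" for \<zeta>
    using nz[OF that] assms unfolding f_def by (intro subdegree_monomial) auto
  have sf0: "subdegree (f \<zeta>) \<noteq> 0" if "\<zeta> \<in> roots_of_unity r2" for \<zeta>
    using sf[OF that] assms by simp
  have szh: "subdegree (fps_const \<zeta> * h ^ m1) = r2 * m1" if "\<zeta> \<in> roots_of_unity m2" for \<zeta>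
  proof -
    have "h \<noteq> 0" using subdegree_nonzeroD[OF sh(2)] by simp
    then have "subdegree (fps_const \<zeta> * h ^ m1) = subdegree (h ^ m1)"
      using nz[OF that assms(7)] by (subst subdegree_mult) auto
    then show ?thesis by (simp add: subdegree_power sh(1))
  qed
  have szh0: "subdegree (fps_const \<zeta> * h ^ m1) \<noteq> 0" if "\<zeta> \<in> roots_of_unity m2" for \<zeta>
    using szh[OF that] assms by simp
  have z1: "fps_nth (fps_X ^ n) 0 = (0::complex)" if "n \<ge> 1" for n using that by (simp add: power_0_left)

  \<comment> \<open>For a fixed branch of the first curve, the product over \<xi> is the equation of
    the second curve restricted to it, since H2 preserves contact orders and the roots of unity
    multiply up to a difference of m2-th powers.\<close>
  have A: "(\<Sum>\<xi>\<in>roots_of_unity m2. int (subdegree (f \<zeta> - g \<xi>))) =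
      int m2 * fls_subdegree (y1 \<diamondop> (fps_X ^ r2) - y2 \<diamondop> (fps_const \<zeta> * fps_X ^ r1))
      + int m1 * int (r2 * m2) + int m2 * int (r1 * m2)"
    if z: "\<zeta> \<in> roots_of_unity r2" for \<zeta>
  proof -
    have tX: "t = fps_X ^ r2 oo fps_X ^ m2" "f \<zeta> = (fps_const \<zeta> * fps_X ^ r1) oo fps_X ^ m2"
      by (simp_all only: t_def f_def fps_linear_comp[OF z1[OF assms(7)]] fps_X_power_comp[OF z1[OF assms(7)]]
          mult.commute[of _ m2] power_mult)
    have s: "subdegree (fps_X ^ r2 :: complex fps) \<noteq> 0" "subdegree (fps_X ^ m2 :: complex fps) \<noteq> 0"
      "subdegree (fps_const \<zeta> * fps_X ^ r1) \<noteq> 0"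
      using assms(4,5,7) subdegree_monomial[OF nz[OF z assms(5)], of r1] by simp_all
    have eq: "y1 \<diamondop> t - y2 \<diamondop> f \<zeta> = (y1 \<diamondop> (fps_X ^ r2) - y2 \<diamondop> (fps_const \<zeta> * fps_X ^ r1)) \<diamondop> (fps_X ^ m2)"
      unfolding tX using s by (simp add: fls_comp_assoc fls_comp_simps)
    have ne1: "y1 \<diamondop> t \<noteq> y2 \<diamondop> f \<zeta>"
    proof -
      have "y1 \<diamondop> t - y2 \<diamondop> f \<zeta> \<noteq> 0" unfolding eq using ne[OF z] s by (simp add: fls_comp_eq_0_iff)
      then show ?thesis by simp
    qed
    have ts: "t ^ r1 = f \<zeta> ^ r2"
      using z by (simp add: t_def f_def power_mult_distrib mult_ac flip: power_mult)
    note F = fls_subdegree_diff_on_fibre[OF assms(1-3) st(2) sf0[OF z] E1 E2 ts ne1]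
    have "(H1 oo t) ^ m1 = (h ^ m1) ^ m2" by (simp add: mult.commute flip: hm power_mult)
    then have F': "(H2 oo f \<zeta>) ^ m2 \<noteq> (h ^ m1) ^ m2"
      "fls_subdegree (y1 \<diamondop> t - y2 \<diamondop> f \<zeta>) =
        int (subdegree ((H2 oo f \<zeta>) ^ m2 - (h ^ m1) ^ m2)) - int m1 * int (r2 * m2) - int m2 * int (r1 * m2)"
      using F sf[OF z] st by simp_all
    have "subdegree (f \<zeta> - g \<xi>) = subdegree ((H2 oo f \<zeta>) - fps_const \<xi> * h ^ m1)" if x: "\<xi> \<in> roots_of_unity m2" for \<xi>
    proof -
      have "f \<zeta> = fps_inv H2 oo (H2 oo f \<zeta>)"
        using i2 subdegree_1D[OF assms(3)] subdegree_nonzeroD[OF sf0[OF z]] by (simp add: fps_compose_assoc)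
      then have "f \<zeta> - g \<xi> = (fps_inv H2 oo (H2 oo f \<zeta>)) - (fps_inv H2 oo (fps_const \<xi> * h ^ m1))"
        by (simp add: g_def)
      also have "subdegree \<dots> = subdegree ((H2 oo f \<zeta>) - fps_const \<xi> * h ^ m1)"
        using i2 subdegree_1D[OF assms(3)] subdegree_nonzeroD[OF szh0[OF x]] by (intro subdegree_compose_diff) auto
      finally show ?thesis .
    qed
    then have "(\<Sum>\<xi>\<in>roots_of_unity m2. int (subdegree (f \<zeta> - g \<xi>))) = int (subdegree ((H2 oo f \<zeta>) ^ m2 - (h ^ m1) ^ m2))"
      using subdegree_prod_roots_of_unity(1)[OF assms(7) F'(1)] by simp
    also have "\<dots> = fls_subdegree (y1 \<diamondop> t - y2 \<diamondop> f \<zeta>) + int m1 * int (r2 * m2) + int m2 * int (r1 * m2)"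
      using F'(2) by simp
    also have "fls_subdegree (y1 \<diamondop> t - y2 \<diamondop> f \<zeta>) =
        int m2 * fls_subdegree (y1 \<diamondop> (fps_X ^ r2) - y2 \<diamondop> (fps_const \<zeta> * fps_X ^ r1))"
      unfolding eq using s by (simp add: fls_subdegree_comp)
    finally show ?thesis .
  qed

  \<comment> \<open>The same with the roles exchanged: the equation of the first curve restricted to
    a branch of the second, on which the inverse transformation expresses the old coordinate through
    the new one with -\<beta> in place of \<beta>.\<close>
  have B: "(\<Sum>\<zeta>\<in>roots_of_unity r2. int (subdegree (f \<zeta> - g \<xi>))) =
      int r2 * fls_subdegree (Y1 \<diamondop> (fps_X ^ m2) - Y2 \<diamondop> (fps_const \<xi> * fps_X ^ m1))
      + int r1 * int (r2 * m2) + int r2 * int (r2 * m1)"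
    if z: "\<xi> \<in> roots_of_unity m2" for \<xi>
  proof -
    define T where "T = h ^ m2"
    define U where "U = fps_const \<xi> * h ^ m1"
    have h0: "fps_nth h 0 = 0" using subdegree_nonzeroD[OF sh(2)] by simp
    have tX: "T = fps_X ^ m2 oo h" "U = (fps_const \<xi> * fps_X ^ m1) oo h"
      using h0 by (simp_all add: T_def U_def fps_X_power_comp fps_linear_comp)
    have s: "subdegree (fps_X ^ m2 :: complex fps) \<noteq> 0" "subdegree (fps_const \<xi> * fps_X ^ m1) \<noteq> 0"
      using assms(6,7) subdegree_monomial[OF nz[OF z assms(7)], of m1] by simp_all
    have eq: "Y1 \<diamondop> T - Y2 \<diamondop> U = (Y1 \<diamondop> (fps_X ^ m2) - Y2 \<diamondop> (fps_const \<xi> * fps_X ^ m1)) \<diamondop> h"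
      unfolding tX using s sh(2) by (simp add: fls_comp_assoc fls_comp_simps)
    have ne1: "Y1 \<diamondop> T \<noteq> Y2 \<diamondop> U"
    proof -
      have "Y1 \<diamondop> T - Y2 \<diamondop> U \<noteq> 0" unfolding eq using ne'[OF z] sh by (simp add: fls_comp_eq_0_iff)
      then show ?thesis by simp
    qed
    have TU: "T ^ m1 = U ^ m2"
      using z by (simp add: T_def U_def power_mult_distrib mult_ac flip: power_mult)
    have sT: "subdegree T = r2 * m2" "subdegree T \<noteq> 0" using Ht st by (simp_all add: T_def hm)
    have sU: "subdegree U = r2 * m1" "subdegree U \<noteq> 0" using szh[OF z] szh0[OF z] by (simp_all add: U_def)
    have E: "fls_const \<delta> * fls_X_intpow (- int m1) + fls_const (- \<beta>) * Y1 = fls_X_intpow (- int r1) \<diamondop> fps_inv H1"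
      "fls_const \<delta> * fls_X_intpow (- int m2) + fls_const (- \<beta>) * Y2 = fls_X_intpow (- int r2) \<diamondop> fps_inv H2"
      using E1' E2' by simp_all
    have b: "- \<beta> \<noteq> 0" using assms(1) by simp
    note F = fls_subdegree_diff_on_fibre[OF b i1(1) i2(1) sT(2) sU(2) E TU ne1]
    have "fps_inv H1 oo T = t"
      using i1 subdegree_1D[OF assms(2)] subdegree_nonzeroD[OF st(2)] by (simp add: T_def hm fps_compose_assoc)
    moreover have "t ^ r1 = (fps_X ^ (r1 * m2)) ^ r2" by (simp add: t_def mult_ac flip: power_mult)
    ultimately have F': "g \<xi> ^ r2 \<noteq> (fps_X ^ (r1 * m2)) ^ r2"
      "fls_subdegree (Y1 \<diamondop> T - Y2 \<diamondop> U) =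
        int (subdegree (g \<xi> ^ r2 - (fps_X ^ (r1 * m2)) ^ r2)) - int r1 * int (r2 * m2) - int r2 * int (r2 * m1)"
      using F sT sU by (simp_all add: g_def U_def)
    have "subdegree (f \<zeta> - g \<xi>) = subdegree (g \<xi> - fps_const \<zeta> * fps_X ^ (r1 * m2))" for \<zeta>
      unfolding f_def by (metis minus_diff_eq subdegree_uminus)
    then have "(\<Sum>\<zeta>\<in>roots_of_unity r2. int (subdegree (f \<zeta> - g \<xi>))) = int (subdegree (g \<xi> ^ r2 - (fps_X ^ (r1 * m2)) ^ r2))"
      using subdegree_prod_roots_of_unity(1)[OF assms(5) F'(1)] by simp
    also have "\<dots> = fls_subdegree (Y1 \<diamondop> T - Y2 \<diamondop> U) + int r1 * int (r2 * m2) + int r2 * int (r2 * m1)"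
      using F'(2) by simp
    also have "fls_subdegree (Y1 \<diamondop> T - Y2 \<diamondop> U) =
        int r2 * fls_subdegree (Y1 \<diamondop> (fps_X ^ m2) - Y2 \<diamondop> (fps_const \<xi> * fps_X ^ m1))"
      unfolding eq using sh by (simp add: fls_subdegree_comp)
    finally show ?thesis .
  qed

  have "(\<Sum>\<zeta>\<in>roots_of_unity r2. \<Sum>\<xi>\<in>roots_of_unity m2. int (subdegree (f \<zeta> - g \<xi>))) =
     (\<Sum>\<xi>\<in>roots_of_unity m2. \<Sum>\<zeta>\<in>roots_of_unity r2. int (subdegree (f \<zeta> - g \<xi>)))"
    by (rule sum.swap)
  \<comment> \<open>The corrections on both sides are r1 r2 m2^2 + m1 m2 r2^2 and cancel.\<close>
  then have "int m2 * (\<Sum>\<zeta>\<in>roots_of_unity r2. fls_subdegree (y1 \<diamondop> (fps_X ^ r2) - y2 \<diamondop> (fps_const \<zeta> * fps_X ^ r1)))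
       + int r2 * (int m1 * int (r2 * m2) + int m2 * int (r1 * m2)) =
     int r2 * (\<Sum>\<zeta>\<in>roots_of_unity m2. fls_subdegree (Y1 \<diamondop> (fps_X ^ m2) - Y2 \<diamondop> (fps_const \<zeta> * fps_X ^ m1)))
       + int m2 * (int r1 * int (r2 * m2) + int r2 * int (r2 * m1))"
    using assms by (simp add: A B sum.distrib card_roots_of_unity distrib_left add.assoc flip: sum_distrib_left)
  then show ?thesis by (simp add: algebra_simps)
qed

text \<open>Both curves contain the diagonal t = s, so the branches for \<zeta> = 1 and \<xi> = 1
  are left out. Every other branch meets the diagonal with multiplicity 1, which lowers the
  corrections 2m and 2r to 2m - 1 and 2r - 1. No auxiliary variable is needed: the branches \<zeta>
  t and H^(-1)(\<xi> H(t)) are power series in t already.\<close>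

lemma self_intersection_symmetric:
  fixes y Y :: "complex fls" and H :: "complex fps"
  assumes "\<beta> \<noteq> 0" "subdegree H = 1" "r \<ge> 1" "m \<ge> 1"
    and E: "fls_const \<alpha> * fls_X_intpow (- int r) + fls_const \<beta> * y = fls_X_intpow (- int m) \<diamondop> H"
    and E': "fls_const \<delta> * fls_X_intpow (- int m) - fls_const \<beta> * Y = fls_X_intpow (- int r) \<diamondop> fps_inv H"
    and ne: "\<And>\<zeta>. \<zeta> \<in> roots_of_unity r - {1} \<Longrightarrow> y \<noteq> y \<diamondop> (fps_const \<zeta> * fps_X)"
    and ne': "\<And>\<zeta>. \<zeta> \<in> roots_of_unity m - {1} \<Longrightarrow> Y \<noteq> Y \<diamondop> (fps_const \<zeta> * fps_X)"
  shows "(\<Sum>\<zeta>\<in>roots_of_unity r - {1}. fls_subdegree (y - y \<diamondop> (fps_const \<zeta> * fps_X))) + (int r - 1) * (2 * int m - 1) =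
    (\<Sum>\<zeta>\<in>roots_of_unity m - {1}. fls_subdegree (Y - Y \<diamondop> (fps_const \<zeta> * fps_X))) + (int m - 1) * (2 * int r - 1)"
proof -
  note i = fps_inv_subdegree[OF assms(2)]
  define f where "f = (\<lambda>\<zeta>. fps_const \<zeta> * fps_X :: complex fps)"
  define g where "g = (\<lambda>\<zeta>. fps_inv H oo (fps_const \<zeta> * H))"
  have nz: "\<zeta> \<noteq> 0" if "\<zeta> \<in> roots_of_unity n - {1}" "n \<ge> 1" for \<zeta> n using that by (auto simp: power_0_left)
  note H = subdegree_1D[OF assms(2)]

  have A: "(\<Sum>\<xi>\<in>roots_of_unity m - {1}. int (subdegree (f \<zeta> - g \<xi>))) =
      fls_subdegree (y - y \<diamondop> (fps_const \<zeta> * fps_X)) + (2 * int m - 1)"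
    if z: "\<zeta> \<in> roots_of_unity r - {1}" for \<zeta>
  proof -
    note z0 = nz[OF z assms(3)]
    have sf: "subdegree (f \<zeta>) = 1" unfolding f_def using subdegree_linear[OF z0] .
    have sX: "subdegree (fps_X :: complex fps) \<noteq> 0" "subdegree (f \<zeta>) \<noteq> 0" using sf by simp_all
    have ts: "fps_X ^ r = f \<zeta> ^ r" using z by (simp add: f_def power_mult_distrib)
    have ne1: "y \<diamondop> fps_X \<noteq> y \<diamondop> f \<zeta>" using ne[OF z] by (simp add: f_def)
    note F = fls_subdegree_diff_on_fibre[OF assms(1,2,2) sX E E ts ne1]
    have F': "(H oo f \<zeta>) ^ m \<noteq> H ^ m"
      "fls_subdegree (y - y \<diamondop> f \<zeta>) = int (subdegree ((H oo f \<zeta>) ^ m - H ^ m)) - 2 * int m"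
      using F sf by simp_all
    have f: "f \<zeta> = fps_inv H oo (H oo f \<zeta>)"
      using i H subdegree_1D[OF sf] by (simp add: fps_compose_assoc)
    have d: "subdegree (f \<zeta> - g \<xi>) = subdegree ((H oo f \<zeta>) - fps_const \<xi> * H)" for \<xi>
    proof -
      have "f \<zeta> - g \<xi> = (fps_inv H oo (H oo f \<zeta>)) - (fps_inv H oo (fps_const \<xi> * H))"
        unfolding g_def using f by simp
      also have "subdegree \<dots> = subdegree ((H oo f \<zeta>) - fps_const \<xi> * H)"
        using i H by (intro subdegree_compose_diff) auto
      finally show ?thesis .
    qed
    have "f \<zeta> - g 1 = fps_const (\<zeta> - 1) * fps_X"
      using i by (simp add: f_def g_def left_diff_distrib flip: fps_const_sub)
    then have g1: "subdegree (f \<zeta> - g 1) = 1" using z subdegree_linear[of "\<zeta> - 1"] by simp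
    have "(\<Sum>\<xi>\<in>roots_of_unity m. int (subdegree (f \<zeta> - g \<xi>))) = int (subdegree ((H oo f \<zeta>) ^ m - H ^ m))"
      unfolding d using subdegree_prod_roots_of_unity(1)[OF assms(4) F'(1)] by simp
    moreover have "(\<Sum>\<xi>\<in>roots_of_unity m. int (subdegree (f \<zeta> - g \<xi>))) =
       int (subdegree (f \<zeta> - g 1)) + (\<Sum>\<xi>\<in>roots_of_unity m - {1}. int (subdegree (f \<zeta> - g \<xi>)))"
      using assms(4) by (intro sum.remove) auto
    ultimately show ?thesis using F'(2) g1 by (simp add: f_def)
  qed

  have B: "(\<Sum>\<zeta>\<in>roots_of_unity r - {1}. int (subdegree (f \<zeta> - g \<xi>))) =
      fls_subdegree (Y - Y \<diamondop> (fps_const \<xi> * fps_X)) + (2 * int r - 1)"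
    if z: "\<xi> \<in> roots_of_unity m - {1}" for \<xi>
  proof -
    note z0 = nz[OF z assms(4)]
    define U where "U = fps_const \<xi> * H"
    have U: "U = (fps_const \<xi> * fps_X) oo H" using H by (simp add: U_def fps_linear_comp)
    have s: "subdegree (fps_const \<xi> * fps_X) = 1" using subdegree_linear[OF z0] .
    have sU: "subdegree U = 1" using s assms(2) by (simp add: U subdegree_comp)
    have eq: "Y \<diamondop> H - Y \<diamondop> U = (Y - Y \<diamondop> (fps_const \<xi> * fps_X)) \<diamondop> H"
      unfolding U using s H by (simp add: fls_comp_assoc fls_comp_simps)
    have ne1: "Y \<diamondop> H \<noteq> Y \<diamondop> U"
    proof -
      have "Y \<diamondop> H - Y \<diamondop> U \<noteq> 0" unfolding eq using ne'[OF z] H by (simp add: fls_comp_eq_0_iff)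
      then show ?thesis by simp
    qed
    have TU: "H ^ m = U ^ m" using z by (simp add: U_def power_mult_distrib)
    have sU0: "subdegree U \<noteq> 0" using sU by simp
    have E2: "fls_const \<delta> * fls_X_intpow (- int m) + fls_const (- \<beta>) * Y = fls_X_intpow (- int r) \<diamondop> fps_inv H"
      using E' by simp
    have b: "- \<beta> \<noteq> 0" using assms(1) by simp
    note F = fls_subdegree_diff_on_fibre[OF b i(1) i(1) H(3) sU0 E2 E2 TU ne1]
    have F': "g \<xi> ^ r \<noteq> fps_X ^ r"
      "fls_subdegree (Y \<diamondop> H - Y \<diamondop> U) = int (subdegree (g \<xi> ^ r - fps_X ^ r)) - 2 * int r"
      using F sU assms(2) i by (simp_all add: g_def U_def)
    have d: "subdegree (f \<zeta> - g \<xi>) = subdegree (g \<xi> - fps_const \<zeta> * fps_X)" for \<zeta>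
      unfolding f_def by (metis minus_diff_eq subdegree_uminus)
    have g1: "subdegree (f 1 - g \<xi>) = 1"
    proof -
      have "f 1 - g \<xi> = (fps_inv H oo H) - (fps_inv H oo U)" using i by (simp add: f_def g_def U_def)
      also have "subdegree \<dots> = subdegree (H - U)"
        using i H subdegree_1D[OF sU] by (intro subdegree_compose_diff) auto
      also have "H - U = fps_const (1 - \<xi>) * H" by (simp add: U_def left_diff_distrib flip: fps_const_sub)
      also have "subdegree \<dots> = 1" using z H assms(2) by (subst subdegree_mult) auto
      finally show ?thesis .
    qed
    have "(\<Sum>\<zeta>\<in>roots_of_unity r. int (subdegree (f \<zeta> - g \<xi>))) = int (subdegree (g \<xi> ^ r - fps_X ^ r))"
      unfolding d using subdegree_prod_roots_of_unity(1)[OF assms(3) F'(1)] by simp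
    moreover have "(\<Sum>\<zeta>\<in>roots_of_unity r. int (subdegree (f \<zeta> - g \<xi>))) =
       int (subdegree (f 1 - g \<xi>)) + (\<Sum>\<zeta>\<in>roots_of_unity r - {1}. int (subdegree (f \<zeta> - g \<xi>)))"
      using assms(3) by (intro sum.remove) auto
    moreover have "fls_subdegree (Y \<diamondop> H - Y \<diamondop> U) = fls_subdegree (Y - Y \<diamondop> (fps_const \<xi> * fps_X))"
      unfolding eq using H assms(2) by (simp add: fls_subdegree_comp)
    ultimately show ?thesis using F'(2) g1 by simp
  qed

  have c: "int (card (roots_of_unity n - {1})) = int n - 1" if "n \<ge> 1" for n
    using that by (subst card_Diff_singleton) (auto simp: card_roots_of_unity)
  have "(\<Sum>\<zeta>\<in>roots_of_unity r - {1}. \<Sum>\<xi>\<in>roots_of_unity m - {1}. int (subdegree (f \<zeta> - g \<xi>))) =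
     (\<Sum>\<xi>\<in>roots_of_unity m - {1}. \<Sum>\<zeta>\<in>roots_of_unity r - {1}. int (subdegree (f \<zeta> - g \<xi>)))"
    by (rule sum.swap)
  then show ?thesis
    by (simp only: A B sum.distrib sum_constant c[OF assms(3)] c[OF assms(4)] cong: sum.cong)
qed

section \<open>From slopes of differences to contact orders\<close>

lemma subdegree_polar_diff:
  assumes "exp_factor p" "exp_factor q" "p \<noteq> q" "1 \<le> N" "polar Inf N p y" "polar Inf N q y'"
    "\<And>k. k \<in> keys p \<Longrightarrow> k * of_nat N \<in> \<int>" "\<And>k. k \<in> keys q \<Longrightarrow> k * of_nat N \<in> \<int>"
  shows "y \<noteq> y'" "of_int (fls_subdegree (y - y')) = of_nat N * (1 - slope (p - q))"
proof -
  define d where "d = p - q"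
  have d: "exp_factor d" "d \<noteq> 0" using assms by (simp_all add: d_def exp_factor_diff)
  note S = slope_max[OF d]
  have N: "(of_nat N :: rat) > 0" using assms(4) by simp
  have P: "of_nat N * (y - y') $$ j = of_int (int N - j) * lookup d (of_int (int N - j) / of_nat N)"
    if "j < int N" for j
  proof -
    have "- of_nat N * y $$ j = of_int (j - int N) * lookup p (of_int (int N - j) / of_nat N)"
      "- of_nat N * y' $$ j = of_int (j - int N) * lookup q (of_int (int N - j) / of_nat N)"
      using assms(5,6) that by (auto simp: polar_def)
    then show ?thesis by (simp add: d_def lookup_minus algebra_simps)
  qed
  have "slope d \<in> keys p \<or> slope d \<in> keys q" using S(1) keys_diff[of p q] by (auto simp: d_def)
  then obtain n where n: "slope d * of_nat N = of_int n" using assms(7,8) by (meson Ints_cases)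
  have "0 < slope d * of_nat N" using S(3) N by simp
  then have n0: "n > 0" using n by simp
  have sn: "of_int n / of_nat N = slope d" using n N by (simp add: field_simps)
  have "of_nat N * (y - y') $$ (int N - n) = of_int n * lookup d (slope d)"
    using P[of "int N - n"] n0 sn by simp
  also have "\<dots> \<noteq> 0" using n0 S(1) by (simp add: in_keys_iff)
  finally have 1: "(y - y') $$ (int N - n) \<noteq> 0" by auto
  then show "y \<noteq> y'" by auto
  have "(y - y') $$ j = 0" if j: "j < int N - n" for j
  proof -
    have "(of_int n :: rat) < of_int (int N - j)" using j by (simp only: of_int_less_iff)
    then have "slope d < of_int (int N - j) / of_nat N" unfolding sn[symmetric] using N by (rule divide_strict_right_mono)
    then have "of_int (int N - j) / of_nat N \<notin> keys d" using S(2) by force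
    then have "lookup d (of_int (int N - j) / of_nat N) = 0" by (simp add: in_keys_iff)
    then have "of_nat N * (y - y') $$ j = 0" using P[of j] j n0 by simp
    then show ?thesis using assms(4) by simp
  qed
  \<comment> \<open>The leading term comes from the derivative of p - q, of order z^(slope-1), and z
    = t^(-N).\<close>
  then have "fls_subdegree (y - y') = int N - n" using 1 by (intro fls_subdegree_eqI)
  then show "of_int (fls_subdegree (y - y')) = of_nat N * (1 - slope (p - q))"
    using n by (simp add: d_def algebra_simps)
qed

lemma polar_subst_root:
  assumes "exp_factor q" "ram q = r" "polar Inf r q y" "\<omega> ^ r = 1"
  shows "polar Inf r (subst_root \<omega> q) (y \<diamondop> (fps_const \<omega> * fps_X))"
  unfolding polar_def
proof (intro allI impI)
  fix j assume j: "j < - coord_exp Inf r"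
  have r: "r \<ge> 1" using assms(2) ram_pos by metis
  then have w: "\<omega> \<noteq> 0" using assms(4) by (auto simp: power_0_left)
  define k where "k = (of_int (- (j + coord_exp Inf r)) / of_nat r :: rat)"
  have P: "of_int (coord_exp Inf r) * y $$ j = of_int (j + coord_exp Inf r) * lookup q k"
    using assms(3) j by (auto simp only: polar_def k_def)
  have "lookup q k * \<omega> powi j = lookup q k * inverse \<omega> ^ expo q k"
  proof (cases "k \<in> keys q")
    case True
    have "k * of_nat r = of_int (int r - j)" using r by (simp add: k_def)
    then have e: "int (expo q k) = int r - j" using j by (simp add: expo_def assms(2))
    have "\<omega> powi j = \<omega> powi (int r - int (expo q k))" using e by simp
    also have "\<dots> = \<omega> powi int r / \<omega> powi int (expo q k)" using w by (intro power_int_diff) simp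
    also have "\<dots> = inverse \<omega> ^ expo q k" using assms(4) by (simp add: power_inverse divide_inverse)
    finally show ?thesis by simp
  qed (simp add: in_keys_iff)
  then have "of_int (coord_exp Inf r) * (y $$ j * \<omega> powi j) = of_int (j + coord_exp Inf r) * (lookup q k * inverse \<omega> ^ expo q k)"
    using P by (simp add: mult.assoc[symmetric])
  then show "of_int (coord_exp Inf r) * (y \<diamondop> (fps_const \<omega> * fps_X)) $$ j =
     of_int (j + coord_exp Inf r) * lookup (subst_root \<omega> q) (of_int (- (j + coord_exp Inf r)) / of_nat r)"
    unfolding k_def[symmetric] lookup_subst_root fls_nth_fls_compose_fps_linear[OF w] .
qed

text \<open>If two roots of unity give the same conjugate, the order n of their quotient divides
  \<open>ram q\<close> and every exponent of q in the root of z. Then \<open>ram q\<close> / n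
  clears the denominators as well, so n = 1 by minimality.\<close>

lemma inj_on_subst_root:
  assumes "exp_factor q"
  shows "inj_on (\<lambda>\<omega>. subst_root \<omega> q) (roots_of_unity (ram q))"
proof (rule inj_onI)
  fix \<omega> \<omega>' assume w: "\<omega> \<in> roots_of_unity (ram q)" "\<omega>' \<in> roots_of_unity (ram q)"
    and eq: "subst_root \<omega> q = subst_root \<omega>' q"
  have nz: "\<omega> \<noteq> 0" "\<omega>' \<noteq> 0" using w root_nonzero[of _ q] by auto
  define \<eta> where "\<eta> = inverse \<omega> * \<omega>'"
  have er: "\<eta> ^ ram q = 1" using w by (simp add: \<eta>_def power_mult_distrib power_inverse)
  have ek: "\<eta> ^ expo q k = 1" if "k \<in> keys q" for k
  proof -
    have "lookup q k * inverse \<omega> ^ expo q k = lookup q k * inverse \<omega>' ^ expo q k"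
      using arg_cong[OF eq, of "\<lambda>p. lookup p k"] by (simp add: lookup_subst_root)
    then have "inverse \<omega> ^ expo q k = inverse \<omega>' ^ expo q k" using that by (simp add: in_keys_iff)
    then show ?thesis using nz by (simp add: \<eta>_def power_mult_distrib power_inverse)
  qed
  define n where "n = (LEAST n. 1 \<le> n \<and> \<eta> ^ n = 1)"
  have n: "1 \<le> n" "\<eta> ^ n = 1" using LeastI[of "\<lambda>n. 1 \<le> n \<and> \<eta> ^ n = 1" "ram q"] er ram_pos[of q] by (auto simp: n_def)
  have dv: "n dvd m" if "\<eta> ^ m = 1" for m
  proof (rule ccontr)
    assume "\<not> n dvd m"
    then have "1 \<le> m mod n" by (simp add: dvd_eq_mod_eq_0 Suc_le_eq)
    moreover have "\<eta> ^ (m mod n) = 1"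
    proof -
      have "\<eta> ^ m = (\<eta> ^ n) ^ (m div n) * \<eta> ^ (m mod n)"
        by (metis mult_div_mod_eq power_add power_mult)
      then show ?thesis using n that by simp
    qed
    ultimately have "n \<le> m mod n" unfolding n_def by (intro Least_le) simp
    moreover have "m mod n < n" using n(1) by simp
    ultimately show False by simp
  qed
  obtain r' where r': "ram q = n * r'" using dv[OF er] by (auto simp: dvd_def)
  have "ram q \<le> r'"
  proof (rule ram_least)
    show "1 \<le> r'" using r' ram_pos[of q] by (cases r') auto
    fix k assume k: "k \<in> keys q"
    obtain l where l: "expo q k = n * l" using dv[OF ek[OF k]] by (auto simp: dvd_def)
    have "of_nat n * (of_nat l :: rat) = of_nat n * (k * of_nat r')"
      using expo_eq[OF assms k] by (simp add: l r' mult_ac)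
    then have "k * of_nat r' = of_nat l" using n(1) by simp
    then show "k * of_nat r' \<in> \<int>" by simp
  qed
  then have "n = 1" using r' n(1) ram_pos[of q] by (cases n) auto
  then have "\<eta> = 1" using n(2) by simp
  then show "\<omega> = \<omega>'" using nz by (simp add: \<eta>_def field_simps)
qed

lemma galois_orbit_image: "galois_orbit q = (\<lambda>\<omega>. subst_root \<omega> q) ` roots_of_unity (ram q)"
  by (auto simp: galois_orbit_def)

lemma A_num_circ:
  assumes "exp_factor p" "exp_factor q"
  shows "A_num (circ a p) (circ b q) =
    (\<Sum>\<omega>\<in>roots_of_unity (ram p). \<Sum>\<eta>\<in>roots_of_unity (ram q). slope (subst_root \<omega> p - subst_root \<eta> q))"
  unfolding A_num_def conjugates_circ[OF assms(1)] conjugates_circ[OF assms(2)] galois_orbit_image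
  using inj_on_subst_root[OF assms(1)] inj_on_subst_root[OF assms(2)] by (simp add: sum.reindex)

lemma sum_roots_of_unity_shift:
  assumes "c \<in> roots_of_unity n" "n \<ge> 1"
  shows "(\<Sum>\<eta>\<in>roots_of_unity n. F (\<eta> * c)) = (\<Sum>\<eta>\<in>roots_of_unity n. F \<eta>)"
proof (rule sum.reindex_bij_witness[of _ "\<lambda>\<eta>. \<eta> / c" "\<lambda>\<eta>. \<eta> * c"])
  have "c \<noteq> 0" using assms by (auto simp: power_0_left)
  then show "\<And>a. a \<in> roots_of_unity n \<Longrightarrow> a * c / c = a" "\<And>b. b \<in> roots_of_unity n \<Longrightarrow> b / c * c = b" by auto
qed (use assms in \<open>auto simp: power_mult_distrib power_divide\<close>)

text \<open>Only the polar parts of y1 and y2 enter, so the transformed parametrisations may be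
  inserted directly. The double sum over conjugates collapses to r1 times a single sum, because
  rotating t makes all rows equal.\<close>

lemma A_num_eq:
  assumes "exp_factor p" "exp_factor q" "ram p = r1" "ram q = r2"
    and "polar Inf r1 p y1" "polar Inf r2 q y2" "circ Inf p \<noteq> circ Inf q"
  shows "\<zeta> \<in> roots_of_unity r2 \<Longrightarrow> y1 \<diamondop> (fps_X ^ r2) \<noteq> y2 \<diamondop> (fps_const \<zeta> * fps_X ^ r1)"
    and "of_nat r2 * (A_num (circ Inf p) (circ Inf q) - of_nat r1 * of_nat r2) =
      - of_int (\<Sum>\<zeta>\<in>roots_of_unity r2. fls_subdegree (y1 \<diamondop> (fps_X ^ r2) - y2 \<diamondop> (fps_const \<zeta> * fps_X ^ r1)))"
proof -
  have r: "r1 \<ge> 1" "r2 \<ge> 1" using assms ram_pos by metis+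
  define N where "N = r2 * r1"
  have N: "1 \<le> N" using r by (simp add: N_def)
  define D where "D = (\<lambda>\<zeta>. y1 \<diamondop> (fps_X ^ r2) - y2 \<diamondop> (fps_const \<zeta> * fps_X ^ r1))"
  have comp: "y \<diamondop> (fps_const \<zeta> * fps_X) \<diamondop> (fps_X ^ e) = y \<diamondop> (fps_const \<zeta> * fps_X ^ e)"
    if "\<zeta> \<noteq> 0" "e \<ge> 1" for y \<zeta> e
  proof -
    have "subdegree (fps_const \<zeta> * fps_X) \<noteq> 0" "subdegree (fps_X ^ e :: complex fps) \<noteq> 0"
      using that subdegree_linear[of \<zeta>] by simp_all
    moreover have "(fps_const \<zeta> * fps_X) oo (fps_X ^ e) = fps_const \<zeta> * fps_X ^ e"
      using that by (simp add: fps_linear_comp power_0_left)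
    ultimately show ?thesis by (simp add: fls_comp_assoc)
  qed
  have nz: "\<zeta> \<noteq> 0" if "\<zeta> \<in> roots_of_unity n" "n \<ge> 1" for \<zeta> n using that by (auto simp: power_0_left)
  have key: "y1 \<diamondop> (fps_const \<omega> * fps_X ^ r2) \<noteq> y2 \<diamondop> (fps_const \<eta> * fps_X ^ r1) \<and>
      of_int (fls_subdegree (y1 \<diamondop> (fps_const \<omega> * fps_X ^ r2) - y2 \<diamondop> (fps_const \<eta> * fps_X ^ r1))) =
      of_nat N * (1 - slope (subst_root \<omega> p - subst_root \<eta> q))"
    if w: "\<omega> \<in> roots_of_unity r1" "\<eta> \<in> roots_of_unity r2" for \<omega> \<eta>
  proof -
    note w0 = nz[OF w(1) r(1)] nz[OF w(2) r(2)]
    have e: "exp_factor (subst_root \<omega> p)" "exp_factor (subst_root \<eta> q)" using assms w0 by (simp_all add: exp_factor_subst_root)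
    have k: "k * of_nat r1 \<in> \<int>" if "k \<in> keys (subst_root \<omega> p)" for k
      using ram_Ints[OF that] w0 assms by (simp add: ram_subst_root)
    have k': "k * of_nat r2 \<in> \<int>" if "k \<in> keys (subst_root \<eta> q)" for k
      using ram_Ints[OF that] w0 assms by (simp add: ram_subst_root)
    have "polar Inf (r2 * r1) (subst_root \<omega> p) (y1 \<diamondop> (fps_const \<omega> * fps_X) \<diamondop> (fps_X ^ r2))"
      using assms w r k by (intro polar_comp_X_power polar_subst_root) auto
    moreover have "polar Inf (r1 * r2) (subst_root \<eta> q) (y2 \<diamondop> (fps_const \<eta> * fps_X) \<diamondop> (fps_X ^ r1))"
      using assms w r k' by (intro polar_comp_X_power polar_subst_root) auto
    ultimately have P: "polar Inf N (subst_root \<omega> p) (y1 \<diamondop> (fps_const \<omega> * fps_X ^ r2))"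
      "polar Inf N (subst_root \<eta> q) (y2 \<diamondop> (fps_const \<eta> * fps_X ^ r1))"
      unfolding comp[OF w0(1) r(2)] comp[OF w0(2) r(1)] N_def mult.commute[of r1 r2] .
    have "subst_root \<omega> p \<noteq> subst_root \<eta> q"
    proof
      assume eq: "subst_root \<omega> p = subst_root \<eta> q"
      have "galois_orbit (subst_root \<omega> p) = galois_orbit p"
        using w assms by (intro galois_orbit_eq) (auto simp: galois_orbit_image)
      moreover have "galois_orbit (subst_root \<eta> q) = galois_orbit q"
        using w assms by (intro galois_orbit_eq) (auto simp: galois_orbit_image)
      ultimately have "galois_orbit p = galois_orbit q" using eq by simp
      then show False using assms(7) by (simp add: circ_def)
    qed
    moreover have "k * of_nat N \<in> \<int>" if "k \<in> keys (subst_root \<omega> p)" for k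
      using Ints_mult[OF k[OF that], of "of_nat r2"] by (simp add: N_def mult_ac)
    moreover have "k * of_nat N \<in> \<int>" if "k \<in> keys (subst_root \<eta> q)" for k
      using Ints_mult[OF k'[OF that], of "of_nat r1"] by (simp add: N_def mult_ac)
    ultimately show ?thesis using subdegree_polar_diff[OF e _ N P] by blast
  qed
  have one: "1 \<in> roots_of_unity r1" by simp
  show "y1 \<diamondop> (fps_X ^ r2) \<noteq> y2 \<diamondop> (fps_const \<zeta> * fps_X ^ r1)" if "\<zeta> \<in> roots_of_unity r2" for \<zeta>
    using key[OF one that] by simp
  have inner: "(\<Sum>\<eta>\<in>roots_of_unity r2. of_nat N * (1 - slope (subst_root \<omega> p - subst_root \<eta> q))) =
      of_int (\<Sum>\<zeta>\<in>roots_of_unity r2. fls_subdegree (D \<zeta>))" if w: "\<omega> \<in> roots_of_unity r1" for \<omega>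
  proof -
    \<comment> \<open>The substitution of \<kappa> t, with \<kappa>^r2 = \<omega>, carries the pair
      (1, \<eta> \<kappa>^(-r1)) to (\<omega>, \<eta>); the factor \<kappa>^(-r1) is an r2-th root
      of unity and merely permutes the row.\<close>
    obtain \<kappa> where k: "\<kappa> ^ r2 = \<omega>" using exists_complex_root[OF r(2)] by blast
    have w0: "\<omega> \<noteq> 0" using nz[OF w r(1)] .
    then have k0: "\<kappa> \<noteq> 0" using k r by (auto simp: power_0_left)
    define c where "c = inverse \<kappa> ^ r1"
    have "c ^ r2 = inverse ((\<kappa> ^ r2) ^ r1)" unfolding c_def by (simp add: power_inverse mult.commute flip: power_mult)
    then have c: "c \<in> roots_of_unity r2" using k w by simp
    have "fls_subdegree (y1 \<diamondop> (fps_const \<omega> * fps_X ^ r2) - y2 \<diamondop> (fps_const \<eta> * fps_X ^ r1)) = fls_subdegree (D (\<eta> * c))"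
      if e: "\<eta> \<in> roots_of_unity r2" for \<eta>
    proof -
      note e0 = nz[OF e r(2)]
      have c0: "c \<noteq> 0" using k0 by (simp add: c_def)
      define l where "l = fps_const \<kappa> * fps_X"
      have l: "subdegree l = 1" unfolding l_def by (rule subdegree_linear[OF k0])
      note l1 = subdegree_1D[OF l]
      have s: "subdegree (fps_X ^ r2 :: complex fps) \<noteq> 0" "subdegree (fps_const (\<eta> * c) * fps_X ^ r1) \<noteq> 0"
        using r e0 c0 subdegree_monomial[of "\<eta> * c" r1] by simp_all
      have "(fps_X ^ r2) oo l = fps_const \<omega> * fps_X ^ r2"
        using l1 k by (simp add: fps_X_power_comp l_def power_mult_distrib)
      moreover have "c * \<kappa> ^ r1 = 1" using k0 by (simp add: c_def power_inverse)
      then have "(fps_const (\<eta> * c) * fps_X ^ r1) oo l = fps_const \<eta> * fps_X ^ r1"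
        using l1 by (simp add: fps_linear_comp fps_X_power_comp l_def power_mult_distrib mult.assoc[symmetric])
      ultimately have "y1 \<diamondop> (fps_const \<omega> * fps_X ^ r2) - y2 \<diamondop> (fps_const \<eta> * fps_X ^ r1) = D (\<eta> * c) \<diamondop> l"
        unfolding D_def using l1 s by (simp add: fls_comp_simps fls_comp_assoc)
      then show ?thesis using l by (simp add: fls_subdegree_comp)
    qed
    then have "(\<Sum>\<eta>\<in>roots_of_unity r2. of_nat N * (1 - slope (subst_root \<omega> p - subst_root \<eta> q))) =
      (\<Sum>\<eta>\<in>roots_of_unity r2. of_int (fls_subdegree (D (\<eta> * c))))"
      using key[OF w] by (intro sum.cong) auto
    also have "\<dots> = (\<Sum>\<eta>\<in>roots_of_unity r2. of_int (fls_subdegree (D \<eta>)))"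
      by (rule sum_roots_of_unity_shift[OF c r(2)])
    finally show ?thesis by simp
  qed
  define A where "A = A_num (circ Inf p) (circ Inf q)"
  have "of_nat N * (of_nat r1 * of_nat r2 - A) =
    (\<Sum>\<omega>\<in>roots_of_unity r1. \<Sum>\<eta>\<in>roots_of_unity r2. of_nat N * (1 - slope (subst_root \<omega> p - subst_root \<eta> q)))"
    unfolding A_def A_num_circ[OF assms(1,2)] assms(3,4) using r
    by (simp add: sum_subtractf card_roots_of_unity flip: sum_distrib_left)
  also have "\<dots> = of_nat r1 * of_int (\<Sum>\<zeta>\<in>roots_of_unity r2. fls_subdegree (D \<zeta>))"
  proof -
    have "(\<Sum>\<omega>\<in>roots_of_unity r1. \<Sum>\<eta>\<in>roots_of_unity r2. of_nat N * (1 - slope (subst_root \<omega> p - subst_root \<eta> q))) =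
      (\<Sum>\<omega>\<in>roots_of_unity r1. of_int (\<Sum>\<zeta>\<in>roots_of_unity r2. fls_subdegree (D \<zeta>)))"
      by (rule sum.cong[OF refl inner])
    then show ?thesis by (simp only: sum_constant card_roots_of_unity[OF r(1)])
  qed
  finally have "of_nat r1 * (of_nat r2 * (of_nat r1 * of_nat r2 - A)) = of_nat r1 * of_int (\<Sum>\<zeta>\<in>roots_of_unity r2. fls_subdegree (D \<zeta>))"
    by (simp add: N_def mult_ac)
  then have "of_nat r2 * (of_nat r1 * of_nat r2 - A) = of_int (\<Sum>\<zeta>\<in>roots_of_unity r2. fls_subdegree (D \<zeta>))"
    using r by (simp only: mult_cancel_left) auto
  then show "of_nat r2 * (A_num (circ Inf p) (circ Inf q) - of_nat r1 * of_nat r2) =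
      - of_int (\<Sum>\<zeta>\<in>roots_of_unity r2. fls_subdegree (y1 \<diamondop> (fps_X ^ r2) - y2 \<diamondop> (fps_const \<zeta> * fps_X ^ r1)))"
    unfolding D_def A_def by (simp add: algebra_simps)
qed

text \<open>The same collapse of rows, now by rotating with \<omega> itself. Pairs of equal
  conjugates have slope 0 and are dropped, which leaves r(r-1) pairs.\<close>

lemma A_num_self:
  assumes "exp_factor q" "ram q = r" "polar Inf r q y"
  shows "\<zeta> \<in> roots_of_unity r - {1} \<Longrightarrow> y \<noteq> y \<diamondop> (fps_const \<zeta> * fps_X)"
    and "A_num (circ Inf q) (circ Inf q) = of_nat r * (of_nat r - 1) -
      of_int (\<Sum>\<zeta>\<in>roots_of_unity r - {1}. fls_subdegree (y - y \<diamondop> (fps_const \<zeta> * fps_X)))"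
proof -
  have r: "r \<ge> 1" using assms ram_pos by metis
  define R where "R = roots_of_unity r"
  have R: "finite R" "card R = r" "1 \<in> R" using r by (simp_all add: R_def card_roots_of_unity)
  define D where "D = (\<lambda>\<zeta>. y - y \<diamondop> (fps_const \<zeta> * fps_X))"
  have nz: "\<zeta> \<noteq> 0" if "\<zeta> \<in> R" for \<zeta> using that r by (auto simp: R_def power_0_left)
  define sl where "sl = (\<lambda>\<omega> \<eta>. slope (subst_root \<omega> q - subst_root \<eta> q))"
  have key: "y \<diamondop> (fps_const \<omega> * fps_X) \<noteq> y \<diamondop> (fps_const \<eta> * fps_X) \<and>
      of_int (fls_subdegree (y \<diamondop> (fps_const \<omega> * fps_X) - y \<diamondop> (fps_const \<eta> * fps_X))) =
      of_nat r * (1 - sl \<omega> \<eta>)"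
    if w: "\<omega> \<in> R" "\<eta> \<in> R" "\<omega> \<noteq> \<eta>" for \<omega> \<eta>
  proof -
    have k: "k * of_nat r \<in> \<int>" if "k \<in> keys (subst_root \<xi> q)" "\<xi> \<in> R" for k \<xi>
      using ram_Ints[OF that(1)] nz[OF that(2)] assms by (simp add: ram_subst_root)
    have e: "exp_factor (subst_root \<omega> q)" "exp_factor (subst_root \<eta> q)"
      using assms nz w by (simp_all add: exp_factor_subst_root)
    have P: "polar Inf r (subst_root \<omega> q) (y \<diamondop> (fps_const \<omega> * fps_X))"
      "polar Inf r (subst_root \<eta> q) (y \<diamondop> (fps_const \<eta> * fps_X))"
      using w polar_subst_root[OF assms] by (simp_all add: R_def)
    have "subst_root \<omega> q \<noteq> subst_root \<eta> q"
      using inj_onD[OF inj_on_subst_root[OF assms(1)], of \<omega> \<eta>] w assms(2) by (auto simp: R_def)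
    then show ?thesis using subdegree_polar_diff[OF e _ r P] k w unfolding sl_def by blast
  qed
  show "y \<noteq> y \<diamondop> (fps_const \<zeta> * fps_X)" if "\<zeta> \<in> roots_of_unity r - {1}" for \<zeta>
    using key[of 1 \<zeta>] that R by (auto simp: R_def)
  define S where "S = (\<Sum>\<zeta>\<in>R - {1}. fls_subdegree (D \<zeta>))"
  have inner: "of_nat r * (\<Sum>\<eta>\<in>R. sl \<omega> \<eta>) = of_nat r * (of_nat r - 1) - of_int S" if w: "\<omega> \<in> R" for \<omega>
  proof -
    note w0 = nz[OF w]
    have "(\<Sum>\<eta>\<in>R - {\<omega>}. of_nat r * (1 - sl \<omega> \<eta>)) = (\<Sum>\<zeta>\<in>R - {1}. of_int (fls_subdegree (D \<zeta>)))"
    proof (rule sum.reindex_bij_witness[of _ "\<lambda>\<zeta>. \<zeta> * \<omega>" "\<lambda>\<eta>. \<eta> / \<omega>"])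
      fix \<eta> assume e: "\<eta> \<in> R - {\<omega>}"
      then have e0: "\<eta> / \<omega> \<noteq> 0" using nz w0 by simp
      define l where "l = fps_const \<omega> * fps_X"
      have l: "subdegree l = 1" unfolding l_def by (rule subdegree_linear[OF w0])
      note l1 = subdegree_1D[OF l]
      have s: "subdegree (fps_const (\<eta> / \<omega>) * fps_X) \<noteq> 0" using subdegree_linear[OF e0] by simp
      have "(fps_const (\<eta> / \<omega>) * fps_X) oo l = fps_const \<eta> * fps_X"
        using l1 w0 by (simp add: fps_linear_comp l_def mult.assoc[symmetric])
      then have "y \<diamondop> l - y \<diamondop> (fps_const \<eta> * fps_X) = D (\<eta> / \<omega>) \<diamondop> l"
        unfolding D_def using l1 s by (simp add: fls_comp_simps fls_comp_assoc)
      then have "fls_subdegree (y \<diamondop> l - y \<diamondop> (fps_const \<eta> * fps_X)) = fls_subdegree (D (\<eta> / \<omega>))"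
        using l by (simp add: fls_subdegree_comp)
      then show "of_int (fls_subdegree (D (\<eta> / \<omega>))) = of_nat r * (1 - sl \<omega> \<eta>)"
        using key[OF w, of \<eta>] e by (auto simp: l_def)
    qed (use w w0 in \<open>auto simp: R_def power_mult_distrib power_divide\<close>)
    also have "\<dots> = of_int S" by (simp add: S_def)
    finally have "of_int S = of_nat r * (of_nat (card (R - {\<omega>})) - (\<Sum>\<eta>\<in>R - {\<omega>}. sl \<omega> \<eta>))"
      by (simp only: sum_subtractf sum_constant mult_1_right flip: sum_distrib_left)
    moreover have "(\<Sum>\<eta>\<in>R. sl \<omega> \<eta>) = sl \<omega> \<omega> + (\<Sum>\<eta>\<in>R - {\<omega>}. sl \<omega> \<eta>)"
      using R w by (intro sum.remove)
    moreover have "sl \<omega> \<omega> = 0" by (simp add: sl_def)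
    moreover have "(of_nat (card (R - {\<omega>})) :: rat) = of_nat r - 1"
      using R w r by (subst card_Diff_singleton) (auto simp: of_nat_diff)
    ultimately show ?thesis by (simp add: algebra_simps)
  qed
  have "of_nat r * A_num (circ Inf q) (circ Inf q) = (\<Sum>\<omega>\<in>R. of_nat r * (\<Sum>\<eta>\<in>R. sl \<omega> \<eta>))"
    unfolding A_num_circ[OF assms(1,1)] assms(2) R_def sl_def by (simp only: sum_distrib_left)
  also have "\<dots> = (\<Sum>\<omega>\<in>R. of_nat r * (of_nat r - 1) - of_int S)"
    by (rule sum.cong[OF refl inner])
  also have "\<dots> = of_nat r * (of_nat r * (of_nat r - 1) - of_int S)" by (simp only: sum_constant R)
  finally have "A_num (circ Inf q) (circ Inf q) = of_nat r * (of_nat r - 1) - of_int S"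
    using r by (simp only: mult_cancel_left) auto
  then show "A_num (circ Inf q) (circ Inf q) = of_nat r * (of_nat r - 1) -
      of_int (\<Sum>\<zeta>\<in>roots_of_unity r - {1}. fls_subdegree (y - y \<diamondop> (fps_const \<zeta> * fps_X)))"
    by (simp add: S_def R_def D_def)
qed

text \<open>G is the parameter in which the new first coordinate is exactly t^(-m), and H is its
  inverse. The first equation is z' = d z - c xi and the second its inverse z = a z' + c xi', valid
  because the determinant is 1; they have the form of the intersection lemmas with \<beta> = -c. Y
  is the new xi and agrees with dp'/dz only in its polar part.\<close>

lemma transformed_germ:
  assumes "A \<in> SL2" "exp_factor p" "exp_factor p'" "circle_rel A (circ Inf p) (circ Inf p')"
  shows "\<exists>H Y. subdegree H = 1 \<and> polar Inf (ram p') p' Y \<and>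
    fls_const (A$2$2) * fls_X_intpow (- int (ram p)) + fls_const (- A$2$1) * Dexp Inf p = fls_X_intpow (- int (ram p')) \<diamondop> H \<and>
    fls_const (A$1$1) * fls_X_intpow (- int (ram p')) - fls_const (- A$2$1) * Y = fls_X_intpow (- int (ram p)) \<diamondop> fps_inv H"
proof -
  define x where "x = (fls_X_intpow (- int (ram p)) :: complex fls)"
  define y where "y = Dexp Inf p"
  define m where "m = ram p'"
  define \<delta> where "\<delta> = act A (germ Inf p)"
  have d: "fst \<delta> = fls_const (A$2$2) * x - fls_const (A$2$1) * y"
    "snd \<delta> = fls_const (A$1$1) * y - fls_const (A$1$2) * x"
    by (simp_all add: \<delta>_def act_def germ_def x_def y_def coord_eq)
  have g: "germ Inf p' = (coord Inf m, Dexp Inf p')" by (simp add: germ_def m_def)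
  have m: "1 \<le> m" unfolding m_def by (rule ram_pos)
  have "germ_equiv (germ Inf p') \<delta>"
    using assms circle_rel_circ germ_equiv_sym unfolding \<delta>_def by blast
  then obtain h where h: "subdegree h = 1" "near (pole (coord Inf m, Dexp Inf p')) (gcomp \<delta> h) (coord Inf m, Dexp Inf p')"
    by (auto simp: germ_equiv_def g)
  have "coord_exp Inf m < pole (coord Inf m, Dexp Inf p')" using pole_coord_Inf[of m "Dexp Inf p'"] m by simp
  from normalize_first_coordinate[OF m this h(1) _ h(2)]
  obtain G where G: "subdegree G = 1" "fst \<delta> \<diamondop> G = coord Inf m" "ordge (- coord_exp Inf m) (snd \<delta> \<diamondop> G - Dexp Inf p')"
    by auto
  note G1 = subdegree_1D[OF G(1)] and iG = fps_inv_subdegree[OF G(1)]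
  define Y where "Y = snd \<delta> \<diamondop> G"
  have pY: "polar Inf m p' Y"
    using polar_cong[OF polar_Dexp[OF assms(3), of Inf, folded m_def] G(3)] by (simp add: Y_def)
  have "fst \<delta> = fst \<delta> \<diamondop> G \<diamondop> fps_inv G" using G1 iG by (simp add: fls_comp_assoc)
  then have E: "fst \<delta> = fls_X_intpow (- int m) \<diamondop> fps_inv G" using G(2) by (simp add: coord_eq)
  have "fls_const (A$1$1) * fst \<delta> + fls_const (A$2$1) * snd \<delta> = fls_const (A$1$1 * A$2$2 - A$1$2 * A$2$1) * x"
    unfolding d by (simp add: algebra_simps flip: fls_minus_const fls_const_mult_const)
  then have "fls_const (A$1$1) * fst \<delta> + fls_const (A$2$1) * snd \<delta> = x" using assms(1) by (simp add: SL2_iff)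
  then have "x \<diamondop> G = (fls_const (A$1$1) * fst \<delta> + fls_const (A$2$1) * snd \<delta>) \<diamondop> G" by simp
  also have "\<dots> = fls_const (A$1$1) * coord Inf m + fls_const (A$2$1) * Y"
    by (simp only: fls_comp_simps[OF G1(3) G1(3)] fls_compose_fps_const G(2) Y_def)
  finally have E': "fls_const (A$1$1) * fls_X_intpow (- int m) - fls_const (- A$2$1) * Y = x \<diamondop> G"
    by (simp add: coord_eq)
  have "fps_nth G 1 \<noteq> 0" using G(1) G1 by (metis nth_subdegree_nonzero)
  then have "fps_inv (fps_inv G) = G" using G1 by (intro fps_inv_idempotent)
  then show ?thesis using iG(1) pY E E' d unfolding m_def x_def y_def
    by (intro exI[of _ "fps_inv G"] exI[of _ Y]) (simp add: algebra_simps)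
qed

lemma B_num_invariant:
  assumes A: "A \<in> SL2" "A$2$1 \<noteq> 0"
    and e: "exp_factor p" "exp_factor p'" "exp_factor q" "exp_factor q'"
    and rel: "circle_rel A (circ Inf p) (circ Inf p')" "circle_rel A (circ Inf q) (circ Inf q')"
  shows "B_num (circ Inf p') (circ Inf q') = B_num (circ Inf p) (circ Inf q)"
proof -
  have eq: "circ Inf p' = circ Inf q' \<longleftrightarrow> circ Inf p = circ Inf q"
    using circle_rel_right_unique[OF A(1)] circle_rel_left_unique[OF A(1)] rel by metis
  define r1 r2 m1 m2 where d: "r1 = ram p" "r2 = ram q" "m1 = ram p'" "m2 = ram q'"
  have ge: "r1 \<ge> 1" "r2 \<ge> 1" "m1 \<ge> 1" "m2 \<ge> 1" using ram_pos by (simp_all add: d)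
  obtain H1 Y1 where 1: "subdegree H1 = 1" "polar Inf m1 p' Y1"
    "fls_const (A$2$2) * fls_X_intpow (- int r1) + fls_const (- A$2$1) * Dexp Inf p = fls_X_intpow (- int m1) \<diamondop> H1"
    "fls_const (A$1$1) * fls_X_intpow (- int m1) - fls_const (- A$2$1) * Y1 = fls_X_intpow (- int r1) \<diamondop> fps_inv H1"
    using transformed_germ[OF A(1) e(1,2) rel(1)] unfolding d by blast
  have b: "- A$2$1 \<noteq> 0" using A(2) by simp
  have p: "polar Inf r1 p (Dexp Inf p)" "polar Inf r2 q (Dexp Inf q)"
    using polar_Dexp e by (simp_all add: d)
  show ?thesis
  proof (cases "circ Inf p = circ Inf q")
    case True
    note S = A_num_self[OF e(1) d(1)[symmetric] p(1)] and S' = A_num_self[OF e(2) d(3)[symmetric] 1(2)]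
    have I: "(\<Sum>\<zeta>\<in>roots_of_unity r1 - {1}. fls_subdegree (Dexp Inf p - Dexp Inf p \<diamondop> (fps_const \<zeta> * fps_X))) + (int r1 - 1) * (2 * int m1 - 1) =
      (\<Sum>\<zeta>\<in>roots_of_unity m1 - {1}. fls_subdegree (Y1 - Y1 \<diamondop> (fps_const \<zeta> * fps_X))) + (int m1 - 1) * (2 * int r1 - 1)"
      (is "?S + _ = ?S' + _")
      by (rule self_intersection_symmetric[OF b 1(1) ge(1,3) 1(3,4) S(1) S'(1)])
    have "A_num (circ Inf p') (circ Inf p') - (of_nat m1)\<^sup>2 + 1 = A_num (circ Inf p) (circ Inf p) - (of_nat r1)\<^sup>2 + 1"
    proof -
      \<comment> \<open>The loop numbers are 1 - r1 - S before and 1 - m1 - S' after, and the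
        identity says S' = S + r1 - m1.\<close>
      have "?S' = ?S + (int r1 - 1) * (2 * int m1 - 1) - (int m1 - 1) * (2 * int r1 - 1)" using I by simp
      then have s: "(of_int ?S' :: rat) = of_int ?S + (of_nat r1 - 1) * (2 * of_nat m1 - 1) - (of_nat m1 - 1) * (2 * of_nat r1 - 1)"
        by (simp only: of_int_add of_int_diff of_int_mult of_int_1 of_int_numeral of_int_of_nat_eq)
      show ?thesis unfolding S(2) S'(2) s by (simp add: algebra_simps power2_eq_square)
    qed
    moreover have "circ Inf q' = circ Inf p'" "circ Inf q = circ Inf p" using True eq by simp_all
    ultimately show ?thesis using e by (simp add: B_num_def d)
  next
    case False
    obtain H2 Y2 where 2: "subdegree H2 = 1" "polar Inf m2 q' Y2"
      "fls_const (A$2$2) * fls_X_intpow (- int r2) + fls_const (- A$2$1) * Dexp Inf q = fls_X_intpow (- int m2) \<diamondop> H2"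
      "fls_const (A$1$1) * fls_X_intpow (- int m2) - fls_const (- A$2$1) * Y2 = fls_X_intpow (- int r2) \<diamondop> fps_inv H2"
      using transformed_germ[OF A(1) e(3,4) rel(2)] unfolding d by blast
    have F': "circ Inf p' \<noteq> circ Inf q'" using False eq by simp
    note N = A_num_eq[OF e(1,3) d(1,2)[symmetric] p False]
    note N' = A_num_eq[OF e(2,4) d(3,4)[symmetric] 1(2) 2(2) F']
    have I: "int m2 * (\<Sum>\<zeta>\<in>roots_of_unity r2. fls_subdegree (Dexp Inf p \<diamondop> (fps_X ^ r2) - Dexp Inf q \<diamondop> (fps_const \<zeta> * fps_X ^ r1))) =
      int r2 * (\<Sum>\<zeta>\<in>roots_of_unity m2. fls_subdegree (Y1 \<diamondop> (fps_X ^ m2) - Y2 \<diamondop> (fps_const \<zeta> * fps_X ^ m1)))"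
      (is "_ * ?S = _ * ?S'")
      by (rule intersection_symmetric[OF b 1(1) 2(1) ge 1(3) 2(3) 1(4) 2(4) N(1) N'(1)])
    define B where "B = A_num (circ Inf p) (circ Inf q) - of_nat r1 * of_nat r2"
    define B' where "B' = A_num (circ Inf p') (circ Inf q') - of_nat m1 * of_nat m2"
    have "of_nat m2 * (of_nat r2 * B) = - of_int (int m2 * ?S)" unfolding B_def N(2) by simp
    also have "\<dots> = of_nat r2 * (of_nat m2 * B')" unfolding B'_def N'(2) I by simp
    finally have "B = B'" using ge by simp
    then show ?thesis using False F' e by (simp add: B_num_def d B_def B'_def)
  qed
qed

section \<open>Legs\<close>

text \<open>The least such d is the degree of the minimal polynomial. No leading coefficient is
  singled out, so the condition is visibly stable under rescaling and under reversal of the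
  coefficients, which is what inversion of M does.\<close>

definition lin_dependent_powers :: "nat \<Rightarrow> complex mat \<Rightarrow> bool" where
  "lin_dependent_powers d M \<longleftrightarrow> (\<exists>c. (\<exists>k\<le>d. c k \<noteq> 0) \<and>
     (\<forall>i<dim_row M. \<forall>j<dim_row M. (\<Sum>k\<le>d. c k * index_mat (M ^\<^sub>m k) (i, j)) = 0))"

lemma annihilating_poly_iff:
  "(\<exists>p. Polynomial.lead_coeff p = 1 \<and> annihilates p M \<and> Polynomial.degree p \<le> d) \<longleftrightarrow> lin_dependent_powers d M"
proof
  assume "\<exists>p. Polynomial.lead_coeff p = 1 \<and> annihilates p M \<and> Polynomial.degree p \<le> d"
  then obtain p where p: "Polynomial.lead_coeff p = 1" "annihilates p M" "Polynomial.degree p \<le> d" by blast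
  have "(\<Sum>k\<le>d. poly.coeff p k * index_mat (M ^\<^sub>m k) (i, j)) =
      (\<Sum>k\<le>Polynomial.degree p. poly.coeff p k * index_mat (M ^\<^sub>m k) (i, j))" for i j
    using p(3) by (intro sum.mono_neutral_right) (auto simp: Polynomial.coeff_eq_0)
  then have "\<forall>i<dim_row M. \<forall>j<dim_row M. (\<Sum>k\<le>d. poly.coeff p k * index_mat (M ^\<^sub>m k) (i, j)) = 0"
    using p(2) by (simp add: annihilates_def)
  moreover have "\<exists>k\<le>d. poly.coeff p k \<noteq> 0" using p(1,3) by (intro exI[of _ "Polynomial.degree p"]) auto
  ultimately show "lin_dependent_powers d M" unfolding lin_dependent_powers_def by blast
next
  assume "lin_dependent_powers d M"
  then obtain c where c: "\<exists>k\<le>d. c k \<noteq> 0"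
    "\<And>i j. i < dim_row M \<Longrightarrow> j < dim_row M \<Longrightarrow> (\<Sum>k\<le>d. c k * index_mat (M ^\<^sub>m k) (i, j)) = 0"
    unfolding lin_dependent_powers_def by blast
  \<comment> \<open>Dividing by the last nonzero coefficient gives a monic polynomial.\<close>
  define e where "e = Max {k. k \<le> d \<and> c k \<noteq> 0}"
  have fin: "finite {k. k \<le> d \<and> c k \<noteq> 0}" "{k. k \<le> d \<and> c k \<noteq> 0} \<noteq> {}" using c(1) by auto
  have e: "e \<le> d" "c e \<noteq> 0" using Max_in[OF fin] by (auto simp: e_def)
  have above: "c k = 0" if "e < k" "k \<le> d" for k
  proof (rule ccontr)
    assume "c k \<noteq> 0"
    then have "k \<le> e" using Max_ge[OF fin(1), of k] that by (simp add: e_def)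
    then show False using that by simp
  qed
  define p where "p = (\<Sum>k\<le>e. Polynomial.monom (c k / c e) k)"
  have cf: "poly.coeff p k = (if k \<le> e then c k / c e else 0)" for k
    by (simp add: p_def Polynomial.coeff_sum)
  have deg: "Polynomial.degree p = e"
  proof (rule order_antisym)
    show "Polynomial.degree p \<le> e" by (rule Polynomial.degree_le) (simp add: cf)
    show "e \<le> Polynomial.degree p" by (rule Polynomial.le_degree) (simp add: cf e)
  qed
  have "(\<Sum>k\<le>e. poly.coeff p k * index_mat (M ^\<^sub>m k) (i, j)) = 0" if "i < dim_row M" "j < dim_row M" for i j
  proof -
    have "(\<Sum>k\<le>e. poly.coeff p k * index_mat (M ^\<^sub>m k) (i, j)) = (\<Sum>k\<le>e. c k * index_mat (M ^\<^sub>m k) (i, j)) / c e"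
      by (simp add: cf sum_divide_distrib)
    also have "(\<Sum>k\<le>e. c k * index_mat (M ^\<^sub>m k) (i, j)) = (\<Sum>k\<le>d. c k * index_mat (M ^\<^sub>m k) (i, j))"
      using e above by (intro sum.mono_neutral_left) auto
    finally show ?thesis using c(2)[OF that] by simp
  qed
  then have "annihilates p M" by (simp add: annihilates_def deg)
  moreover have "Polynomial.lead_coeff p = 1" using e by (simp add: deg cf)
  ultimately show "\<exists>p. Polynomial.lead_coeff p = 1 \<and> annihilates p M \<and> Polynomial.degree p \<le> d"
    using e deg by blast
qed

text \<open>No annihilating polynomial needs to be exhibited: without one, both degrees would be the degree of the
  same arbitrary polynomial.\<close>

lemma degree_minimal_poly_cong:
  assumes "\<And>d. lin_dependent_powers d M \<longleftrightarrow> lin_dependent_powers d N"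
  shows "Polynomial.degree (minimal_poly M) = Polynomial.degree (minimal_poly N)"
proof -
  have le: "Polynomial.degree (minimal_poly M) \<le> Polynomial.degree (minimal_poly N)"
    if MN: "\<And>d. lin_dependent_powers d M \<longleftrightarrow> lin_dependent_powers d N"
      and ex: "\<exists>p. Polynomial.lead_coeff p = 1 \<and> annihilates p N" for M N
  proof -
    obtain p where "Polynomial.lead_coeff p = 1 \<and> annihilates p N" using ex by blast
    then have "Polynomial.lead_coeff (minimal_poly N) = 1 \<and> annihilates (minimal_poly N) N"
      unfolding minimal_poly_def by (rule arg_min_natI)
    then have "lin_dependent_powers (Polynomial.degree (minimal_poly N)) N"
      unfolding annihilating_poly_iff[symmetric] by blast
    then have "lin_dependent_powers (Polynomial.degree (minimal_poly N)) M" using MN by simp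
    then have "\<exists>q. Polynomial.lead_coeff q = 1 \<and> annihilates q M \<and> Polynomial.degree q \<le> Polynomial.degree (minimal_poly N)"
      by (simp only: annihilating_poly_iff)
    then obtain q where "Polynomial.lead_coeff q = 1" "annihilates q M" "Polynomial.degree q \<le> Polynomial.degree (minimal_poly N)"
      by blast
    then show ?thesis
      using arg_min_nat_le[of "\<lambda>p. Polynomial.lead_coeff p = 1 \<and> annihilates p M" q Polynomial.degree]
      unfolding minimal_poly_def by simp
  qed
  have ex: "(\<exists>p. Polynomial.lead_coeff p = 1 \<and> annihilates p M) \<longleftrightarrow> (\<exists>p. Polynomial.lead_coeff p = 1 \<and> annihilates p N)"
  proof -
    have "(\<exists>p. Polynomial.lead_coeff p = 1 \<and> annihilates p L) \<longleftrightarrow> (\<exists>d. lin_dependent_powers d L)" for L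
      unfolding annihilating_poly_iff[symmetric] by blast
    then show ?thesis using assms by simp
  qed
  show ?thesis
  proof (cases "\<exists>p. Polynomial.lead_coeff p = 1 \<and> annihilates p N")
    case True
    then show ?thesis using le[of M N] le[of N M] assms ex by (intro order_antisym) auto
  next
    case False
    then have "(\<lambda>p. Polynomial.lead_coeff p = 1 \<and> annihilates p M) = (\<lambda>p. Polynomial.lead_coeff p = 1 \<and> annihilates p N)"
      using ex by blast
    then show ?thesis unfolding minimal_poly_def by simp
  qed
qed

lemma sum_mult_left_eq_0:
  assumes "L \<in> carrier_mat n n" "\<And>k. k \<le> d \<Longrightarrow> X k \<in> carrier_mat n n"
    and "\<And>i j. i < n \<Longrightarrow> j < n \<Longrightarrow> (\<Sum>k\<le>d. c k * index_mat (X k) (i, j)) = (0::complex)"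
    and ij: "i < n" "j < n"
  shows "(\<Sum>k\<le>d. c k * index_mat (L * X k) (i, j)) = 0"
proof -
  have e: "index_mat (L * X k) (i, j) = (\<Sum>a<n. index_mat L (i, a) * index_mat (X k) (a, j))" if "k \<le> d" for k
    using assms(1) assms(2)[OF that] ij by (simp add: scalar_prod_def lessThan_atLeast0)
  have "(\<Sum>k\<le>d. c k * index_mat (L * X k) (i, j)) =
     (\<Sum>k\<le>d. \<Sum>a<n. index_mat L (i, a) * (c k * index_mat (X k) (a, j)))"
    by (intro sum.cong refl) (auto simp: e sum_distrib_left mult_ac)
  also have "\<dots> = (\<Sum>a<n. \<Sum>k\<le>d. index_mat L (i, a) * (c k * index_mat (X k) (a, j)))" by (rule sum.swap)
  also have "\<dots> = (\<Sum>a<n. index_mat L (i, a) * (\<Sum>k\<le>d. c k * index_mat (X k) (a, j)))"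
    by (simp only: sum_distrib_left)
  also have "\<dots> = 0" using assms(3) ij by simp
  finally show ?thesis .
qed

lemma sum_mult_right_eq_0:
  assumes "R \<in> carrier_mat n n" "\<And>k. k \<le> d \<Longrightarrow> X k \<in> carrier_mat n n"
    and "\<And>i j. i < n \<Longrightarrow> j < n \<Longrightarrow> (\<Sum>k\<le>d. c k * index_mat (X k) (i, j)) = (0::complex)"
    and ij: "i < n" "j < n"
  shows "(\<Sum>k\<le>d. c k * index_mat (X k * R) (i, j)) = 0"
proof -
  have e: "index_mat (X k * R) (i, j) = (\<Sum>a<n. index_mat (X k) (i, a) * index_mat R (a, j))" if "k \<le> d" for k
    using assms(1) assms(2)[OF that] ij by (simp add: scalar_prod_def lessThan_atLeast0)
  have "(\<Sum>k\<le>d. c k * index_mat (X k * R) (i, j)) =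
     (\<Sum>k\<le>d. \<Sum>a<n. index_mat R (a, j) * (c k * index_mat (X k) (i, a)))"
    by (intro sum.cong refl) (auto simp: e sum_distrib_left mult_ac)
  also have "\<dots> = (\<Sum>a<n. \<Sum>k\<le>d. index_mat R (a, j) * (c k * index_mat (X k) (i, a)))" by (rule sum.swap)
  also have "\<dots> = (\<Sum>a<n. index_mat R (a, j) * (\<Sum>k\<le>d. c k * index_mat (X k) (i, a)))"
    by (simp only: sum_distrib_left)
  also have "\<dots> = 0" using assms(3) ij by simp
  finally show ?thesis .
qed

lemma lin_dependent_powers_similar:
  assumes "similar_mat N M" "lin_dependent_powers d M"
  shows "lin_dependent_powers d N"
proof -
  define n where "n = dim_row N"
  obtain P Q where w: "similar_mat_wit N M P Q" using assms(1) by (auto simp: similar_mat_def)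
  then have car: "N \<in> carrier_mat n n" "M \<in> carrier_mat n n" "P \<in> carrier_mat n n" "Q \<in> carrier_mat n n"
    unfolding similar_mat_wit_def Let_def n_def by blast+
  obtain c where c: "\<exists>k\<le>d. c k \<noteq> 0"
    "\<And>i j. i < n \<Longrightarrow> j < n \<Longrightarrow> (\<Sum>k\<le>d. c k * index_mat (M ^\<^sub>m k) (i, j)) = 0"
    using assms(2) car unfolding lin_dependent_powers_def by auto
  have 1: "(\<Sum>k\<le>d. c k * index_mat (P * M ^\<^sub>m k) (i, j)) = 0" if "i < n" "j < n" for i j
    by (rule sum_mult_left_eq_0[OF car(3) _ c(2) that]) (use car in auto)
  have "(\<Sum>k\<le>d. c k * index_mat (P * M ^\<^sub>m k * Q) (i, j)) = 0" if "i < n" "j < n" for i j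
    by (rule sum_mult_right_eq_0[OF car(4) _ 1 that]) (use car in auto)
  then have "(\<Sum>k\<le>d. c k * index_mat (N ^\<^sub>m k) (i, j)) = 0" if "i < n" "j < n" for i j
    using that by (simp only: similar_mat_wit_pow_id[OF w])
  then show ?thesis using c(1) unfolding lin_dependent_powers_def n_def by blast
qed

lemma pow_mat_smult:
  assumes "M \<in> carrier_mat n n"
  shows "(s \<cdot>\<^sub>m M) ^\<^sub>m k = (s ^ k :: complex) \<cdot>\<^sub>m (M ^\<^sub>m k)"
proof (induction k)
  case (Suc k)
  have "(s \<cdot>\<^sub>m M) ^\<^sub>m Suc k = (s ^ k \<cdot>\<^sub>m (M ^\<^sub>m k)) * (s \<cdot>\<^sub>m M)" using Suc by simp
  also have "\<dots> = s ^ k \<cdot>\<^sub>m (M ^\<^sub>m k * (s \<cdot>\<^sub>m M))" using assms by (intro mult_smult_assoc_mat) auto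
  also have "M ^\<^sub>m k * (s \<cdot>\<^sub>m M) = s \<cdot>\<^sub>m (M ^\<^sub>m k * M)" using assms by (intro mult_smult_distrib) auto
  finally show ?case by (intro eq_matI) (use assms in auto)
qed (use assms in \<open>auto intro!: eq_matI\<close>)

lemma lin_dependent_powers_smult:
  assumes "M \<in> carrier_mat n n" "s \<noteq> 0" "lin_dependent_powers d M"
  shows "lin_dependent_powers d (s \<cdot>\<^sub>m M)"
proof -
  obtain c where c: "\<exists>k\<le>d. c k \<noteq> 0"
    "\<And>i j. i < n \<Longrightarrow> j < n \<Longrightarrow> (\<Sum>k\<le>d. c k * index_mat (M ^\<^sub>m k) (i, j)) = 0"
    using assms unfolding lin_dependent_powers_def by auto
  have "(\<Sum>k\<le>d. c k / s ^ k * index_mat ((s \<cdot>\<^sub>m M) ^\<^sub>m k) (i, j)) = 0" if "i < n" "j < n" for i j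
  proof -
    have "c k / s ^ k * index_mat ((s \<cdot>\<^sub>m M) ^\<^sub>m k) (i, j) = c k * index_mat (M ^\<^sub>m k) (i, j)" for k
      using assms that pow_carrier_mat[OF assms(1), of k] by (simp add: pow_mat_smult[OF assms(1)])
    then show ?thesis using c(2)[OF that] by simp
  qed
  moreover have "\<exists>k\<le>d. c k / s ^ k \<noteq> 0" using c(1) assms(2) by simp
  ultimately show ?thesis using assms(1)
    unfolding lin_dependent_powers_def by (intro exI[of _ "\<lambda>k. c k / s ^ k"]) auto
qed

lemma pow_mat_inverse:
  assumes "M \<in> carrier_mat n n" "N \<in> carrier_mat n n" "N * M = 1\<^sub>m n"
  shows "N ^\<^sub>m (l + k) * M ^\<^sub>m k = (N ^\<^sub>m l :: complex mat)"
proof (induction k)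
  case (Suc k)
  have comm: "M ^\<^sub>m Suc k = M * M ^\<^sub>m k"
  proof (induction k)
    case (Suc k)
    have "M ^\<^sub>m Suc (Suc k) = (M * M ^\<^sub>m k) * M" using Suc by simp
    also have "\<dots> = M * (M ^\<^sub>m k * M)" using assms by (intro assoc_mult_mat[of _ n n _ n _ n]) auto
    finally show ?case by simp
  qed (use assms in simp)
  have "N ^\<^sub>m (l + Suc k) * M ^\<^sub>m Suc k = (N ^\<^sub>m (l + k) * N) * (M * M ^\<^sub>m k)" unfolding comm by simp
  also have "\<dots> = N ^\<^sub>m (l + k) * (N * (M * M ^\<^sub>m k))" using assms by (intro assoc_mult_mat[of _ n n _ n _ n]) auto
  also have "N * (M * M ^\<^sub>m k) = (N * M) * M ^\<^sub>m k" using assms by (intro assoc_mult_mat[of _ n n _ n _ n, symmetric]) auto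
  also have "\<dots> = M ^\<^sub>m k" using assms by simp
  finally show ?case using Suc by simp
qed (use assms in \<open>simp add: right_mult_one_mat[OF pow_carrier_mat]\<close>)

text \<open>Multiplying a relation between 1, M, ..., M^d by N^d turns it into a relation between
  powers of N with the coefficients in reverse order.\<close>

lemma lin_dependent_powers_inverse:
  assumes "M \<in> carrier_mat n n" "N \<in> carrier_mat n n" "N * M = 1\<^sub>m n" "lin_dependent_powers d M"
  shows "lin_dependent_powers d N"
proof -
  obtain c where c: "\<exists>k\<le>d. c k \<noteq> 0"
    "\<And>i j. i < n \<Longrightarrow> j < n \<Longrightarrow> (\<Sum>k\<le>d. c k * index_mat (M ^\<^sub>m k) (i, j)) = 0"
    using assms unfolding lin_dependent_powers_def by auto
  have "(\<Sum>k\<le>d. c (d - k) * index_mat (N ^\<^sub>m k) (i, j)) = 0" if "i < n" "j < n" for i j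
  proof -
    have "(\<Sum>k\<le>d. c (d - k) * index_mat (N ^\<^sub>m k) (i, j)) = (\<Sum>k\<le>d. c k * index_mat (N ^\<^sub>m (d - k)) (i, j))"
      by (rule sum.reindex_bij_witness[of _ "\<lambda>k. d - k" "\<lambda>k. d - k"]) auto
    also have "\<dots> = (\<Sum>k\<le>d. c k * index_mat (N ^\<^sub>m d * M ^\<^sub>m k) (i, j))"
    proof (intro sum.cong refl)
      fix k assume "k \<in> {..d}"
      then show "c k * index_mat (N ^\<^sub>m (d - k)) (i, j) = c k * index_mat (N ^\<^sub>m d * M ^\<^sub>m k) (i, j)"
        using pow_mat_inverse[OF assms(1-3), of "d - k" k] by simp
    qed
    also have "\<dots> = 0"
      by (rule sum_mult_left_eq_0[OF pow_carrier_mat[OF assms(2)] _ c(2) that]) (use assms in auto)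
    finally show ?thesis .
  qed
  moreover have "\<exists>k\<le>d. c (d - k) \<noteq> 0" using c(1) by (metis diff_diff_cancel diff_le_self)
  ultimately show ?thesis using assms(2)
    unfolding lin_dependent_powers_def by (intro exI[of _ "\<lambda>k. c (d - k)"]) auto
qed

text \<open>A property weaker than being a conjugacy class that every elementary step preserves
  visibly and that still determines the leg. The invertible element keeps the class nonempty after
  inversion, so that the choice made in \<open>leg_length\<close> remains meaningful.\<close>

definition leg_class :: "nat \<Rightarrow> nat \<Rightarrow> complex mat set \<Rightarrow> bool" where
  "leg_class n l C \<longleftrightarrow> (\<exists>M\<in>C. invertible_mat M) \<and>
     (\<forall>M\<in>C. M \<in> carrier_mat n n \<and> Polynomial.degree (minimal_poly M) = l)"

lemma leg_class_conj_class:
  assumes "is_conj_class n C"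
  shows "leg_class n (leg_length C) C"
proof -
  obtain M where M: "M \<in> carrier_mat n n" "invertible_mat M" "C = {N. similar_mat N M}"
    using assms by (auto simp: is_conj_class_def)
  have car: "N \<in> carrier_mat n n" if "similar_mat N M" for N
    using similar_matD[OF that] M(1) by auto
  have eq: "Polynomial.degree (minimal_poly N) = Polynomial.degree (minimal_poly M)" if "similar_mat N M" for N
    using lin_dependent_powers_similar that similar_mat_sym by (intro degree_minimal_poly_cong) blast
  have "M \<in> C" using M similar_mat_refl by blast
  then have "(SOME N. N \<in> C) \<in> C" by (rule someI)
  then have l: "leg_length C = Polynomial.degree (minimal_poly M)"
    unfolding leg_length_def using eq M(3) by blast
  show ?thesis
    unfolding leg_class_def
  proof (intro conjI ballI)
    show "\<exists>M\<in>C. invertible_mat M" using M(2) \<open>M \<in> C\<close> by blast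
    fix N assume "N \<in> C"
    then have N: "similar_mat N M" using M(3) by blast
    show "N \<in> carrier_mat n n" by (rule car[OF N])
    show "Polynomial.degree (minimal_poly N) = leg_length C" unfolding l by (rule eq[OF N])
  qed
qed

lemma leg_class_leg_length: "leg_class n l C \<Longrightarrow> leg_length C = l"
  unfolding leg_class_def leg_length_def by (metis someI)

lemma leg_class_smult:
  assumes "leg_class n l C" "s \<noteq> 0"
  shows "leg_class n l (class_smult s C)"
proof -
  have eq: "Polynomial.degree (minimal_poly (s \<cdot>\<^sub>m M)) = l" if "M \<in> C" for M
  proof -
    have M: "M \<in> carrier_mat n n" "Polynomial.degree (minimal_poly M) = l" using assms that by (auto simp: leg_class_def)
    have "inverse s \<cdot>\<^sub>m (s \<cdot>\<^sub>m M) = M" using assms(2) by (intro eq_matI) auto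
    then have "lin_dependent_powers d (s \<cdot>\<^sub>m M) \<longleftrightarrow> lin_dependent_powers d M" for d
      using lin_dependent_powers_smult[of M n s d] lin_dependent_powers_smult[of "s \<cdot>\<^sub>m M" n "inverse s" d] M assms(2)
      by auto
    then show ?thesis using M(2) degree_minimal_poly_cong by metis
  qed
  obtain M where M: "M \<in> C" "invertible_mat M" using assms by (auto simp: leg_class_def)
  have car: "M \<in> carrier_mat n n" using M assms by (auto simp: leg_class_def)
  obtain N where N: "inverts_mat M N" "inverts_mat N M" using M(2) by (auto simp: invertible_mat_def)
  have "dim_col N = n" "dim_row N = n"
    using arg_cong[OF N(1)[unfolded inverts_mat_def], of dim_col] arg_cong[OF N(2)[unfolded inverts_mat_def], of dim_col] car
    by auto
  then have Nc: "N \<in> carrier_mat n n" by auto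
  have MN: "M * N = 1\<^sub>m n" "N * M = 1\<^sub>m n" using N car Nc by (auto simp: inverts_mat_def)
  have "(s \<cdot>\<^sub>m M) * (inverse s \<cdot>\<^sub>m N) = 1\<^sub>m n"
  proof -
    have "(s \<cdot>\<^sub>m M) * (inverse s \<cdot>\<^sub>m N) = s \<cdot>\<^sub>m (M * (inverse s \<cdot>\<^sub>m N))" using car Nc by (intro mult_smult_assoc_mat) auto
    also have "M * (inverse s \<cdot>\<^sub>m N) = inverse s \<cdot>\<^sub>m (M * N)" using car Nc by (intro mult_smult_distrib) auto
    finally show ?thesis using assms(2) unfolding MN by (intro eq_matI) auto
  qed
  moreover have "(inverse s \<cdot>\<^sub>m N) * (s \<cdot>\<^sub>m M) = 1\<^sub>m n"
  proof -
    have "(inverse s \<cdot>\<^sub>m N) * (s \<cdot>\<^sub>m M) = inverse s \<cdot>\<^sub>m (N * (s \<cdot>\<^sub>m M))" using car Nc by (intro mult_smult_assoc_mat) auto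
    also have "N * (s \<cdot>\<^sub>m M) = s \<cdot>\<^sub>m (N * M)" using car Nc by (intro mult_smult_distrib) auto
    finally show ?thesis using assms(2) unfolding MN by (intro eq_matI) auto
  qed
  ultimately have "invertible_mat (s \<cdot>\<^sub>m M)"
    unfolding invertible_mat_def inverts_mat_def using car Nc by (auto intro!: exI[of _ "inverse s \<cdot>\<^sub>m N"])
  then show ?thesis using eq M(1) assms(1) unfolding leg_class_def class_smult_def by auto
qed

lemma leg_class_inverse:
  assumes "leg_class n l C"
  shows "leg_class n l (class_inverse C)"
proof -
  have key: "N \<in> carrier_mat n n \<and> Polynomial.degree (minimal_poly N) = l"
    if "M \<in> C" "inverts_mat M N" "inverts_mat N M" for M N
  proof -
    have M: "M \<in> carrier_mat n n" "Polynomial.degree (minimal_poly M) = l" using assms that by (auto simp: leg_class_def)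
    have "dim_col N = n" "dim_row N = n"
      using arg_cong[OF that(2)[unfolded inverts_mat_def], of dim_col] arg_cong[OF that(3)[unfolded inverts_mat_def], of dim_col] M
      by auto
    then have N: "N \<in> carrier_mat n n" by auto
    have MN: "M * N = 1\<^sub>m n" "N * M = 1\<^sub>m n" using that M N by (auto simp: inverts_mat_def)
    have "lin_dependent_powers d N \<longleftrightarrow> lin_dependent_powers d M" for d
      using lin_dependent_powers_inverse[OF M(1) N MN(2)] lin_dependent_powers_inverse[OF N M(1) MN(1)] by blast
    then show ?thesis using N M(2) degree_minimal_poly_cong by metis
  qed
  obtain M where M: "M \<in> C" "invertible_mat M" using assms by (auto simp: leg_class_def)
  obtain N where N: "inverts_mat M N" "inverts_mat N M" using M(2) by (auto simp: invertible_mat_def)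
  have "square_mat N" using key[OF M(1) N] by auto
  then have "invertible_mat N" using N by (auto simp: invertible_mat_def)
  then show ?thesis using key M(1) N unfolding leg_class_def class_inverse_def by auto
qed

lemma elem_circle_leg_class:
  assumes "elem_circle E c \<phi> d" "leg_class n l C"
  shows "leg_class n l (\<phi> C)"
  using assms(1) by cases (use assms(2) leg_class_smult leg_class_inverse in simp_all)

section \<open>Formal data\<close>

lemma circle_irr_unique:
  assumes "circ a p = circ b q" "exp_factor p" "exp_factor q"
  shows "irr p = irr q" "slope p = slope q" "p = 0 \<longleftrightarrow> q = 0"
proof -
  have o: "p \<in> galois_orbit q" using assms circ_eq_iff by blast
  show i: "irr p = irr q" using irr_conjugate[OF assms(3) o] .
  then show "slope p = slope q" using ram_conjugate[OF o] by (simp add: slope_def)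
  have "irr s = 0 \<longleftrightarrow> s = 0" if "exp_factor s" for s using irr_pos[OF that] by (cases "s = 0") auto
  then show "p = 0 \<longleftrightarrow> q = 0" using i assms by metis
qed

lemma slope_single_1: "slope (Poly_Mapping.single 1 \<alpha>) = (if \<alpha> = 0 then 0 else 1)"
proof (cases "\<alpha> = 0")
  case False
  then show ?thesis using slope_eqI[of "Poly_Mapping.single 1 \<alpha>" 1] by (simp add: exp_factor_single)
qed simp

lemma slope_small:
  assumes "exp_factor q" "slope q < 1"
  shows "slope (Poly_Mapping.single 1 \<alpha> + q) \<le> 1"
proof (cases "Poly_Mapping.single 1 \<alpha> + q = 0")
  case False
  have e: "exp_factor (Poly_Mapping.single 1 \<alpha> + q)" using assms by (intro exp_factor_add exp_factor_single) auto
  have "l \<le> 1" if "l \<in> keys q" for l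
    using slope_max(2)[OF assms(1) _ that] assms(2) that by (cases "q = 0") auto
  then show ?thesis using slope_max(1)[OF e False] keys_add[of "Poly_Mapping.single 1 \<alpha>" q]
    by (auto split: if_splits)
qed simp

text \<open>Splitting off the linear term commutes with conjugation: it does not affect the
  ramification, and exponent 1 occurs in neither remainder. Hence the remainders are themselves
  conjugate, and the sign in the Fourier rule for small slope depends on the circle only.\<close>

lemma small_slope_circle_irr:
  assumes q: "exp_factor q" "slope q < 1" and p: "exp_factor p" "slope p < 1"
    and eq: "circ Inf (Poly_Mapping.single 1 \<alpha> + q) = circ Inf (Poly_Mapping.single 1 \<beta> + p)"
  shows "irr q = irr p" "q = 0 \<longleftrightarrow> p = 0"
proof -
  define s where "s = Poly_Mapping.single 1 \<alpha> + q"
  define t where "t = Poly_Mapping.single 1 \<beta> + p"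
  have e: "exp_factor s" "exp_factor t" unfolding s_def t_def using q p by (auto intro!: exp_factor_add exp_factor_single)
  have r: "ram s = ram q" "ram t = ram p" unfolding s_def t_def by (rule ram_add_integral, simp)+
  have "s \<in> galois_orbit t" using eq e circ_eq_iff unfolding s_def t_def by blast
  then obtain \<omega> where w: "s = subst_root \<omega> t" "\<omega> ^ ram t = 1" by (auto simp: galois_orbit_def)
  have nz: "\<omega> \<noteq> 0" using root_nonzero[OF w(2)] .
  have n1: "1 \<notin> keys q" "1 \<notin> keys p"
  proof -
    show "1 \<notin> keys q" using slope_max(2)[OF q(1), of 1] q(2) by (cases "q = 0") auto
    show "1 \<notin> keys p" using slope_max(2)[OF p(1), of 1] p(2) by (cases "p = 0") auto
  qed
  have lq: "lookup q k = (if k = 1 then 0 else lookup s k)" for k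
    using n1 by (auto simp: s_def lookup_add lookup_single when_def in_keys_iff)
  have lp: "lookup p k = (if k = 1 then 0 else lookup t k)" for k
    using n1 by (auto simp: t_def lookup_add lookup_single when_def in_keys_iff)
  have rr: "ram q = ram p" using r w nz ram_subst_root by metis
  have ep: "expo t k = expo p k" for k by (simp add: expo_def r)
  have "q = subst_root \<omega> p"
    by (rule poly_mapping_eqI) (simp add: lq lp w(1) lookup_subst_root ep)
  then have "q \<in> galois_orbit p" using w(2) r by (auto simp: galois_orbit_def)
  then have "circ Inf q = circ Inf p" using circ_eq_iff q p by blast
  then show "irr q = irr p" "q = 0 \<longleftrightarrow> p = 0" using circle_irr_unique q p by blast+
qed

text \<open>Base point, slope and vanishing of the factor separate the Fourier rules from one
  another, and \<open>irr\<close> is constant on a circle. Without this, \<open>elem_data\<close>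
  could impose contradictory conditions on the monodromy of the image.\<close>

lemma elem_circle_monodromy_unique:
  assumes "elem_circle E c \<phi> d" "elem_circle E c \<psi> d'"
  shows "\<phi> = \<psi>"
proof (cases "E = Fourier")
  case False
  have "\<theta> = id" if "elem_circle E c \<theta> e" for \<theta> e
    using that by cases (use False in auto)
  then show ?thesis using assms by blast
next
  case True
  have e1: "exp_factor (Poly_Mapping.single 1 \<alpha>)" for \<alpha> by (rule exp_factor_single) simp
  have es: "exp_factor (Poly_Mapping.single 1 \<alpha> + q)" if "exp_factor q" for q \<alpha>
    using that e1 by (intro exp_factor_add)
  have s1: "slope (Poly_Mapping.single 1 \<alpha>) \<le> 1" for \<alpha> by (simp add: slope_single_1)
  have base: "a = b" if "circ a p = circ b q" "exp_factor p" "exp_factor q" for a b p q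
    using that circ_eq_iff by blast
  show ?thesis using assms(1)
  proof cases
    case (fourier_large_slope q q')
    note q = this
    show ?thesis using assms(2)
    proof cases
      case (fourier_large_slope p p')
      then show ?thesis using q circle_irr_unique(1) by metis
    next
      case (fourier_tame_inf \<alpha>)
      then show ?thesis using q circle_irr_unique(2)[of Inf q Inf "Poly_Mapping.single 1 \<alpha>"] e1 s1[of \<alpha>] by auto
    next
      case (fourier_small_slope p \<alpha> p')
      then show ?thesis using q circle_irr_unique(2)[of Inf q Inf "Poly_Mapping.single 1 \<alpha> + p"] es slope_small[of p \<alpha>] by auto
    qed (use q base exp_factor_0 in \<open>blast+\<close>)
  next
    case (fourier_fin q a q')
    note q = this
    show ?thesis using assms(2)
    proof cases
      case (fourier_fin p b p')
      then show ?thesis using q circle_irr_unique(1) by metis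
    next
      case (fourier_tame_fin b)
      then show ?thesis using q circle_irr_unique(3) exp_factor_0 by metis
    qed (use q base e1 es in \<open>blast+\<close>)
  next
    case (fourier_tame_fin a)
    note q = this
    show ?thesis using assms(2)
    proof cases
      case (fourier_fin p b p')
      then show ?thesis using q circle_irr_unique(3) exp_factor_0 by metis
    qed (use q base e1 es exp_factor_0 in \<open>blast+\<close>)
  next
    case (fourier_tame_inf \<alpha>)
    note q = this
    show ?thesis using assms(2)
    proof cases
      case (fourier_large_slope p p')
      then show ?thesis using q circle_irr_unique(2)[of Inf p Inf "Poly_Mapping.single 1 \<alpha>"] e1 s1[of \<alpha>] by auto
    next
      case (fourier_small_slope p \<beta> p')
      then have "circ Inf (Poly_Mapping.single 1 \<alpha> + 0) = circ Inf (Poly_Mapping.single 1 \<beta> + p)" using q by simp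
      then have "p = 0" using small_slope_circle_irr(2)[of 0 p \<alpha> \<beta>] fourier_small_slope by simp
      then show ?thesis using fourier_small_slope by simp
    qed (use q base e1 exp_factor_0 in \<open>blast+\<close>)
  next
    case (fourier_small_slope q \<alpha> q')
    note q = this
    show ?thesis using assms(2)
    proof cases
      case (fourier_large_slope p p')
      then show ?thesis using q circle_irr_unique(2)[of Inf p Inf "Poly_Mapping.single 1 \<alpha> + q"] es slope_small[of q \<alpha>] by auto
    next
      case (fourier_tame_inf \<beta>)
      then have "circ Inf (Poly_Mapping.single 1 \<beta> + 0) = circ Inf (Poly_Mapping.single 1 \<alpha> + q)" using q by simp
      then have "q = 0" using small_slope_circle_irr(2)[of 0 q \<beta> \<alpha>] q by simp
      then show ?thesis using q by simp
    next
      case (fourier_small_slope p \<beta> p')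
      then show ?thesis using q small_slope_circle_irr(1)[of q p \<alpha> \<beta>] by simp
    qed (use q base es exp_factor_0 in \<open>blast+\<close>)
  qed (use True in auto)
qed

text \<open>The data are pulled back along a chosen preimage. By left uniqueness of
  \<open>circle_rel\<close> and uniqueness of the map on monodromy the choice is forced, so all
  conditions of \<open>elem_data\<close> are met at once.\<close>

lemma elem_data_exists:
  assumes "elem_matrix E \<in> SL2"
  shows "\<exists>D'. elem_data E D D'"
proof -
  define pre where "pre = (\<lambda>c'. SOME (c, \<phi>). elem_circle E c \<phi> c')"
  define D' where "D' = \<lparr>multiplicity = (\<lambda>c'. if \<exists>c \<phi>. elem_circle E c \<phi> c' then multiplicity D (fst (pre c')) else 0),
     monodromy = (\<lambda>c'. (snd (pre c')) (monodromy D (fst (pre c'))))\<rparr>"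
  have pre: "elem_circle E (fst (pre c')) (snd (pre c')) c'" if "elem_circle E c \<phi> c'" for c \<phi> c'
    using someI[of "\<lambda>(c, \<phi>). elem_circle E c \<phi> c'" "(c, \<phi>)"] that unfolding pre_def by (auto simp: case_prod_beta)
  have eq: "fst (pre c') = c \<and> snd (pre c') = \<phi>" if e: "elem_circle E c \<phi> c'" for c \<phi> c'
  proof -
    have "fst (pre c') = c"
      using circle_rel_left_unique[OF assms elem_circle_rel[OF pre[OF e]] elem_circle_rel[OF e]] .
    then show ?thesis using elem_circle_monodromy_unique pre[OF e] e by metis
  qed
  have "elem_data E D D'"
    unfolding elem_data_def
  proof (intro conjI allI impI ballI)
    fix c \<phi> c' assume e: "elem_circle E c \<phi> c'"
    then show "multiplicity D' c' = multiplicity D c" using eq[OF e] by (auto simp: D'_def)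
    show "monodromy D' c' = \<phi> (monodromy D c)" using eq[OF e] by (simp add: D'_def)
  next
    fix c' assume a: "c' \<in> active D'"
    then obtain c \<phi> where e: "elem_circle E c \<phi> c'" by (auto simp: active_def D'_def split: if_splits)
    then have "c \<in> active D" using a eq[OF e] by (auto simp: active_def D'_def split: if_splits)
    then show "\<exists>c\<in>active D. \<exists>\<phi>. elem_circle E c \<phi> c'" using e by blast
  qed
  then show ?thesis ..
qed

text \<open>Although the factorization is arbitrary, the effect on circles and leg lengths only depends on the matrix.\<close>

lemma acts_properties:
  assumes "acts A D D'" "is_formal_data D"
  shows "A \<in> SL2 \<and>
    (\<forall>c. \<exists>c'. circle_rel A c c' \<and> multiplicity D' c' = multiplicity D c) \<and>
    (\<forall>c'\<in>active D'. \<exists>c\<in>active D. circle_rel A c c') \<and>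
    (\<forall>c\<in>active D. \<forall>c'. circle_rel A c c' \<longrightarrow>
       leg_class (multiplicity D c) (leg_length (monodromy D c)) (monodromy D' c'))"
  using assms
proof induction
  case (acts_one D)
  have "Finite_Cartesian_Product.mat 1 \<in> SL2" by (simp add: SL2_def)
  moreover have "leg_class (multiplicity D c) (leg_length (monodromy D c)) (monodromy D c')"
    if "c \<in> active D" "circle_rel (Finite_Cartesian_Product.mat 1) c c'" for c c'
    using that acts_one circle_rel_one_eq[OF that(2)] leg_class_conj_class by (auto simp: is_formal_data_def)
  ultimately show ?case using circle_rel_one by blast
next
  case (acts_step A D D' E D'')
  then have A: "A \<in> SL2" by blast
  have tot: "\<exists>d. circle_rel A c d \<and> multiplicity D' d = multiplicity D c" for c using acts_step by blast
  have ed: "elem_data E D' D''" "elem_matrix E \<in> SL2" using acts_step by simp_all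
  have step: "\<exists>d' \<phi>. elem_circle E d \<phi> d' \<and> circle_rel (elem_matrix E) d d' \<and> multiplicity D'' d' = multiplicity D' d \<and>
      (d \<in> active D' \<longrightarrow> monodromy D'' d' = \<phi> (monodromy D' d))" for d
  proof -
    obtain \<phi> d' where e: "elem_circle E d \<phi> d'" using elem_circle_total[OF ed(2)] by blast
    then show ?thesis using ed(1) elem_circle_rel[OF e] unfolding elem_data_def by blast
  qed
  have AE: "elem_matrix E ** A \<in> SL2" using SL2_mult ed(2) A by blast
  have 1: "\<exists>c'. circle_rel (elem_matrix E ** A) c c' \<and> multiplicity D'' c' = multiplicity D c" for c
    using tot[of c] step circle_rel_mult[OF A ed(2)] by metis
  have 2: "\<exists>c\<in>active D. circle_rel (elem_matrix E ** A) c c'" if c': "c' \<in> active D''" for c'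
  proof -
    obtain d \<phi> where d: "d \<in> active D'" "elem_circle E d \<phi> c'" using ed(1) c' unfolding elem_data_def by blast
    then obtain c where "c \<in> active D" "circle_rel A c d" using acts_step by blast
    then show ?thesis using circle_rel_mult[OF A ed(2)] elem_circle_rel[OF d(2)] by blast
  qed
  have 3: "leg_class (multiplicity D c) (leg_length (monodromy D c)) (monodromy D'' c')"
    if c: "c \<in> active D" "circle_rel (elem_matrix E ** A) c c'" for c c'
  proof -
    obtain d where d: "circle_rel A c d" "multiplicity D' d = multiplicity D c" using tot by blast
    then have dD: "d \<in> active D'" using c by (simp add: active_def)
    obtain d' \<phi> where d': "elem_circle E d \<phi> d'" "circle_rel (elem_matrix E) d d'" "monodromy D'' d' = \<phi> (monodromy D' d)"
      using step[of d] dD by blast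
    \<comment> \<open>The circle c' is known only through the product matrix; right uniqueness
      identifies it with the one reached step by step, whose monodromy is controlled.\<close>
    have "d' = c'" using circle_rel_right_unique[OF AE circle_rel_mult[OF A ed(2) d(1) d'(2)] c(2)] .
    moreover have "leg_class (multiplicity D c) (leg_length (monodromy D c)) (monodromy D' d)" using acts_step c(1) d(1) by blast
    ultimately show ?thesis using elem_circle_leg_class[OF d'(1)] d'(3) by simp
  qed
  show ?case using AE 1 2 3 by blast
qed

lemma acts_diagram_iso:
  assumes "acts A D D'" "is_formal_data D" "supported_at_infinity D" "supported_at_infinity D'" "A$2$1 \<noteq> 0"
  shows "diagram_iso (full_diagram D) (full_diagram D')"
proof -
  note P = acts_properties[OF assms(1,2)]
  have A: "A \<in> SL2" using P by blast
  obtain T where T: "\<And>c. circle_rel A c (T c)" "\<And>c. multiplicity D' (T c) = multiplicity D c"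
    using P by metis
  have act: "T c \<in> active D' \<longleftrightarrow> c \<in> active D" for c using T by (simp add: active_def)
  have inj: "T c = T d \<Longrightarrow> c = d" for c d using circle_rel_left_unique[OF A] T(1) by metis
  have surj: "\<exists>c\<in>active D. c' = T c" if "c' \<in> active D'" for c'
    using P that circle_rel_right_unique[OF A] T(1) by blast
  have leg: "leg_length (monodromy D' (T c)) = leg_length (monodromy D c)" if "c \<in> active D" for c
    using P that T(1) leg_class_leg_length by blast
  have B: "B_num (T c) (T d) = B_num c d" if "c \<in> active D" "d \<in> active D" for c d
  proof -
    have inf: "\<exists>q. e = circ Inf q \<and> exp_factor q" if "base_point e = Inf" for e
      using circle_cases[of e] base_point_circ that by metis
    have "base_point c = Inf" "base_point d = Inf" "base_point (T c) = Inf" "base_point (T d) = Inf"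
      using assms(3,4) that act by (auto simp: supported_at_infinity_def)
    then obtain p q p' q' where "c = circ Inf p" "d = circ Inf q" "T c = circ Inf p'" "T d = circ Inf q'"
      "exp_factor p" "exp_factor q" "exp_factor p'" "exp_factor q'" using inf by metis
    then show ?thesis using B_num_invariant[OF A assms(5)] T(1) by metis
  qed
  define f where "f = (\<lambda>(c, l :: nat). (T c, l))"
  have nodes: "fst (full_diagram X) = {(c, l). c \<in> active X \<and> 1 \<le> l \<and> l \<le> leg_length (monodromy X c)}" for X
    by (simp add: full_diagram_def)
  have "bij_betw f (fst (full_diagram D)) (fst (full_diagram D'))"
    unfolding bij_betw_def
  proof
    show "inj_on f (fst (full_diagram D))" by (rule inj_onI) (auto simp: f_def dest: inj)
    show "f ` fst (full_diagram D) = fst (full_diagram D')"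
    proof (intro equalityI subsetI)
      fix x assume "x \<in> f ` fst (full_diagram D)"
      then show "x \<in> fst (full_diagram D')" by (auto simp: nodes f_def act leg)
    next
      fix x assume "x \<in> fst (full_diagram D')"
      then obtain c' l where x: "x = (c', l)" "c' \<in> active D'" "1 \<le> l" "l \<le> leg_length (monodromy D' c')"
        by (auto simp: nodes)
      then obtain c where "c \<in> active D" "c' = T c" using surj by blast
      then have "(c, l) \<in> fst (full_diagram D)" "x = f (c, l)" using x leg by (auto simp: nodes f_def)
      then show "x \<in> f ` fst (full_diagram D)" by blast
    qed
  qed
  moreover have "snd (full_diagram D') (f x) (f y) = snd (full_diagram D) x y"
    if "x \<in> fst (full_diagram D)" "y \<in> fst (full_diagram D)" for x y
  proof -
    obtain c l where x: "x = (c, l)" by (cases x)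
    obtain d m where y: "y = (d, m)" by (cases y)
    have "c \<in> active D" "d \<in> active D" using that by (simp_all add: nodes x y)
    moreover have "T c = T d \<longleftrightarrow> c = d" using inj by blast
    ultimately show ?thesis using B by (simp add: full_diagram_def f_def x y)
  qed
  ultimately show ?thesis unfolding diagram_iso_def by blast
qed

section \<open>Generic matrices\<close>

text \<open>The limit of \<open>\<xi>/z\<close> along the germ of \<open>q\<close>, for slope at most 2.\<close>

definition direction :: "puiseux \<Rightarrow> complex" where
  "direction q = Dexp Inf q $$ (- int (ram q))"

text \<open>At t^(-r), where r is the ramification, z contributes \<alpha> and xi contributes
  \<beta> times \<open>direction q\<close>. A nonzero coefficient there forces a pole of order at
  least r, also when the slope exceeds 2 and xi has a larger pole.\<close>

lemma pole_first_coordinate: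
  assumes "exp_factor q" "\<beta> \<noteq> 0" "\<alpha> + \<beta> * direction q \<noteq> 0"
  shows "fls_subdegree (fls_const \<alpha> * fst (germ Inf q) + fls_const \<beta> * snd (germ Inf q)) < 0"
proof -
  define r where "r = ram q"
  have r: "r \<ge> 1" using ram_pos[of q] by (simp add: r_def)
  have "(fls_const \<alpha> * fst (germ Inf q) + fls_const \<beta> * snd (germ Inf q)) $$ (- int r) = \<alpha> + \<beta> * direction q"
    by (simp add: germ_def coord_eq direction_def r_def)
  then have "(fls_const \<alpha> * fst (germ Inf q) + fls_const \<beta> * snd (germ Inf q)) $$ (- int r) \<noteq> 0"
    using assms(3) by simp
  then have "fls_subdegree (fls_const \<alpha> * fst (germ Inf q) + fls_const \<beta> * snd (germ Inf q)) \<le> - int r"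
    by (rule fls_subdegree_leI)
  then show ?thesis using r by simp
qed

text \<open>The new first coordinate d z - c xi has a pole, equivalence of germs preserves its polar
  terms, and at a finite point the function z has none.\<close>

lemma circle_rel_at_infinity:
  assumes "A \<in> SL2" "exp_factor q" "A$2$1 \<noteq> 0" "A$2$2 - A$2$1 * direction q \<noteq> 0"
    "circle_rel A (circ Inf q) d"
  shows "base_point d = Inf"
proof -
  obtain b p where d: "d = circ b p" "exp_factor p" by (rule circle_cases)
  have "germ_equiv (act A (germ Inf q)) (germ b p)" using assms d circle_rel_circ by blast
  then obtain g where g: "1 \<le> pole (act A (germ Inf q))" "subdegree g = 1"
    "near (pole (act A (germ Inf q))) (gcomp (germ b p) g) (act A (germ Inf q))"
    by (auto simp: germ_equiv_def)
  define f where "f = fst (act A (germ Inf q))"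
  have "f = fls_const (A$2$2) * fst (germ Inf q) + fls_const (- A$2$1) * snd (germ Inf q)"
    by (simp add: f_def act_def)
  then have f: "fls_subdegree f < 0" using pole_first_coordinate[of q "- A$2$1" "A$2$2"] assms by simp
  then have "f \<noteq> 0" by auto
  then have "f $$ fls_subdegree f \<noteq> 0" by (rule nth_fls_subdegree_nonzero)
  moreover have "(fst (germ b p) \<diamondop> g) $$ fls_subdegree f = f $$ fls_subdegree f"
    using g f by (simp add: near_def gcomp_def ordge_def f_def)
  ultimately have "(fst (germ b p) \<diamondop> g) $$ fls_subdegree f \<noteq> 0" by simp
  then have "fls_subdegree (fst (germ b p) \<diamondop> g) \<le> fls_subdegree f" by (rule fls_subdegree_leI)
  then have "fls_subdegree (fst (germ b p)) < 0" using f g(2) by (simp add: fls_subdegree_comp)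
  then have "b = Inf"
  proof (cases b)
    case (Fin x)
    then show ?thesis using fls_subdegree_coord_Fin[of x "ram p"] \<open>fls_subdegree (fst (germ b p)) < 0\<close>
      by (simp add: fst_germ)
  qed
  then show ?thesis using d by simp
qed

text \<open>Bruhat decomposition of the big cell: for A = (a, b; c, d) with c nonzero, A = T(a/c)
  S(-c) F T(d/c).\<close>

lemma acts_exists:
  assumes "A \<in> SL2" "A$2$1 \<noteq> 0"
  shows "\<exists>D'. acts A D D'"
proof -
  define c where "c = A$2$1"
  define E1 where "E1 = Twist (A$2$2 / c)"
  define E2 where "E2 = Scale (- c)"
  define E3 where "E3 = Twist (A$1$1 / c)"
  have S: "elem_matrix E1 \<in> SL2" "elem_matrix E2 \<in> SL2" "elem_matrix E3 \<in> SL2"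
    using assms(2) by (simp_all only: E1_def E2_def E3_def Twist_SL2 Scale_SL2_iff) (simp add: c_def)
  obtain D1 where e1: "elem_data E1 D D1" using elem_data_exists[OF S(1)] by blast
  obtain D2 where e2: "elem_data Fourier D1 D2" using elem_data_exists[OF Fourier_SL2] by blast
  obtain D3 where e3: "elem_data E2 D2 D3" using elem_data_exists[OF S(2)] by blast
  obtain D4 where e4: "elem_data E3 D3 D4" using elem_data_exists[OF S(3)] by blast
  have "acts (elem_matrix E3 ** (elem_matrix E2 ** (elem_matrix Fourier ** (elem_matrix E1 ** Finite_Cartesian_Product.mat 1)))) D D4"
    by (rule acts_step[OF acts_step[OF acts_step[OF acts_step[OF acts_one S(1) e1] Fourier_SL2 e2] S(2) e3] S(3) e4])
  moreover have "elem_matrix E3 ** (elem_matrix E2 ** (elem_matrix Fourier ** (elem_matrix E1 ** Finite_Cartesian_Product.mat 1))) = A"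
  proof -
    have c: "c \<noteq> 0" using assms(2) by (simp add: c_def)
    have det: "A$1$1 * A$2$2 - A$1$2 * c = 1" using assms(1) by (simp add: SL2_iff c_def)
    then have "A$1$2 = (A$1$1 * A$2$2 - 1) / c" using c by (simp add: field_simps)
    then show ?thesis
      using c by (intro mat2_eqI) (simp_all add: mat2_mult_nth mat2_one_nth E1_def E2_def E3_def vector_2 c_def field_simps)
  qed
  ultimately show ?thesis by auto
qed

text \<open>The contragredient matrix sends z to d z - c xi. The values l are limits of xi/z (or the
  coefficients replacing them), so d - c l must not vanish if z is to keep its pole; c must not
  vanish because the intersection argument needs a transversal coordinate.\<close>

definition generic :: "complex set \<Rightarrow> (complex^2^2) set" where
  "generic L = {A \<in> SL2. A$2$1 \<noteq> 0 \<and> (\<forall>l\<in>L. A$2$2 - A$2$1 * l \<noteq> 0)}"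

lemma openin_generic:
  assumes "finite L"
  shows "openin (top_of_set SL2) (generic L)"
proof -
  have "generic L = SL2 \<inter> ({A. A$2$1 \<noteq> 0} \<inter> (\<Inter>l\<in>L. {A. A$2$2 - A$2$1 * l \<noteq> 0}))"
    by (auto simp: generic_def)
  moreover have "open ({A :: complex^2^2. A$2$1 \<noteq> 0} \<inter> (\<Inter>l\<in>L. {A. A$2$2 - A$2$1 * l \<noteq> 0}))"
    using assms by (intro open_Int open_INT ballI open_Collect_neq continuous_intros)
  ultimately show ?thesis by (simp add: openin_open_Int)
qed

text \<open>Along the curve \<open>A \<cdot> B(e)\<close> with \<open>B(e) = (1, e; e, 1 + e\<^sup>2)\<close> the excluded conditions are
  nonzero polynomials in \<open>e\<close>.\<close>

lemma generic_dense:
  assumes "finite L"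
  shows "SL2 \<subseteq> closure (generic L)"
proof
  fix A assume A: "A \<in> SL2"
  define c where "c = A$2$1"
  define d where "d = A$2$2"
  have cd: "c \<noteq> 0 \<or> d \<noteq> 0" using A by (auto simp: SL2_iff c_def d_def)
  define B :: "complex \<Rightarrow> complex^2^2" where
    "B = (\<lambda>e. A ** vector [vector [1, e], vector [e, 1 + e * e]])"
  have B: "B e $ i $ 1 = A$i$1 + A$i$2 * e" "B e $ i $ 2 = A$i$1 * e + A$i$2 * (1 + e * e)" for e i
    by (simp_all add: B_def mat2_mult_nth vector_2)
  have BS: "B e \<in> SL2" for e
  proof -
    have "vector [vector [1, e], vector [e, 1 + e * e]] \<in> SL2" by (simp add: SL2_iff vector_2)
    then show ?thesis unfolding B_def using SL2_mult A by blast
  qed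
  define p where "p = [:c, d:]"
  define q where "q = (\<lambda>l. [:d - c * l, c - d * l, d:])"
  have p0: "p \<noteq> 0" using cd by (auto simp: p_def)
  \<comment> \<open>For d nonzero the quadratic term survives; for d = 0 the linear coefficient is
    c, which is nonzero. A single shear would not do: the lower one fails for d = l = 0 and the
    upper one for c = 0, so B(e) is the product of both.\<close>
  have q0: "q l \<noteq> 0" for l using cd by (auto simp: q_def)
  define bad where "bad = {e. poly p e = 0} \<union> (\<Union>l\<in>L. {e. poly (q l) e = 0})"
  have fin: "finite bad" unfolding bad_def using p0 q0 assms by (auto intro: poly_roots_finite)
  have good: "B e \<in> generic L" if "e \<notin> bad" for e
  proof -
    have 1: "B e $ 2 $ 1 = poly p e" by (simp add: B p_def c_def d_def)
    have 2: "B e $ 2 $ 2 - B e $ 2 $ 1 * l = poly (q l) e" for l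
      by (simp add: B q_def c_def d_def algebra_simps)
    have "poly p e \<noteq> 0" "\<forall>l\<in>L. poly (q l) e \<noteq> 0" using that by (auto simp: bad_def)
    then show ?thesis unfolding generic_def mem_Collect_eq 2 using BS by (simp add: 1)
  qed
  have "(B \<longlongrightarrow> B 0) (at 0)"
  proof -
    have "((\<lambda>e. B e $ i $ j) \<longlongrightarrow> B 0 $ i $ j) (at 0)" for i j
    proof (cases "j = 1")
      case True
      show ?thesis unfolding True B by (intro tendsto_intros)
    next
      case False
      then have "j = 2" using exhaust_2 by blast
      then show ?thesis unfolding B by (auto intro!: tendsto_eq_intros simp: B)
    qed
    then show ?thesis by (intro vec_tendstoI)
  qed
  moreover have "B 0 = A"
    by (rule mat2_eqI) (simp_all add: B)
  ultimately have lim: "(B \<longlongrightarrow> A) (at 0)" by simp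
  have ev: "\<forall>\<^sub>F e in at 0. B e \<in> closure (generic L)"
  proof -
    have "\<forall>\<^sub>F e in at 0. e \<notin> bad"
    proof -
      have "open (- (bad - {0}))" using fin by (intro open_Compl finite_imp_closed) simp
      then have "\<forall>\<^sub>F e in nhds 0. e \<in> - (bad - {0})" by (rule eventually_nhds_in_open) simp
      then have "\<forall>\<^sub>F e in at 0. e \<in> - (bad - {0})" unfolding eventually_at_filter by (rule eventually_mono) auto
      moreover have "\<forall>\<^sub>F e in at (0::complex). e \<noteq> 0" by (simp add: eventually_at_filter)
      ultimately show ?thesis by eventually_elim auto
    qed
    then show ?thesis by (rule eventually_mono) (use good closure_subset in blast)
  qed
  show "A \<in> closure (generic L)"
    using Lim_in_closed_set[OF closed_closure ev _ lim] by simp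
qed

theorem theorem4p10:
  fixes D :: formal_data
  assumes "is_formal_data D" and "supported_at_infinity D"
  shows "\<exists>S. openin (top_of_set SL2) S \<and> SL2 \<subseteq> closure S \<and>
           (\<forall>A\<in>S. (\<exists>D'. acts A D D') \<and>
              (\<forall>D'. acts A D D' \<longrightarrow>
                 supported_at_infinity D' \<and>
                 diagram_iso (full_diagram D) (full_diagram D')))"
proof -
  define rep where "rep = (\<lambda>c. SOME q. exp_factor q \<and> c = circ Inf q)"
  have rep: "exp_factor (rep c) \<and> c = circ Inf (rep c)" if "c \<in> active D" for c
  proof -
    have "base_point c = Inf" using that assms(2) by (simp add: supported_at_infinity_def)
    then have "\<exists>q. exp_factor q \<and> c = circ Inf q" using circle_cases[of c] base_point_circ by metis
    then show ?thesis unfolding rep_def by (rule someI_ex)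
  qed
  \<comment> \<open>\<open>direction q\<close> is twice the coefficient of z^2 in q, which is the
    same for all conjugates; each active circle excludes one value.\<close>
  define L where "L = (\<lambda>c. direction (rep c)) ` active D"
  have fin: "finite L" using assms(1) by (simp add: L_def is_formal_data_def)
  have "supported_at_infinity D' \<and> diagram_iso (full_diagram D) (full_diagram D')"
    if A: "A \<in> generic L" and acts: "acts A D D'" for A D'
  proof -
    have g: "A \<in> SL2" "A$2$1 \<noteq> 0" "\<And>l. l \<in> L \<Longrightarrow> A$2$2 - A$2$1 * l \<noteq> 0"
      using A by (auto simp: generic_def)
    have "base_point c' = Inf" if c': "c' \<in> active D'" for c'
    proof -
      obtain c where c: "c \<in> active D" "circle_rel A c c'" using acts_properties[OF acts assms(1)] c' by blast
      have "direction (rep c) \<in> L" using c by (simp add: L_def)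
      then show ?thesis using circle_rel_at_infinity[OF g(1) _ g(2) g(3)] rep[OF c(1)] c(2) by metis
    qed
    then have "supported_at_infinity D'" by (simp add: supported_at_infinity_def)
    then show ?thesis using acts_diagram_iso[OF acts assms _ g(2)] by blast
  qed
  moreover have "\<exists>D'. acts A D D'" if "A \<in> generic L" for A
    using that acts_exists by (auto simp: generic_def)
  ultimately show ?thesis using openin_generic[OF fin] generic_dense[OF fin] by blast
qed

end
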